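(* Let $\mathscr T$ be a T-mesh with $t$ T $l$-edges, let $M(T(\mathscr T))$ be its global conformality matrix, let $M_1$ be the conformality matrix of the completely non-diagonalizable component (CNDC) of the complete partition, with $s$ T $l$-edges and $m$ multi-vertices, and let $K$ be the condensed coupling matrix. Let $h_d(\mathscr T)$ be Mourrain's homological correction term. Then $$h_d(\mathscr T)=t(d+1)-\operatorname{rank}M(T(\mathscr T))=s(d+1)-\operatorname{rank}M_1=m-\operatorname{rank}K.$$
   Context: Let $d\ge 1$ be an integer. A T-mesh $\mathscr T$ is a partition of a simply connected planar domain $\Phi$ into finitely many axis-aligned rectangles (cells), with T-junctions allowed. Vertices are the grid points of the mesh; a T-junction is an interior vertex of valence 3. An edge is a segment joining two adjacent vertices along a horizontal or vertical grid line; edges are boundary or interior. An $l$-edge is a maximal straight segment composed of collinear contiguous edges whose endpoints are T-junctions or boundary vertices. An interior $l$-edge is a cross-cut if both endpoints lie on the domain boundary, a T $l$-edge if both endpoints are T-junctions, and a ray otherwise. The T-connected component $T(\mathscr T)$ is the set of all T $l$-edges (with the vertices on them). For a T $l$-edge $l$, $n(l)$ is the number of vertices on $l$, endpoints included. Standing assumptions: $T(\mathscr T)$ is connected (assumed without loss of generality), and no T $l$-edge is vanishable, i.e. $n(l)\ge d+2$ for every T $l$-edge $l$. CNDC. A sub-component of $T(\mathscr T)$ is a set of T $l$-edges with the vertices on them. A reasonable order is an ordering $l_1\succ l_2\succ\cdots$ such that for each $i$ the number of vertices remaining on $l_i$ after deleting its intersections with the preceding edges $l_j$, $j<i$, is at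 least $d+1$. $\mathscr T$ is diagonalizable if $T(\mathscr T)$ has a reasonable order. Let $\mathscr T$ be non-diagonalizable. A partition $\{T_1,T_2\}$ of the T $l$-edges, with $T_2=T(\mathscr T)\setminus T_1$ (vertices lying on edges of $T_1$ are deleted from the edges of $T_2$), is regular if $T_1$ has no reasonable order and $T_2$ has one ($T_2$ may be empty). A regular partition is complete if there is no other regular partition $\{T_1',T_2'\}$ with $T_1'$ a proper subset of $T_1$. The complete partition is unique; $T_1=\{l_1,\dots,l_s\}$ is called the CNDC. Let $n_{\textit{CNDC}}$ be the number of vertices lying on edges of $T_1$. A multi-vertex of the CNDC is a vertex that is the intersection of two T $l$-edges of $T_1$ (one horizontal, one vertical); the other vertices are mono-vertices; $m$ is the number of multi-vertices. Conformality matrices. $M(T(\mathscr T))$ has columns indexed by the vertices lying on T $l$-edges and rows indexed by pairs $(l,k)$, $l$ a T $l$-edge, $0\le k\le d$; its entry in row $(l,k)$ and column $v$ is $0$ if $v\notin l$, and $z^k$ if $v\in l$, where $z$ is the $x$-coordinate of $v$ if $l$ is horizontal and the $y$-coordinate of $v$ if $l$ is vertical ($z^0=1$). $M_1\in\mathbb R^{s(d+1)\times n_{\textit{CNDC}}}$ is defined in the same way using only the edges of $T_1$ and the vertices on them. Matrix $K$. Replace each multi-vertex $v_i$ ($1\le i\le m$) by two independent variables $\delta_i^h,\delta_i^v$, attached respectively to the horizontal and vertical edge of $T_1$ through $v_i$; each mono-vertex keeps one variable attached to its unique edge of $T_1$. $K_1$ is the $s(d+1)\times(n_{\textit{CNDC}}+m)$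 block-diagonal matrix with one block per edge $l\in T_1$: the $(d+1)\times n(l)$ Vandermonde matrix with rows $(z_1^k,\dots,z_{n(l)}^k)$, $0\le k\le d$, where the $z_j$ are the $x$-coordinates ($l$ horizontal) or $y$-coordinates ($l$ vertical) of the vertices on $l$, acting on the variables attached to $l$. $K_2$ is the $m\times 2m$ matrix encoding the equations $\delta_i^h-\delta_i^v=0$. Choose a basis of $\ker K_1$, write it as the columns of a matrix, and let $Z$ be its submatrix of the $2m$ rows corresponding to the variables $\delta_i^h,\delta_i^v$. The condensed coupling matrix is $K=K_2Z\in\mathbb R^{m\times(n_{\textit{CNDC}}+m-s(d+1))}$; its rank does not depend on the chosen basis. Homological correction term. Let $R$ be the space of real polynomials in $x,y$ of degree at most $d$ in each variable. For an interior edge $\tau$ on the line $\ell_\tau=0$ ($\ell_\tau=x-a$ or $\ell_\tau=y-b$) let $J(\tau)=\{p\in R:\ \ell_\tau^{\,d}\mid p\}$, and for an interior vertex $\gamma=(a,b)$ let $J(\gamma)=\{p\in R: p=(x-a)^d\}\text{-multiples in }R$ plus $(y-b)^d\text{-multiples in }R$ (the sum of the two subspaces). Orient every interior edge and let $\partial:\bigoplus_{\tau}J(\tau)[\tau]\to\bigoplus_{\gamma}J(\gamma)[\gamma]$ (sums over interior edges and interior vertices) be the map $p[\tau]\mapsto p[\gamma_1]-p[\gamma_0]$, where $\gamma_0,\gamma_1$ are the initial and final endpoints of $\tau$ and terms for boundary vertices are set to $0$. Then $h_d(\mathscr T)=h_{d,d}^{(d-1,d-1)}(\mathscr T)=\dim\operatorname{coker}\partial$.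 Mourrain's dimension formula (known) states $\dim S_d(\mathscr T)=(d+1)^2f_2-d(d+1)f_1^o+d^2f_0+h_d(\mathscr T)$, with $f_2,f_1^o,f_0$ the numbers of cells, interior edges and interior vertices, and $S_d(\mathscr T)$ the space of functions on $\Phi$ of class $C^{d-1,d-1}$ that are polynomials of bi-degree at most $(d,d)$ on each cell. *)

theory Defs
  imports
    "HOL-Analysis.Homotopy"
    "HOL-Computational_Algebra.Polynomial"
    "HOL-Algebra.AbelCoset"
    "Jordan_Normal_Form.Matrix_Kernel"
    "Jordan_Normal_Form.DL_Rank"
    "Jordan_Normal_Form.DL_Submatrix"
begin

section \<open>T-meshes\<close>

type_synonym point = "real \<times> real"

datatype rect = Rect (xlo: real) (xhi: real) (ylo: real) (yhi: real)

definition rect_set :: "rect \<Rightarrow> point set" where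
  "rect_set r = {xlo r..xhi r} \<times> {ylo r..yhi r}"

definition corners :: "rect \<Rightarrow> point set" where
  "corners r = {xlo r, xhi r} \<times> {ylo r, yhi r}"

definition mesh_domain :: "rect set \<Rightarrow> point set" where
  "mesh_domain C = (\<Union>r\<in>C. rect_set r)"

text \<open>
  A T-mesh is given by its set of cells. The domain is the closed region covered by the cells;
  being a simply connected domain is read as: the region is simply connected and its interior
  is connected (so that cells touching only in a corner do not form a mesh by themselves).
\<close>

definition t_mesh :: "rect set \<Rightarrow> bool" where
  "t_mesh C \<longleftrightarrow>
     finite C \<and> C \<noteq> {} \<and>
     (\<forall>r\<in>C. xlo r < xhi r \<and> ylo r < yhi r) \<and>
     (\<forall>r\<in>C. \<forall>r'\<in>C. r \<noteq> r' \<longrightarrow> interior (rect_set r) \<inter> interior (rect_set r') = {}) \<and>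
     simply_connected (mesh_domain C) \<and> connected (interior (mesh_domain C))"

definition vertices :: "rect set \<Rightarrow> point set" where
  "vertices C = (\<Union>r\<in>C. corners r)"

definition interior_vertices :: "rect set \<Rightarrow> point set" where
  "interior_vertices C = vertices C \<inter> interior (mesh_domain C)"

definition boundary_vertices :: "rect set \<Rightarrow> point set" where
  "boundary_vertices C = vertices C \<inter> frontier (mesh_domain C)"

text \<open>
  Edges and \<open>l\<close>-edges are pairs of end points, listed from left to right or from bottom to top;
  this makes the pair determined by the segment and also serves as the orientation of edges.
\<close>

type_synonym seg = "point \<times> point"

definition hseg :: "seg \<Rightarrow> bool" where
  "hseg e \<longleftrightarrow> fst (fst e) < fst (snd e) \<and> snd (fst e) = snd (snd e)"

definition vseg :: "seg \<Rightarrow> bool" where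
  "vseg e \<longleftrightarrow> fst (fst e) = fst (snd e) \<and> snd (fst e) < snd (snd e)"

definition supp :: "seg \<Rightarrow> point set" where
  "supp e = closed_segment (fst e) (snd e)"

definition edges :: "rect set \<Rightarrow> seg set" where
  "edges C = {e. (hseg e \<or> vseg e) \<and> fst e \<in> vertices C \<and> snd e \<in> vertices C \<and>
     supp e \<subseteq> (\<Union>r\<in>C. frontier (rect_set r)) \<and>
     open_segment (fst e) (snd e) \<inter> vertices C = {}}"

definition interior_edges :: "rect set \<Rightarrow> seg set" where
  "interior_edges C = {e \<in> edges C. open_segment (fst e) (snd e) \<subseteq> interior (mesh_domain C)}"

definition valence :: "rect set \<Rightarrow> point \<Rightarrow> nat" where
  "valence C v = card {e \<in> edges C. v = fst e \<or> v = snd e}"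

definition t_junctions :: "rect set \<Rightarrow> point set" where
  "t_junctions C = {v \<in> interior_vertices C. valence C v = 3}"

text \<open>
  Interior \<open>l\<close>-edges consist of interior edges only: on a non-convex domain, a grid line that
  continues along the boundary ends the \<open>l\<close>-edge at a boundary vertex.
\<close>

definition composed_of_edges :: "rect set \<Rightarrow> seg \<Rightarrow> bool" where
  "composed_of_edges C l \<longleftrightarrow> (hseg l \<or> vseg l) \<and>
     (\<exists>E \<subseteq> interior_edges C. supp l = (\<Union>e\<in>E. supp e))"

definition interior_l_edges :: "rect set \<Rightarrow> seg set" where
  "interior_l_edges C = {l. composed_of_edges C l \<and>
     fst l \<in> t_junctions C \<union> boundary_vertices C \<and>
     snd l \<in> t_junctions C \<union> boundary_vertices C \<and>
     (\<forall>l'. composed_of_edges C l' \<and> supp l \<subseteq> supp l' \<longrightarrow> l' = l)}"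

definition t_l_edges :: "rect set \<Rightarrow> seg set" where
  "t_l_edges C = {l \<in> interior_l_edges C. fst l \<in> t_junctions C \<and> snd l \<in> t_junctions C}"

definition verts_on :: "rect set \<Rightarrow> seg \<Rightarrow> point set" where
  "verts_on C l = vertices C \<inter> supp l"

definition verts_of :: "rect set \<Rightarrow> seg set \<Rightarrow> point set" where
  "verts_of C A = (\<Union>l\<in>A. verts_on C l)"

definition t_connected :: "rect set \<Rightarrow> bool" where
  "t_connected C \<longleftrightarrow> connected (\<Union>l\<in>t_l_edges C. supp l)"

definition no_vanishable :: "rect set \<Rightarrow> nat \<Rightarrow> bool" where
  "no_vanishable C d \<longleftrightarrow> (\<forall>l\<in>t_l_edges C. d + 2 \<le> card (verts_on C l))"


section \<open>The completely non-diagonalizable component\<close>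

definition enumerates :: "'a list \<Rightarrow> 'a set \<Rightarrow> bool" where
  "enumerates xs A \<longleftrightarrow> distinct xs \<and> set xs = A"

text \<open>
  The sub-component consists of the edges in \<open>A\<close>, with the vertices in \<open>D\<close> deleted from them.
\<close>

definition has_reasonable_order :: "rect set \<Rightarrow> nat \<Rightarrow> seg set \<Rightarrow> point set \<Rightarrow> bool" where
  "has_reasonable_order C d A D \<longleftrightarrow>
     (\<exists>ls. enumerates ls A \<and>
        (\<forall>i<length ls.
           d + 1 \<le> card (verts_on C (ls ! i) - D - (\<Union>j<i. verts_on C (ls ! j)))))"

definition diagonalizable :: "rect set \<Rightarrow> nat \<Rightarrow> bool" where
  "diagonalizable C d \<longleftrightarrow> has_reasonable_order C d (t_l_edges C) {}"

text \<open>The partition into \<open>T1\<close> and \<open>t_l_edges C - T1\<close>.\<close>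

definition regular_partition :: "rect set \<Rightarrow> nat \<Rightarrow> seg set \<Rightarrow> bool" where
  "regular_partition C d T1 \<longleftrightarrow>
     T1 \<subseteq> t_l_edges C \<and>
     \<not> has_reasonable_order C d T1 {} \<and>
     has_reasonable_order C d (t_l_edges C - T1) (verts_of C T1)"

definition is_CNDC :: "rect set \<Rightarrow> nat \<Rightarrow> seg set \<Rightarrow> bool" where
  "is_CNDC C d T1 \<longleftrightarrow>
     regular_partition C d T1 \<and> \<not> (\<exists>T1'. T1' \<subset> T1 \<and> regular_partition C d T1')"

definition multi_vertices :: "rect set \<Rightarrow> seg set \<Rightarrow> point set" where
  "multi_vertices C T1 = {v \<in> vertices C.
     \<exists>l\<in>T1. \<exists>l'\<in>T1. hseg l \<and> vseg l' \<and> v \<in> supp l \<and> v \<in> supp l'}"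

definition mono_vertices :: "rect set \<Rightarrow> seg set \<Rightarrow> point set" where
  "mono_vertices C T1 = verts_of C T1 - multi_vertices C T1"


section \<open>Conformality matrices and the condensed coupling matrix\<close>

definition mrank :: "real mat \<Rightarrow> nat" where
  "mrank A = vec_space.rank (dim_row A) A"

definition coord :: "seg \<Rightarrow> point \<Rightarrow> real" where
  "coord l v = (if hseg l then fst v else snd v)"

text \<open>
  Edges and vertices are enumerated by lists; the row of index \<open>i\<close> belongs to the pair
  \<open>(ls ! (i div (d + 1)), i mod (d + 1))\<close>.
\<close>

definition conformality_mat :: "nat \<Rightarrow> seg list \<Rightarrow> point list \<Rightarrow> real mat" where
  "conformality_mat d ls vs =
     mat (length ls * (d + 1)) (length vs)
       (\<lambda>(i, j). let l = ls ! (i div (d + 1)); k = i mod (d + 1); v = vs ! j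
                 in if v \<in> supp l then coord l v ^ k else 0)"

text \<open>
  A variable is a pair of an edge of \<open>T1\<close> and a vertex on it. With \<open>ms\<close> and \<open>us\<close> the lists of
  multi- and mono-vertices, the variables are listed in the order
  \<open>\<delta>\<^sub>1\<^sup>h, \<dots>, \<delta>\<^sub>m\<^sup>h, \<delta>\<^sub>1\<^sup>v, \<dots>, \<delta>\<^sub>m\<^sup>v\<close>, followed by those of the mono-vertices.
  Grouping the columns of \<open>K1_mat\<close> by edges gives the block-diagonal form with one
  Vandermonde block per edge.
\<close>

definition coupling_vars :: "seg set \<Rightarrow> point list \<Rightarrow> point list \<Rightarrow> (seg \<times> point) list" where
  "coupling_vars T1 ms us =
     map (\<lambda>v. (THE l. l \<in> T1 \<and> hseg l \<and> v \<in> supp l, v)) ms @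
     map (\<lambda>v. (THE l. l \<in> T1 \<and> vseg l \<and> v \<in> supp l, v)) ms @
     map (\<lambda>v. (THE l. l \<in> T1 \<and> v \<in> supp l, v)) us"

definition K1_mat :: "nat \<Rightarrow> seg list \<Rightarrow> point list \<Rightarrow> point list \<Rightarrow> real mat" where
  "K1_mat d ls ms us =
     (let ws = coupling_vars (set ls) ms us in
      mat (length ls * (d + 1)) (length ws)
        (\<lambda>(i, j). let l = ls ! (i div (d + 1)); k = i mod (d + 1)
                  in if fst (ws ! j) = l then coord l (snd (ws ! j)) ^ k else 0))"

definition K2_mat :: "nat \<Rightarrow> real mat" where
  "K2_mat m = mat m (2 * m) (\<lambda>(i, j). if j = i then 1 else if j = m + i then - 1 else 0)"

definition kernel_basis_mat :: "real mat \<Rightarrow> real mat \<Rightarrow> bool" where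
  "kernel_basis_mat A B \<longleftrightarrow>
     dim_row B = dim_col A \<and> distinct (cols B) \<and> kernel.basis (dim_col A) A (set (cols B))"

text \<open>\<open>B\<close> is the matrix whose columns are the chosen basis of the kernel.\<close>

definition condensed_coupling_mat :: "nat \<Rightarrow> real mat \<Rightarrow> real mat" where
  "condensed_coupling_mat m B = K2_mat m * submatrix B {..<2 * m} UNIV"


section \<open>The homological correction term\<close>

text \<open>A polynomial in \<open>x, y\<close> is a polynomial in \<open>y\<close> whose coefficients are polynomials in \<open>x\<close>.\<close>

type_synonym poly2 = "real poly poly"

definition x_minus :: "real \<Rightarrow> poly2" where
  "x_minus a = [:[:- a, 1:]:]"

definition y_minus :: "real \<Rightarrow> poly2" where
  "y_minus b = [:[:- b:], 1:]"

definition bideg_polys :: "nat \<Rightarrow> poly2 set" where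
  "bideg_polys d = {p. Polynomial.degree p \<le> d \<and>
     (\<forall>i. Polynomial.degree (Polynomial.coeff p i) \<le> d)}"

definition edge_line :: "seg \<Rightarrow> poly2" where
  "edge_line e = (if hseg e then y_minus (snd (fst e)) else x_minus (fst (fst e)))"

definition J_edge :: "nat \<Rightarrow> seg \<Rightarrow> poly2 set" where
  "J_edge d e = {p \<in> bideg_polys d. edge_line e ^ d dvd p}"

definition J_vertex :: "nat \<Rightarrow> point \<Rightarrow> poly2 set" where
  "J_vertex d v = {p + q | p q.
     p \<in> bideg_polys d \<and> x_minus (fst v) ^ d dvd p \<and>
     q \<in> bideg_polys d \<and> y_minus (snd v) ^ d dvd q}"

definition edge_chains :: "rect set \<Rightarrow> nat \<Rightarrow> (seg \<Rightarrow> poly2) set" where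
  "edge_chains C d = {c. (\<forall>e\<in>interior_edges C. c e \<in> J_edge d e) \<and>
     (\<forall>e. e \<notin> interior_edges C \<longrightarrow> c e = 0)}"

definition vertex_chains :: "rect set \<Rightarrow> nat \<Rightarrow> (real, point \<Rightarrow> poly2) module" where
  "vertex_chains C d = \<lparr>
     carrier = {c. (\<forall>v\<in>interior_vertices C. c v \<in> J_vertex d v) \<and>
       (\<forall>v. v \<notin> interior_vertices C \<longrightarrow> c v = 0)},
     monoid.mult = undefined,
     one = undefined,
     zero = (\<lambda>v. 0),
     add = (\<lambda>c c' v. c v + c' v),
     smult = (\<lambda>a c v. Polynomial.smult [:a:] (c v))\<rparr>"

definition boundary_map :: "rect set \<Rightarrow> (seg \<Rightarrow> poly2) \<Rightarrow> point \<Rightarrow> poly2" where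
  "boundary_map C c v =
     (if v \<in> interior_vertices C
      then (\<Sum>e | e \<in> interior_edges C \<and> snd e = v. c e)
         - (\<Sum>e | e \<in> interior_edges C \<and> fst e = v. c e)
      else 0)"

text \<open>
  The quotient of a vector space by a subspace \<open>W\<close>: its elements are the cosets of \<open>W\<close>.
\<close>

definition quotient_space :: "('a, 'b) module \<Rightarrow> 'b set \<Rightarrow> ('a, 'b set) module" where
  "quotient_space V W = \<lparr>
     carrier = a_rcosets\<^bsub>V\<^esub> W,
     monoid.mult = undefined,
     one = undefined,
     zero = W,
     add = (\<lambda>A B. A <+>\<^bsub>V\<^esub> B),
     smult = (\<lambda>a A. \<Union>x\<in>A. W +>\<^bsub>V\<^esub> (a \<odot>\<^bsub>V\<^esub> x))\<rparr>"

definition h_term :: "nat \<Rightarrow> rect set \<Rightarrow> nat" where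
  "h_term d C = vectorspace.dim class_ring
     (quotient_space (vertex_chains C d) (boundary_map C ` edge_chains C d))"

end

theory Submission
  imports Defs
begin

text \<open>
  All three differences are the dimension of one space. Attach to each T \<open>l\<close>-edge \<open>l\<close> a real
  polynomial \<open>p l\<close> of degree at most \<open>d\<close> in the coordinate that varies along \<open>l\<close>. Call such a
  family a syzygy if at every vertex the values of the polynomials of the \<open>l\<close>-edges through it add
  up to zero. The coefficient vectors of syzygies form the left kernel of the conformality matrix,
  so \<open>t (d + 1) - rank M\<close> is the dimension of the space of syzygies; likewise for \<open>M\<^sub>1\<close> and the
  edges of \<open>T1\<close>.

  The homological term. On a horizontal edge on the line \<open>y = b\<close> the space \<open>J\<close> consists of the
  products \<open>f(x) (y - b)^d\<close> with \<open>f\<close> of degree at most \<open>d\<close>. Modulo boundaries such a product,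
  placed at a vertex, may be moved along the line from vertex to vertex, and it vanishes as soon
  as the line meets the boundary of the domain. A line through an interior vertex either is a T
  \<open>l\<close>-edge or meets the boundary (\<open>line_reaches_boundary\<close>): at least three of the four directions
  at an interior vertex carry an edge (\<open>at_most_one_missing_direction\<close>), so a maximal segment that
  stops at an interior vertex stops at a T-junction. As \<open>J\<close> at a vertex is the sum of a horizontal
  and a vertical part, the cokernel of the boundary map is generated by one copy of the
  polynomials of degree at most \<open>d\<close> for every T \<open>l\<close>-edge. The two parts at the vertex \<open>(a, b)\<close>
  meet in the multiples of \<open>(x - a)^d (y - b)^d\<close>, and this produces one relation for each vertex:
  \<open>(x - a)^d\<close> on the horizontal \<open>l\<close>-edge equals \<open>(y - b)^d\<close> on the vertical one. In the basis \<open>(d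
  choose k) (-1)^k x^(d - k)\<close>, with the sign reversed on vertical edges, the coefficients of this
  relation are the powers \<open>a^k\<close> and \<open>b^k\<close>, that is, a column of the conformality matrix. Hence the
  cokernel is the quotient of the coefficient space by the column space of \<open>M\<close>
  (\<open>h_term_plus_mrank\<close>).

  The CNDC. In a reasonable order of the \<open>l\<close>-edges outside \<open>T1\<close>, the last edge has \<open>d + 1\<close>
  vertices that lie on no other \<open>l\<close>-edge. There the polynomial of a syzygy vanishes, so it is
  zero; going backwards, a syzygy vanishes on all edges outside \<open>T1\<close>
  (\<open>syzygies_regular_partition\<close>), and the syzygies of the mesh are those of \<open>T1\<close>.

  The coupling matrix. A vector \<open>w\<close> is in the left kernel of \<open>K = K\<^sub>2 Z\<close> iff \<open>(w, -w, 0)\<close> is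
  orthogonal to the kernel of \<open>K\<^sub>1\<close>, iff it lies in the row space of \<open>K\<^sub>1\<close>. As \<open>K\<^sub>1\<close> consists of
  Vandermonde blocks, this says that there are polynomials on the edges of \<open>T1\<close> with the values
  \<open>w\<^sub>i\<close> and \<open>-w\<^sub>i\<close> at the \<open>i\<close>-th multi-vertex, on its horizontal and on its vertical edge, and
  with the value \<open>0\<close> at the mono-vertices: a syzygy. It is determined by \<open>w\<close> because no edge is
  vanishable (\<open>corank_condensed_coupling\<close>).
\<close>

section \<open>Rank, left kernels and quotients of real vector spaces\<close>

no_notation inner (infix "\<bullet>" 70)
no_notation vec_nth (infixl "$" 90)

lemma mult_mat_vec_in_carrier [simp]: "A *\<^sub>v x \<in> carrier_vec (dim_row A)"
  by (rule carrier_vecI) simp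

lemma mrank_eq_dim_image:
  "mrank A = vectorspace.dim class_ring
     ((module_vec TYPE(real) (dim_row A))\<lparr>carrier := (\<lambda>x. A *\<^sub>v x) ` carrier_vec (dim_col A)\<rparr>)"
proof -
  have A: "A \<in> carrier_mat (dim_row A) (dim_col A)" by simp
  interpret vec_space "TYPE(real)" "dim_row A" .
  have "span (set (cols A)) = (\<lambda>x. A *\<^sub>v x) ` carrier_vec (dim_col A)"
    using col_space_eq[OF A] unfolding col_space_def by auto
  then show ?thesis unfolding mrank_def rank_def by simp
qed

lemma linear_map_vecI:
  assumes "vectorspace (class_ring :: real ring) W"
    and "\<And>x. x \<in> carrier_vec n \<Longrightarrow> f x \<in> carrier W"
    and "\<And>x y. x \<in> carrier_vec n \<Longrightarrow> y \<in> carrier_vec n \<Longrightarrow> f (x + y) = f x \<oplus>\<^bsub>W\<^esub> f y"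
    and "\<And>a x. x \<in> carrier_vec n \<Longrightarrow> f (a \<cdot>\<^sub>v x) = a \<odot>\<^bsub>W\<^esub> f x"
  shows "linear_map class_ring (module_vec TYPE(real) n) W f"
proof -
  interpret V: vectorspace class_ring "module_vec TYPE(real) n" by (rule vec_vs)
  interpret W: vectorspace class_ring W by fact
  show ?thesis
    by (unfold_locales) (use assms in \<open>auto simp: module_hom_def module_vec_simps class_ring_simps\<close>)
qed

theorem rank_plus_nullity:
  "mrank A + vectorspace.dim class_ring ((module_vec TYPE(real) (dim_col A))\<lparr>carrier := mat_kernel
        A\<rparr>)
     = dim_col A"
proof -
  let ?nr = "dim_row A" and ?nc = "dim_col A"
  have A: "A \<in> carrier_mat ?nr ?nc" by simp
  interpret V: vec_space "TYPE(real)" ?nc .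
  interpret T: linear_map class_ring "module_vec TYPE(real) ?nc" "module_vec TYPE(real) ?nr"
      "\<lambda>x. A *\<^sub>v x"
    by (rule linear_map_vecI[OF vec_vs])
       (auto simp: module_vec_simps mult_add_distrib_mat_vec[OF A] mult_mat_vec[OF A])
  have "T.im = (\<lambda>x. A *\<^sub>v x) ` carrier_vec ?nc" by (simp add: T.im_def module_vec_simps)
  moreover have "T.ker = mat_kernel A" by (auto simp: T.ker_def mat_kernel_def module_vec_simps)
  ultimately show ?thesis
    using T.rank_nullity[OF V.fin_dim] V.dim_is_n unfolding mrank_eq_dim_image by simp
qed

lemma mat_kernel_fin_dim:
  "vectorspace.fin_dim class_ring ((module_vec TYPE(real) (dim_col A))\<lparr>carrier := mat_kernel A\<rparr>)"
proof -
  interpret kernel "dim_row A" "dim_col A" A by unfold_locales simp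
  show ?thesis
    using kernel_basis_exists[of A "dim_row A" "dim_col A"]
    unfolding Ker.fin_dim_def Ker.basis_def by auto
qed

text \<open>
  Rank-nullity for a map onto \<open>Q\<close> whose kernel is the column space of a matrix: this is how a
  cokernel is compared with a corank.
\<close>
lemma dim_surjective_image:
  assumes "vectorspace (class_ring :: real ring) Q"
    and "\<And>x. x \<in> carrier_vec (dim_row A) \<Longrightarrow> f x \<in> carrier Q"
    and "\<And>x y. x \<in> carrier_vec (dim_row A) \<Longrightarrow> y \<in> carrier_vec (dim_row A) \<Longrightarrow> f (x + y) = f x \<oplus>\<^bsub>Q\<^esub> f y"
    and "\<And>a x. x \<in> carrier_vec (dim_row A) \<Longrightarrow> f (a \<cdot>\<^sub>v x) = a \<odot>\<^bsub>Q\<^esub> f x"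
    and surj: "\<And>q. q \<in> carrier Q \<Longrightarrow> \<exists>x\<in>carrier_vec (dim_row A). f x = q"
    and ker: "\<And>x. x \<in> carrier_vec (dim_row A) \<Longrightarrow>
        f x = \<zero>\<^bsub>Q\<^esub> \<longleftrightarrow> x \<in> (\<lambda>y. A *\<^sub>v y) ` carrier_vec (dim_col A)"
  shows "vectorspace.dim class_ring Q + mrank A = dim_row A"
proof -
  let ?n = "dim_row A"
  interpret V: vec_space "TYPE(real)" ?n .
  interpret T: linear_map class_ring "module_vec TYPE(real) ?n" Q f
    by (rule linear_map_vecI) (use assms in auto)
  have "T.im = carrier Q"
    using assms(2) surj unfolding T.im_def by (auto simp: module_vec_simps image_iff)
  moreover have "T.ker = (\<lambda>y. A *\<^sub>v y) ` carrier_vec (dim_col A)"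
    using ker unfolding T.ker_def by (auto simp: module_vec_simps)
  ultimately show ?thesis
    using T.rank_nullity[OF V.fin_dim] V.dim_is_n unfolding mrank_eq_dim_image by simp
qed

lemma scalar_prod_self_eq_0:
  fixes x :: "real vec"
  assumes "x \<in> carrier_vec n" "x \<bullet> x = 0"
  shows "x = 0\<^sub>v n"
proof (rule eq_vecI)
  have "(\<Sum>i\<in>{0..<n}. x $ i * x $ i) = 0" using assms by (simp add: scalar_prod_def)
  then have "\<forall>i\<in>{0..<n}. x $ i * x $ i = 0" by (subst (asm) sum_nonneg_eq_0_iff) auto
  then show "x $ i = 0\<^sub>v n $ i" if "i < dim_vec (0\<^sub>v n)" for i using that by auto
qed (use assms in auto)

text \<open>
  Over the reals \<open>A\<^sup>T A x = 0\<close> gives \<open>\<bar>A x\<bar>\<^sup>2 = x \<bullet> A\<^sup>T A x = 0\<close>.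
\<close>
lemma mat_kernel_transpose_mult:
  fixes A :: "real mat"
  shows "mat_kernel (A\<^sup>T * A) = mat_kernel A"
proof
  let ?nr = "dim_row A" and ?nc = "dim_col A"
  have A: "A \<in> carrier_mat ?nr ?nc" and At: "A\<^sup>T \<in> carrier_mat ?nc ?nr" by simp_all
  show "mat_kernel A \<subseteq> mat_kernel (A\<^sup>T * A)" by (rule mat_kernel_mult_subset[OF A At])
  show "mat_kernel (A\<^sup>T * A) \<subseteq> mat_kernel A"
  proof
    fix x assume x: "x \<in> mat_kernel (A\<^sup>T * A)"
    then have xc: "x \<in> carrier_vec ?nc" and 0: "(A\<^sup>T * A) *\<^sub>v x = 0\<^sub>v ?nc"
      by (auto simp: mat_kernel_def)
    have "(A *\<^sub>v x) \<bullet> (A *\<^sub>v x) = (A\<^sup>T *\<^sub>v (A *\<^sub>v x)) \<bullet> x"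
      by (rule transpose_vec_mult_scalar[OF A xc, symmetric]) simp
    also have "A\<^sup>T *\<^sub>v (A *\<^sub>v x) = 0\<^sub>v ?nc" using 0 assoc_mult_mat_vec[OF At A xc] by simp
    finally have "(A *\<^sub>v x) \<bullet> (A *\<^sub>v x) = 0" using xc by simp
    then have "A *\<^sub>v x = 0\<^sub>v ?nr" by (intro scalar_prod_self_eq_0) (auto)
    then show "x \<in> mat_kernel A" using xc by (auto simp: mat_kernel_def)
  qed
qed

lemma mrank_transpose_mult: "mrank (A\<^sup>T * A) = mrank A"
  using rank_plus_nullity[of A] rank_plus_nullity[of "A\<^sup>T * A"]
      by (simp add: mat_kernel_transpose_mult)

lemma image_mult_subset:
  fixes A B :: "real mat"
  assumes "dim_col A = dim_row B"
  shows "(\<lambda>x. (A * B) *\<^sub>v x) ` carrier_vec (dim_col B) \<subseteq> (\<lambda>x. A *\<^sub>v x) ` carrier_vec (dim_col A)"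
proof (clarify)
  fix x :: "real vec" assume x: "x \<in> carrier_vec (dim_col B)"
  have "(A * B) *\<^sub>v x = A *\<^sub>v (B *\<^sub>v x)"
    using assms x by (intro assoc_mult_mat_vec[of A "dim_row A" "dim_col A" B "dim_col B" x]) auto
  then show "(A * B) *\<^sub>v x \<in> (\<lambda>x. A *\<^sub>v x) ` carrier_vec (dim_col A)"
    using assms mult_mat_vec_in_carrier[of B x] by simp
qed

text \<open>
  The second part is the equality of nested column spaces of equal dimension: a basis of the
  smaller one is an independent subset of maximal size of the larger one.
\<close>
lemma image_subset_mrank:
  fixes A B :: "real mat"
  assumes rows: "dim_row A = dim_row B"
    and sub: "(\<lambda>x. A *\<^sub>v x) ` carrier_vec (dim_col A) \<subseteq> (\<lambda>x. B *\<^sub>v x) ` carrier_vec (dim_col B)"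
  shows "mrank A \<le> mrank B"
    and "mrank A = mrank B \<Longrightarrow>
      (\<lambda>x. A *\<^sub>v x) ` carrier_vec (dim_col A) = (\<lambda>x. B *\<^sub>v x) ` carrier_vec (dim_col B)"
proof -
  let ?n = "dim_row B"
  let ?U = "(\<lambda>x. A *\<^sub>v x) ` carrier_vec (dim_col A)"
      and ?W = "(\<lambda>x. B *\<^sub>v x) ` carrier_vec (dim_col B)"
  have A: "A \<in> carrier_mat ?n (dim_col A)" and B: "B \<in> carrier_mat ?n (dim_col B)"
    using rows by auto
  have cA: "set (cols A) \<subseteq> carrier_vec ?n" and cB: "set (cols B) \<subseteq> carrier_vec ?n"
    using cols_dim[of A] cols_dim[of B] rows by auto
  interpret V: vec_space "TYPE(real)" ?n .
  have U: "V.span (set (cols A)) = ?U"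
    using V.col_space_eq[OF A] rows using mult_mat_vec_in_carrier[of A] unfolding V.col_space_def
        by auto
  have W: "V.span (set (cols B)) = ?W"
    using V.col_space_eq[OF B] unfolding V.col_space_def by auto
  have sU: "subspace class_ring ?U V.V" and sW: "subspace class_ring ?W V.V"
    using V.span_is_subspace[of "set (cols A)"] V.span_is_subspace[of "set (cols B)"] cA cB
    unfolding U W by simp_all
  have fU: "vectorspace.fin_dim class_ring (V.vs ?U)"
      and fW: "vectorspace.fin_dim class_ring (V.vs ?W)"
    using V.fin_dim_span_cols[OF A] V.fin_dim_span_cols[OF B] unfolding U W by simp_all
  interpret vU: vectorspace class_ring "V.vs ?U" by (rule V.subspace_is_vs[OF sU])
  interpret vW: vectorspace class_ring "V.vs ?W" by (rule V.subspace_is_vs[OF sW])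
  have UW: "subspace class_ring ?U (V.vs ?W)" by (rule V.nested_subspaces[OF sW sU sub])
  show "mrank A \<le> mrank B"
    using vW.subspace_dim[OF UW fW] fU unfolding mrank_eq_dim_image rows by simp
  assume eq: "mrank A = mrank B"
  obtain b where b: "finite b" "vU.basis b" using vU.finite_basis_exists[OF fU] by blast
  then have bU: "b \<subseteq> ?U" and li: "vU.lin_indpt b" and gen: "vU.span b = ?U"
    unfolding vU.basis_def by auto
  have li2: "V.lin_indpt b"
    using li V.span_li_not_depend(2)[OF bU] sU unfolding subspace_def by blast
  have card: "card b = vU.dim" using vU.dim_basis[OF b] by simp
  have "vW.basis b"
  proof (rule vW.dim_li_is_basis[OF fW b(1)])
    show "b \<subseteq> carrier (V.vs ?W)" using bU sub by auto
    show "vW.lin_indpt b"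
      using li2 V.span_li_not_depend(2)[of b ?W] bU sub sW unfolding subspace_def by auto
    show "vW.dim \<le> card b" using card eq unfolding mrank_eq_dim_image rows by simp
  qed
  then have "vW.span b = ?W" unfolding vW.basis_def by auto
  moreover have "vW.span b = V.span b"
    using V.span_li_not_depend(1)[of b ?W] bU sub sW unfolding subspace_def by auto
  moreover have "vU.span b = V.span b"
    using V.span_li_not_depend(1)[OF bU] sU unfolding subspace_def by auto
  ultimately show "?U = ?W" using gen by simp
qed

text \<open>
  The column space of \<open>A\<^sup>T A\<close> lies in that of \<open>A\<^sup>T\<close> and has the dimension of that of \<open>A\<close>; apply
  this to \<open>A\<close> and to \<open>A\<^sup>T\<close>.
\<close>
lemma mrank_transpose: "mrank A\<^sup>T = mrank A"
proof -
  have le: "mrank A \<le> mrank A\<^sup>T" for A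
  proof -
    have "mrank (A\<^sup>T * A) \<le> mrank A\<^sup>T"
      by (rule image_subset_mrank(1)) (use image_mult_subset[of "A\<^sup>T" A] in auto)
    then show ?thesis by (simp add: mrank_transpose_mult)
  qed
  show ?thesis using le[of A] le[of "A\<^sup>T"] by simp
qed

text \<open>
  The Fredholm alternative. The matrices \<open>A A\<^sup>T\<close> and \<open>A\<close> have the same column space, so \<open>A y = A
  (A\<^sup>T x)\<close> for some \<open>x\<close>. Then \<open>y - A\<^sup>T x\<close> lies in the kernel of \<open>A\<close>, to which both \<open>y\<close> and \<open>A\<^sup>T x\<close>
  are orthogonal, hence it is orthogonal to itself.
\<close>
lemma orthogonal_to_kernel:
  fixes A :: "real mat"
  assumes y: "y \<in> carrier_vec (dim_col A)"
    and orth: "\<And>z. z \<in> mat_kernel A \<Longrightarrow> y \<bullet> z = 0"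
  obtains x where "x \<in> carrier_vec (dim_row A)" "y = A\<^sup>T *\<^sub>v x"
proof -
  let ?nr = "dim_row A" and ?nc = "dim_col A"
  have A: "A \<in> carrier_mat ?nr ?nc" and At: "A\<^sup>T \<in> carrier_mat ?nc ?nr" by simp_all
  have "(\<lambda>x. (A * A\<^sup>T) *\<^sub>v x) ` carrier_vec (dim_col A\<^sup>T) = (\<lambda>x. A *\<^sub>v x) ` carrier_vec ?nc"
    using image_subset_mrank(2)[of "A * A\<^sup>T" A] image_mult_subset[of A "A\<^sup>T"]
      mrank_transpose_mult[of "A\<^sup>T"] mrank_transpose[of A] by simp
  then have "A *\<^sub>v y \<in> (\<lambda>x. (A * A\<^sup>T) *\<^sub>v x) ` carrier_vec (dim_col A\<^sup>T)" using y by blast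
  then obtain x where x: "x \<in> carrier_vec ?nr" "A *\<^sub>v y = (A * A\<^sup>T) *\<^sub>v x" by auto
  define r where "r = A\<^sup>T *\<^sub>v x"
  have r: "r \<in> carrier_vec ?nc" unfolding r_def using mult_mat_vec_in_carrier[of "A\<^sup>T" x] by simp
  have Ar: "A *\<^sub>v y = A *\<^sub>v r" using x assoc_mult_mat_vec[OF A At] by (simp add: r_def)
  have z: "y - r \<in> mat_kernel A"
    using y r Ar mult_minus_distrib_mat_vec[OF A y r] by (auto simp: mat_kernel_def)
  have zc: "y - r \<in> carrier_vec ?nc" using y r by simp
  have "r \<bullet> (y - r) = x \<bullet> (A *\<^sub>v (y - r))"
    using transpose_vec_mult_scalar[OF A zc x(1)] unfolding r_def by simp
  also have "\<dots> = 0" using z x by (simp add: mat_kernel_def)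
  finally have "(y - r) \<bullet> (y - r) = 0"
    using orth[OF z] minus_scalar_prod_distrib[OF y r zc] by simp
  then have "y - r = 0\<^sub>v ?nc" by (rule scalar_prod_self_eq_0[OF zc])
  then have "y = r"
    using y r by (intro eq_vecI) (auto simp: vec_eq_iff)
  then show ?thesis using that x(1) r_def by blast
qed

definition left_kernel :: "real mat \<Rightarrow> real vec set" where
  "left_kernel A = mat_kernel A\<^sup>T"

lemma corank_eq_dim_left_kernel:
  "int (dim_row A) - int (mrank A) =
     int (vectorspace.dim class_ring ((module_vec TYPE(real) (dim_row A))\<lparr>carrier := left_kernel
         A\<rparr>))"
  using rank_plus_nullity[of "A\<^sup>T"] unfolding left_kernel_def mrank_transpose by simp

lemma mem_left_kernel_iff:
  "y \<in> left_kernel A \<longleftrightarrow> y \<in> carrier_vec (dim_row A) \<and>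
     (\<forall>j<dim_col A. (\<Sum>i<dim_row A. y $ i * A $$ (i, j)) = 0)"
  unfolding left_kernel_def mat_kernel_def
  by (auto simp: vec_eq_iff scalar_prod_def mult.commute atLeast0LessThan)

lemma left_kernel_closed:
  "x \<in> left_kernel A \<Longrightarrow> y \<in> left_kernel A \<Longrightarrow> x + y \<in> left_kernel A"
  "x \<in> left_kernel A \<Longrightarrow> a \<cdot>\<^sub>v x \<in> left_kernel A"
  by (auto simp: mem_left_kernel_iff algebra_simps sum.distrib simp flip: sum_distrib_left)

text \<open>
  The left kernels are identified through their common image in an arbitrary type. Whatever the
  operations \<open>add\<close> and \<open>sc\<close> are, the composite of \<open>f\<close> with the inverse of \<open>g\<close> is linear because
  \<open>g\<close> is injective.
\<close>
theorem corank_eq_if_left_kernels_same_image: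
  fixes f g :: "real vec \<Rightarrow> 'b" and add :: "'b \<Rightarrow> 'b \<Rightarrow> 'b" and sc :: "real \<Rightarrow> 'b \<Rightarrow> 'b"
  assumes f_add: "\<And>x y. x \<in> left_kernel A \<Longrightarrow> y \<in> left_kernel A \<Longrightarrow> f (x + y) = add (f x) (f y)"
    and f_sc: "\<And>a x. x \<in> left_kernel A \<Longrightarrow> f (a \<cdot>\<^sub>v x) = sc a (f x)"
    and g_add: "\<And>x y. x \<in> left_kernel B \<Longrightarrow> y \<in> left_kernel B \<Longrightarrow> g (x + y) = add (g x) (g y)"
    and g_sc: "\<And>a x. x \<in> left_kernel B \<Longrightarrow> g (a \<cdot>\<^sub>v x) = sc a (g x)"
    and f_inj: "inj_on f (left_kernel A)" and g_inj: "inj_on g (left_kernel B)"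
    and image: "f ` left_kernel A = g ` left_kernel B"
  shows "int (dim_row A) - int (mrank A) = int (dim_row B) - int (mrank B)"
proof -
  let ?V = "(module_vec TYPE(real) (dim_row A))\<lparr>carrier := left_kernel A\<rparr>"
  let ?W = "(module_vec TYPE(real) (dim_row B))\<lparr>carrier := left_kernel B\<rparr>"
  define h where "h = inv_into (left_kernel B) g \<circ> f"
  have h: "h x \<in> left_kernel B" "g (h x) = f x" if "x \<in> left_kernel A" for x
  proof -
    have "f x \<in> g ` left_kernel B" using that image by blast
    then show "h x \<in> left_kernel B" "g (h x) = f x"
      unfolding h_def by (auto intro: inv_into_into f_inv_into_f)
  qed
  interpret KA: kernel "dim_col A" "dim_row A" "A\<^sup>T" by unfold_locales simp
  interpret KB: kernel "dim_col B" "dim_row B" "B\<^sup>T" by unfold_locales simp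
  have vA: "vectorspace class_ring ?V" and vB: "vectorspace class_ring ?W"
    unfolding left_kernel_def by (rule KA.Ker.vectorspace_axioms, rule KB.Ker.vectorspace_axioms)
  interpret V: vectorspace class_ring ?V by (rule vA)
  interpret W: vectorspace class_ring ?W by (rule vB)
  interpret T: linear_map class_ring ?V ?W h
  proof (unfold_locales, unfold module_hom_def, safe)
    fix x y assume "x \<in> carrier ?V" "y \<in> carrier ?V"
    then have xy: "x \<in> left_kernel A" "y \<in> left_kernel A" by auto
    have "g (h (x + y)) = g (h x + h y)"
      using h xy left_kernel_closed f_add g_add by simp
    then have "h (x + y) = h x + h y"
      by (rule inj_onD[OF g_inj]) (use h xy left_kernel_closed in auto)
    then show "h (x \<oplus>\<^bsub>?V\<^esub> y) = h x \<oplus>\<^bsub>?W\<^esub> h y" by (simp add: module_vec_simps)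
  next
    fix a :: real and x assume "x \<in> carrier ?V"
    then have x: "x \<in> left_kernel A" by auto
    have "g (h (a \<cdot>\<^sub>v x)) = g (a \<cdot>\<^sub>v h x)"
      using h x left_kernel_closed f_sc g_sc by simp
    then have "h (a \<cdot>\<^sub>v x) = a \<cdot>\<^sub>v h x"
      by (rule inj_onD[OF g_inj]) (use h x left_kernel_closed in auto)
    then show "h (a \<odot>\<^bsub>?V\<^esub> x) = a \<odot>\<^bsub>?W\<^esub> h x" by (simp add: module_vec_simps)
  qed (use h in auto)
  have "inj_on h (left_kernel A)"
    by (rule inj_onI) (metis h(2) f_inj inj_onD)
  moreover have "h ` left_kernel A = left_kernel B"
  proof (intro equalityI subsetI)
    fix y assume y: "y \<in> left_kernel B"
    then obtain x where x: "x \<in> left_kernel A" "f x = g y" using image by (metis imageE imageI)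
    then have "h x = y" using h[of x] g_inj y by (metis inj_onD)
    then show "y \<in> h ` left_kernel A" using x by blast
  qed (use h in auto)
  ultimately have "V.dim = W.dim"
    using T.dim_eq mat_kernel_fin_dim[of "A\<^sup>T"] by (simp add: left_kernel_def)
  then show ?thesis using corank_eq_dim_left_kernel by simp
qed

text \<open>
  The coset map is a surjective linear map with kernel \<open>U\<close>; its well-definedness makes the
  quotient a vector space.
\<close>
lemma quotient_space_vectorspace:
  assumes sub: "subspace (class_ring :: real ring) U V" and vs: "vectorspace class_ring V"
  shows "vectorspace class_ring (quotient_space V U)"
    and "\<And>x. x \<in> carrier V \<Longrightarrow> U +>\<^bsub>V\<^esub> x \<in> carrier (quotient_space V U)"
    and "\<And>q. q \<in> carrier (quotient_space V U) \<Longrightarrow> \<exists>x\<in>carrier V. q = U +>\<^bsub>V\<^esub> x"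
    and "\<And>x y. x \<in> carrier V \<Longrightarrow> y \<in> carrier V \<Longrightarrow>
       U +>\<^bsub>V\<^esub> (x \<oplus>\<^bsub>V\<^esub> y) = (U +>\<^bsub>V\<^esub> x) \<oplus>\<^bsub>quotient_space V U\<^esub> (U +>\<^bsub>V\<^esub> y)"
    and "\<And>a x. x \<in> carrier V \<Longrightarrow>
       U +>\<^bsub>V\<^esub> (a \<odot>\<^bsub>V\<^esub> x) = a \<odot>\<^bsub>quotient_space V U\<^esub> (U +>\<^bsub>V\<^esub> x)"
    and "\<And>x y. x \<in> carrier V \<Longrightarrow> y \<in> carrier V \<Longrightarrow>
       U +>\<^bsub>V\<^esub> x = U +>\<^bsub>V\<^esub> y \<longleftrightarrow> x \<ominus>\<^bsub>V\<^esub> y \<in> U"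
    and "\<And>x. x \<in> carrier V \<Longrightarrow> U +>\<^bsub>V\<^esub> x = \<zero>\<^bsub>quotient_space V U\<^esub> \<longleftrightarrow> x \<in> U"
proof -
  let ?Q = "quotient_space V U"
  interpret V: vectorspace class_ring V by (rule vs)
  have sm: "submodule class_ring U V" using sub unfolding subspace_def by simp
  have Uc: "U \<subseteq> carrier V" by (rule submodule.subset[OF sm])
  have neg: "\<ominus>\<^bsub>V\<^esub> u \<in> U" if "u \<in> U" for u
    using submodule.smult_closed[OF sm, of "\<ominus>\<^bsub>class_ring\<^esub> \<one>\<^bsub>class_ring\<^esub>" u] that Uc
      V.smult_minus_1[of u] by (auto simp: class_ring_simps)
  interpret H: abelian_subgroup U V
    by (rule abelian_subgroupI3, unfold additive_subgroup_def, rule subgroup.intro)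
       (use Uc submodule.m_closed[OF sm] submodule.zero_closed[OF sm] neg
         in \<open>auto simp: V.abelian_group_axioms simp flip: a_inv_def\<close>)
  have car: "carrier ?Q = (\<lambda>x. U +>\<^bsub>V\<^esub> x) ` carrier V"
    by (auto simp: quotient_space_def A_RCOSETS_def')
  show elem: "\<And>x. x \<in> carrier V \<Longrightarrow> U +>\<^bsub>V\<^esub> x \<in> carrier ?Q" unfolding car by blast
  show ex: "\<And>q. q \<in> carrier ?Q \<Longrightarrow> \<exists>x\<in>carrier V. q = U +>\<^bsub>V\<^esub> x" unfolding car by blast
  show eq: "U +>\<^bsub>V\<^esub> x = U +>\<^bsub>V\<^esub> y \<longleftrightarrow> x \<ominus>\<^bsub>V\<^esub> y \<in> U" if "x \<in> carrier V" "y \<in> carrier V" for x y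
    using H.a_rcos_module[of y x] V.minus_eq[of x y] H.a_repr_independence' H.a_rcos_self that
    by metis
  have add: "U +>\<^bsub>V\<^esub> (x \<oplus>\<^bsub>V\<^esub> y) = (U +>\<^bsub>V\<^esub> x) \<oplus>\<^bsub>?Q\<^esub> (U +>\<^bsub>V\<^esub> y)"
    if "x \<in> carrier V" "y \<in> carrier V" for x y
    using H.a_rcos_sum that by (simp add: quotient_space_def)
  then show "\<And>x y. x \<in> carrier V \<Longrightarrow> y \<in> carrier V \<Longrightarrow>
       U +>\<^bsub>V\<^esub> (x \<oplus>\<^bsub>V\<^esub> y) = (U +>\<^bsub>V\<^esub> x) \<oplus>\<^bsub>?Q\<^esub> (U +>\<^bsub>V\<^esub> y)" by blast
  have smult: "U +>\<^bsub>V\<^esub> (a \<odot>\<^bsub>V\<^esub> x) = a \<odot>\<^bsub>?Q\<^esub> (U +>\<^bsub>V\<^esub> x)"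
    if x: "x \<in> carrier V" for a x
  proof -
    have "U +>\<^bsub>V\<^esub> (a \<odot>\<^bsub>V\<^esub> x') = U +>\<^bsub>V\<^esub> (a \<odot>\<^bsub>V\<^esub> x)" if x': "x' \<in> U +>\<^bsub>V\<^esub> x" for x'
    proof -
      have c: "x' \<in> carrier V" using H.a_elemrcos_carrier[OF x x'] .
      have "x' \<ominus>\<^bsub>V\<^esub> x \<in> U" using H.a_rcos_module[OF x c] x' V.minus_eq by simp
      then have "a \<odot>\<^bsub>V\<^esub> (x' \<ominus>\<^bsub>V\<^esub> x) \<in> U"
        using submodule.smult_closed[OF sm] by (simp add: class_ring_simps)
      also have "a \<odot>\<^bsub>V\<^esub> (x' \<ominus>\<^bsub>V\<^esub> x) = a \<odot>\<^bsub>V\<^esub> x' \<ominus>\<^bsub>V\<^esub> a \<odot>\<^bsub>V\<^esub> x"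
        using c x by (simp add: V.minus_eq V.smult_r_distr V.smult_r_minus class_ring_simps)
      finally show ?thesis using eq c x by (simp add: class_ring_simps)
    qed
    then have "(\<Union>x'\<in>U +>\<^bsub>V\<^esub> x. U +>\<^bsub>V\<^esub> (a \<odot>\<^bsub>V\<^esub> x')) = U +>\<^bsub>V\<^esub> (a \<odot>\<^bsub>V\<^esub> x)"
      using H.a_rcos_self[OF x] by blast
    then show ?thesis by (simp add: quotient_space_def)
  qed
  then show "\<And>a x. x \<in> carrier V \<Longrightarrow>
       U +>\<^bsub>V\<^esub> (a \<odot>\<^bsub>V\<^esub> x) = a \<odot>\<^bsub>?Q\<^esub> (U +>\<^bsub>V\<^esub> x)" by blast
  have zero: "\<zero>\<^bsub>?Q\<^esub> = U +>\<^bsub>V\<^esub> \<zero>\<^bsub>V\<^esub>"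
    using V.a_coset_add_zero[OF Uc] by (simp add: quotient_space_def)
  show "U +>\<^bsub>V\<^esub> x = \<zero>\<^bsub>?Q\<^esub> \<longleftrightarrow> x \<in> U" if "x \<in> carrier V" for x
    using H.a_rcos_const[of x] H.a_rcos_self[OF that] by (auto simp: quotient_space_def)
  have fold:
    "(U +>\<^bsub>V\<^esub> x) \<oplus>\<^bsub>?Q\<^esub> (U +>\<^bsub>V\<^esub> y) = U +>\<^bsub>V\<^esub> (x \<oplus>\<^bsub>V\<^esub> y)"
    "a \<odot>\<^bsub>?Q\<^esub> (U +>\<^bsub>V\<^esub> x) = U +>\<^bsub>V\<^esub> (a \<odot>\<^bsub>V\<^esub> x)"
    if "x \<in> carrier V" "y \<in> carrier V" for x y a
    using add smult that by simp_all
  have all: "(\<forall>q\<in>carrier ?Q. P q) \<longleftrightarrow> (\<forall>x\<in>carrier V. P (U +>\<^bsub>V\<^esub> x))" for P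
    unfolding car by blast
  have all1: "(\<forall>a q. a \<in> A \<and> q \<in> carrier ?Q \<longrightarrow> P a q) \<longleftrightarrow> (\<forall>a\<in>A. \<forall>q\<in>carrier ?Q. P a q)"
      for A :: "'z set" and P
    by blast
  have all2: "(\<forall>p q r. p \<in> A \<and> q \<in> B \<and> r \<in> carrier ?Q \<longrightarrow> P p q r) \<longleftrightarrow>
      (\<forall>p\<in>A. \<forall>q\<in>B. \<forall>r\<in>carrier ?Q. P p q r)" for A :: "'y set" and B :: "'z set" and P
    by blast
  have sc: "a \<odot>\<^bsub>V\<^esub> x \<in> carrier V" if "x \<in> carrier V" for a x
    using V.smult_closed that by (simp add: class_ring_simps)
  have ring: "(a * b) \<odot>\<^bsub>V\<^esub> x = a \<odot>\<^bsub>V\<^esub> (b \<odot>\<^bsub>V\<^esub> x)"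
    "(a + b) \<odot>\<^bsub>V\<^esub> x = a \<odot>\<^bsub>V\<^esub> x \<oplus>\<^bsub>V\<^esub> b \<odot>\<^bsub>V\<^esub> x"
    "a \<odot>\<^bsub>V\<^esub> (x \<oplus>\<^bsub>V\<^esub> y) = a \<odot>\<^bsub>V\<^esub> x \<oplus>\<^bsub>V\<^esub> a \<odot>\<^bsub>V\<^esub> y"
    "1 \<odot>\<^bsub>V\<^esub> x = x"
    if "x \<in> carrier V" "y \<in> carrier V" for a b x y
    using V.smult_assoc1[of a b x] V.smult_l_distr[of a b x] V.smult_r_distr[of a x y]
        V.smult_one[of x] that
    by (simp_all add: class_ring_simps)
  show "vectorspace class_ring ?Q"
  proof (rule vs_criteria, goal_cases)
    case 1 show ?case by (rule class_field)
  next
    case 2 show ?case unfolding zero by (rule elem) simp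
  next
    case 4 show ?case
      unfolding all zero using fold(1) elem V.r_neg V.a_inv_closed by metis
  qed (unfold all1 all2 all zero, auto simp: fold elem sc ring V.a_ac class_ring_simps)
qed

theorem dim_quotient_space:
  assumes sub: "subspace (class_ring :: real ring) U V" and vs: "vectorspace class_ring V"
    and closed: "\<And>x. x \<in> carrier_vec (dim_row A) \<Longrightarrow> f x \<in> carrier V"
    and add: "\<And>x y. x \<in> carrier_vec (dim_row A) \<Longrightarrow> y \<in> carrier_vec (dim_row A) \<Longrightarrow>
        f (x + y) = f x \<oplus>\<^bsub>V\<^esub> f y"
    and smult: "\<And>a x. x \<in> carrier_vec (dim_row A) \<Longrightarrow> f (a \<cdot>\<^sub>v x) = a \<odot>\<^bsub>V\<^esub> f x"
    and surj: "\<And>c. c \<in> carrier V \<Longrightarrow> \<exists>x\<in>carrier_vec (dim_row A). f x \<ominus>\<^bsub>V\<^esub> c \<in> U"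
    and ker: "\<And>x. x \<in> carrier_vec (dim_row A) \<Longrightarrow>
        f x \<in> U \<longleftrightarrow> x \<in> (\<lambda>y. A *\<^sub>v y) ` carrier_vec (dim_col A)"
  shows "vectorspace.dim class_ring (quotient_space V U) + mrank A = dim_row A"
proof (rule dim_surjective_image[where f = "\<lambda>x. U +>\<^bsub>V\<^esub> f x"])
  note Q = quotient_space_vectorspace[OF sub vs]
  show "vectorspace class_ring (quotient_space V U)" by (rule Q)
  show "\<exists>x\<in>carrier_vec (dim_row A). U +>\<^bsub>V\<^esub> f x = q"
    if q: "q \<in> carrier (quotient_space V U)" for q
    using Q(3)[OF q] surj Q(6) closed by blast
qed (use quotient_space_vectorspace[OF sub vs] closed add smult ker in auto)

section \<open>Axis-parallel segments and rectangles in either direction\<close>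

text \<open>
  Horizontal and vertical segments are treated together. A Boolean \<open>h\<close> stands for a direction,
  \<open>True\<close> for horizontal; \<open>along h\<close> is the coordinate that varies in this direction, and \<open>along (\<not>
  h)\<close> the one that is constant on a line of this direction.
\<close>
definition along :: "bool \<Rightarrow> point \<Rightarrow> real" where
  "along h v = (if h then fst v else snd v)"

definition lo :: "bool \<Rightarrow> rect \<Rightarrow> real" where
  "lo h r = (if h then xlo r else ylo r)"

definition hi :: "bool \<Rightarrow> rect \<Rightarrow> real" where
  "hi h r = (if h then xhi r else yhi r)"

definition oseg :: "bool \<Rightarrow> seg \<Rightarrow> bool" where
  "oseg h e \<longleftrightarrow> along h (fst e) < along h (snd e) \<and> along (\<not> h) (fst e) = along (\<not> h) (snd e)"

lemma oseg_simps: "oseg True e = hseg e" "oseg False e = vseg e"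
  by (auto simp: oseg_def along_def hseg_def vseg_def)

lemma hseg_or_vseg: "hseg e \<or> vseg e \<longleftrightarrow> (\<exists>h. oseg h e)"
  by (metis oseg_simps)

lemma oseg_unique: "oseg h e \<Longrightarrow> oseg h' e \<Longrightarrow> h = h'"
  by (cases h; cases h') (auto simp: oseg_def along_def)

lemma hseg_iff_oseg: "oseg h e \<Longrightarrow> hseg e \<longleftrightarrow> h"
  using oseg_unique[of h e True] by (auto simp: oseg_simps)

lemma point_eqI: "along h v = along h w \<Longrightarrow> along (\<not> h) v = along (\<not> h) w \<Longrightarrow> v = w"
  by (cases h; cases v; cases w) (auto simp: along_def)

lemma all_bool_iff: "(\<forall>h. P h) \<longleftrightarrow> P h \<and> P (\<not> h)" for h :: bool
  by (cases h) (auto simp: all_bool_eq)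

lemma point_exists: obtains v where "along h v = a" "along (\<not> h) v = c"
proof
  show "along h (if h then (a, c) else (c, a)) = a" "along (\<not> h) (if h then (a, c) else (c, a)) = c"
    by (auto simp: along_def)
qed

lemma point_exists_all: "\<exists>v. \<forall>h. along h v = f h"
proof
  show "\<forall>h. along h (f True, f False) = f h" by (auto simp: along_def)
qed

lemma closed_segment_horizontal:
  fixes a b c :: real assumes "a \<le> b"
  shows "closed_segment (a, c) (b, c) = {v. snd v = c \<and> a \<le> fst v \<and> fst v \<le> b}"
proof -
  have "closed_segment (a, c) (b, c) = (\<lambda>x. (x, c)) ` closed_segment a b"
    by (auto simp: closed_segment_def image_iff algebra_simps)
       (metis (no_types, opaque_lifting) add.commute add_diff_cancel_left' mult.commute mult_1
           left_diff_distrib diff_add_cancel)+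
  also have "closed_segment a b = {a..b}" using assms by (simp add: closed_segment_eq_real_ivl)
  finally show ?thesis by (auto simp: image_iff)
qed

lemma closed_segment_vertical:
  fixes a b c :: real assumes "a \<le> b"
  shows "closed_segment (c, a) (c, b) = {v. fst v = c \<and> a \<le> snd v \<and> snd v \<le> b}"
proof -
  have "closed_segment (c, a) (c, b) = prod.swap ` closed_segment (a, c) (b, c)"
    using closed_segment_linear_image[of prod.swap "(a, c)" "(b, c)"]
    by (simp add: linear_iff)
  then show ?thesis using closed_segment_horizontal[OF assms, of c] by (auto simp: image_iff)
qed

lemma mem_supp_iff:
  assumes "oseg h e"
  shows "v \<in> supp e \<longleftrightarrow> along (\<not> h) v = along (\<not> h) (fst e) \<and> along h (fst e) \<le> along h v \<and>
        along h v \<le> along h (snd e)"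
proof (cases h)
  case True
  then show ?thesis using assms closed_segment_horizontal[of "fst (fst e)" "fst (snd e)"
      "snd (fst e)"]
    unfolding supp_def oseg_def along_def by (cases e; cases "fst e"; cases "snd e") auto
next
  case False
  then show ?thesis using assms closed_segment_vertical[of "snd (fst e)" "snd (snd e)"
      "fst (fst e)"]
    unfolding supp_def oseg_def along_def by (cases e; cases "fst e"; cases "snd e") auto
qed

lemma mem_open_segment_iff:
  assumes "oseg h e"
  shows "v \<in> open_segment (fst e) (snd e) \<longleftrightarrow>
    along (\<not> h) v = along (\<not> h) (fst e) \<and> along h (fst e) < along h v \<and> along h v < along h (snd e)"
proof -
  have "v \<in> open_segment (fst e) (snd e) \<longleftrightarrow> v \<in> supp e \<and> v \<noteq> fst e \<and> v \<noteq> snd e"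
    by (auto simp: open_segment_def supp_def)
  moreover have "v = fst e \<longleftrightarrow> along h v = along h (fst e) \<and> along (\<not> h) v = along (\<not> h) (fst e)"
    "v = snd e \<longleftrightarrow> along h v = along h (snd e) \<and> along (\<not> h) v = along (\<not> h) (fst e)"
    using assms point_eqI[of h v "fst e"] point_eqI[of h v "snd e"] by (auto simp: oseg_def)
  ultimately show ?thesis using mem_supp_iff[OF assms, of v] assms by (auto simp: oseg_def)
qed

lemma coord_eq_along: "oseg h l \<Longrightarrow> coord l v = along h v"
  by (auto simp: coord_def along_def hseg_iff_oseg)

lemma mem_rect_set: "v \<in> rect_set r \<longleftrightarrow> (\<forall>h. lo h r \<le> along h v \<and> along h v \<le> hi h r)"
  by (cases v) (auto simp: rect_set_def lo_def hi_def along_def all_bool_eq)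

lemma mem_corners: "v \<in> corners r \<longleftrightarrow> (\<forall>h. along h v = lo h r \<or> along h v = hi h r)"
  by (cases v) (auto simp: corners_def lo_def hi_def along_def all_bool_eq)

lemma mem_interior_rect: "v \<in> interior (rect_set r) \<longleftrightarrow> (\<forall>h. lo h r < along h v \<and> along h v < hi h r)"
  by (cases v) (auto simp: rect_set_def lo_def hi_def along_def all_bool_eq interior_Times)

lemma mem_frontier_rect:
  "v \<in> frontier (rect_set r) \<longleftrightarrow> v \<in> rect_set r \<and> (\<exists>h. along h v = lo h r \<or> along h v = hi h r)"
proof -
  have "closed (rect_set r)" by (simp add: rect_set_def closed_Times)
  then have "v \<in> frontier (rect_set r) \<longleftrightarrow> v \<in> rect_set r \<and> v \<notin> interior (rect_set r)"
    by (simp add: frontier_def)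
  then show ?thesis unfolding mem_interior_rect mem_rect_set less_le by metis
qed

lemma open_box: "open {w. a < along h w \<and> along h w < b \<and> c < along (\<not> h) w \<and> along (\<not> h) w < d}"
proof -
  have "continuous_on UNIV (along k)" for k
    unfolding along_def by (cases k) (auto intro: continuous_intros)
  then show ?thesis by (intro open_Collect_conj open_Collect_less) (auto intro: continuous_intros)
qed

text \<open>
  A step size below the distance from \<open>a\<close> to all other points of a finite set.
\<close>
lemma finite_gap:
  fixes S :: "real set" assumes "finite S"
  obtains e where "e > 0" "\<And>x. x \<in> S \<Longrightarrow> x \<noteq> a \<Longrightarrow> e < \<bar>x - a\<bar>"
proof -
  have "\<exists>e>0. \<forall>x\<in>S. x \<noteq> a \<longrightarrow> e < \<bar>x - a\<bar>"
    using assms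
  proof induction
    case (insert y S)
    then obtain e where e: "e > 0" "\<forall>x\<in>S. x \<noteq> a \<longrightarrow> e < \<bar>x - a\<bar>" by blast
    show ?case
    proof (cases "y = a")
      case False
      then have "0 < \<bar>y - a\<bar>" by simp
      then show ?thesis using e by (intro exI[of _ "min e (\<bar>y - a\<bar> / 2)"]) (auto simp: min_def)
    qed (use e in auto)
  qed (auto intro: exI[of _ 1])
  then show ?thesis using that by blast
qed

section \<open>The local structure of a T-mesh\<close>

locale mesh =
  fixes C :: "rect set"
  assumes t_mesh: "t_mesh C"
begin

abbreviation region :: "point set" where
  "region \<equiv> mesh_domain C"

lemma finite_cells: "finite C" and lo_less_hi: "r \<in> C \<Longrightarrow> lo h r < hi h r"
  using t_mesh by (auto simp: t_mesh_def lo_def hi_def)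

lemma finite_vertices: "finite (vertices C)"
  using finite_cells by (auto simp: vertices_def corners_def)

text \<open>
  Disjointness of interiors in terms of coordinates: rectangles overlap as soon as both pairs of
  intervals do.
\<close>
lemma overlapping_cells_eq:
  assumes "r \<in> C" "r' \<in> C" "\<And>h. max (lo h r) (lo h r') < min (hi h r) (hi h r')"
  shows "r = r'"
proof (rule ccontr)
  assume "r \<noteq> r'"
  obtain v where v: "\<And>h. along h v = (max (lo h r) (lo h r') + min (hi h r) (hi h r')) / 2"
    using point_exists_all[of "\<lambda>h. (max (lo h r) (lo h r') + min (hi h r) (hi h r')) / 2"] by blast
  have "lo h r < along h v" "along h v < hi h r" "lo h r' < along h v" "along h v < hi h r'" for h
    using assms(3)[of h] unfolding v max_def min_def by (auto split: if_splits)
  then have "v \<in> interior (rect_set r) \<inter> interior (rect_set r')"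
    by (auto simp: mem_interior_rect)
  then show False using \<open>r \<noteq> r'\<close> assms(1,2) t_mesh by (auto simp: t_mesh_def)
qed

lemma mem_domain: "v \<in> region \<longleftrightarrow> (\<exists>r\<in>C. \<forall>h. lo h r \<le> along h v \<and> along h v \<le> hi h r)"
  by (auto simp: mesh_domain_def mem_rect_set)

text \<open>
  The interval \<open>[a, b]\<close> contains a one-sided neighbourhood of \<open>x\<close>: to the right for \<open>s = True\<close>, to
  the left for \<open>s = False\<close>.
\<close>
definition covers_side :: "bool \<Rightarrow> real \<Rightarrow> real \<Rightarrow> real \<Rightarrow> bool" where
  "covers_side s a b x \<longleftrightarrow> (if s then a \<le> x \<and> x < b else a < x \<and> x \<le> b)"

text \<open>
  The rectangle contains the part near \<open>v\<close> of the closed quadrant at \<open>v\<close> that \<open>q\<close> selects: \<open>q h\<close>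
  is the side of \<open>v\<close> in direction \<open>h\<close>.
\<close>
definition covers :: "rect \<Rightarrow> (bool \<Rightarrow> bool) \<Rightarrow> point \<Rightarrow> bool" where
  "covers r q v \<longleftrightarrow> (\<forall>h. covers_side (q h) (lo h r) (hi h r) (along h v))"

text \<open>
  A point of the quadrant that is close enough to \<open>v\<close> lies in some cell. If the step is smaller
  than the distance of \<open>v\<close> to all cell borders that avoid \<open>v\<close>, the same cell reaches \<open>v\<close> itself.
\<close>
lemma quadrant_covered:
  assumes "v \<in> interior region"
  obtains r where "r \<in> C" "covers r q v"
proof -
  obtain e where e: "e > 0" "ball v e \<subseteq> region"
    using assms by (meson mem_interior)
  have "\<exists>d>0. \<forall>r\<in>C. (lo h r \<noteq> along h v \<longrightarrow> d < \<bar>lo h r - along h v\<bar>) \<and>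
        (hi h r \<noteq> along h v \<longrightarrow> d < \<bar>hi h r - along h v\<bar>)" for h
    using finite_gap[of "lo h ` C \<union> hi h ` C" "along h v"] finite_cells
        by (metis UnI1 UnI2 finite_UnI finite_imageI imageI)
  then obtain d where d: "\<And>h. d h > 0"
    "\<And>h r. r \<in> C \<Longrightarrow> lo h r \<noteq> along h v \<Longrightarrow> d h < \<bar>lo h r - along h v\<bar>"
    "\<And>h r. r \<in> C \<Longrightarrow> hi h r \<noteq> along h v \<Longrightarrow> d h < \<bar>hi h r - along h v\<bar>"
    by metis
  \<comment> \<open>below \<open>d h\<close>, so that no cell border is crossed, and small enough for \<open>w\<close> to stay in the ball\<close>
  define t where "t h = min (d h) (e / 4)" for h
  have t: "0 < t h" "t h \<le> d h" "t h \<le> e / 4" for h using d(1)[of h] e(1) by (auto simp: t_def)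
  obtain w where w: "\<And>h. along h w = along h v + (if q h then t h else - t h)"
    using point_exists_all[of "\<lambda>h. along h v + (if q h then t h else - t h)"] by blast
  have "dist v w \<le> dist (fst v) (fst w) + dist (snd v) (snd w)"
    by (cases v, cases w) (simp add: dist_Pair_Pair sqrt_sum_squares_le_sum)
  also have "\<dots> \<le> e / 4 + e / 4"
    using w[of True] w[of False] t[of True] t[of False] by (auto simp: along_def dist_real_def)
  finally have "w \<in> region" using e by auto
  then obtain r where r: "r \<in> C" "\<And>h. lo h r \<le> along h w" "\<And>h. along h w \<le> hi h r"
    unfolding mem_domain by auto
  have "covers_side (q h) (lo h r) (hi h r) (along h v)" for h
  proof (cases "q h")
    case True
    have "\<not> along h v < lo h r" using r(2)[of h] w[of h] t[of h] d(2)[OF r(1), of h] True by force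
    then show ?thesis using r(3)[of h] w[of h] t[of h] True by (auto simp: covers_side_def)
  next
    case False
    have "\<not> hi h r < along h v" using r(3)[of h] w[of h] t[of h] d(3)[OF r(1), of h] False by force
    then show ?thesis using r(2)[of h] w[of h] t[of h] False by (auto simp: covers_side_def)
  qed
  then show ?thesis using that[OF r(1)] by (auto simp: covers_def)
qed

text \<open>Two cells that cover the same quadrant at \<open>v\<close> overlap.\<close>
lemma quadrant_unique:
  assumes "r \<in> C" "r' \<in> C" "covers r q v" "covers r' q v"
  shows "r = r'"
proof (rule overlapping_cells_eq[OF assms(1,2)])
  fix h show "max (lo h r) (lo h r') < min (hi h r) (hi h r')"
    using assms(3,4)[unfolded covers_def, rule_format, of h]
        by (cases "q h") (auto simp: covers_side_def)
qed

lemma edgesD: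
  assumes "e \<in> edges C" "oseg h e"
  shows "fst e \<in> vertices C" "snd e \<in> vertices C"
    and "\<And>v. v \<in> vertices C \<Longrightarrow> along (\<not> h) v = along (\<not> h) (fst e) \<Longrightarrow> along h v \<le> along h (fst e) \<or>
          along h (snd e) \<le> along h v"
    and "\<And>v. along (\<not> h) v = along (\<not> h) (fst e) \<Longrightarrow> along h (fst e) \<le> along h v \<Longrightarrow>
          along h v \<le> along h (snd e) \<Longrightarrow>
       \<exists>r\<in>C. v \<in> frontier (rect_set r)"
proof -
  show "fst e \<in> vertices C" "snd e \<in> vertices C" using assms(1) by (auto simp: edges_def)
  show "along h v \<le> along h (fst e) \<or> along h (snd e) \<le> along h v"
    if "v \<in> vertices C" "along (\<not> h) v = along (\<not> h) (fst e)" for v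
  proof (rule ccontr)
    assume "\<not> ?thesis"
    then have "v \<in> open_segment (fst e) (snd e)" using that mem_open_segment_iff[OF assms(2)]
        by auto
    then show False using that assms(1) by (auto simp: edges_def)
  qed
  show "\<exists>r\<in>C. v \<in> frontier (rect_set r)"
    if "along (\<not> h) v = along (\<not> h) (fst e)" "along h (fst e) \<le> along h v"
        "along h v \<le> along h (snd e)" for v
  proof -
    have "v \<in> supp e" using that mem_supp_iff[OF assms(2)] by auto
    then show ?thesis using assms(1) by (auto simp: edges_def)
  qed
qed

lemma edges_oseg: assumes "e \<in> edges C" obtains h where "oseg h e"
  using assms hseg_or_vseg unfolding edges_def by blast

text \<open>
  A border point of one cell that is inside another would make the two cells overlap.
\<close>
lemma frontier_not_inside:
  assumes "r \<in> C" "r' \<in> C" "v \<in> frontier (rect_set r')"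
  shows "\<not> (\<forall>h. lo h r < along h v \<and> along h v < hi h r)"
proof
  assume *: "\<forall>h. lo h r < along h v \<and> along h v < hi h r"
  have **: "\<forall>h. lo h r' \<le> along h v \<and> along h v \<le> hi h r'" using assms(3)
      by (simp add: mem_frontier_rect mem_rect_set)
  have "r = r'"
  proof (rule overlapping_cells_eq[OF assms(1,2)])
    fix h show "max (lo h r) (lo h r') < min (hi h r) (hi h r')"
      using *[rule_format, of h] **[rule_format, of h] lo_less_hi[OF assms(1), of h]
          lo_less_hi[OF assms(2), of h] by auto
  qed
  then show False using * assms(3) unfolding mem_frontier_rect by (metis less_irrefl)
qed

text \<open>
  The cell is adjacent to the edge over its full length, above it or to its right for \<open>s = True\<close>,
  below it or to its left for \<open>s = False\<close>.
\<close>
definition side_cell :: "bool \<Rightarrow> seg \<Rightarrow> bool \<Rightarrow> rect \<Rightarrow> bool" where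
  "side_cell h e s r \<longleftrightarrow> r \<in> C \<and> (if s then lo (\<not> h) r else hi (\<not> h) r) = along (\<not> h) (fst e) \<and>
     lo h r \<le> along h (fst e) \<and> along h (snd e) \<le> hi h r"

lemma corner_vertex:
  assumes "r \<in> C" "along h v = lo h r \<or> along h v = hi h r" "along (\<not> h) v = lo (\<not> h) r \<or>
        along (\<not> h) v = hi (\<not> h) r"
  shows "v \<in> vertices C"
  using assms unfolding vertices_def by (auto simp: mem_corners all_bool_iff[of _ h])

text \<open>
  Some cell covers the quadrant at \<open>z\<close> on the required side. Its side must lie on the line of the
  edge, since otherwise points of the edge would be inside the cell. The ends of this side are
  vertices, so they are not strictly inside the edge and the side extends over all of it.
\<close>
lemma edge_side_cell:
  assumes e: "e \<in> edges C" "oseg h e"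
      and z: "z \<in> open_segment (fst e) (snd e)" "z \<in> interior region"
  shows "\<exists>r. side_cell h e s r"
proof -
  have z1: "along (\<not> h) z = along (\<not> h) (fst e)" "along h (fst e) < along h z"
      "along h z < along h (snd e)"
    using z(1) mem_open_segment_iff[OF e(2)] by auto
  obtain r where r: "r \<in> C" "covers r (\<lambda>k. if k = h then True else s) z"
      using quadrant_covered[OF z(2)] .
  have rh: "lo h r \<le> along h z" "along h z < hi h r"
    using r(2)[unfolded covers_def, rule_format, of h] by (auto simp: covers_side_def)
  have rn: "covers_side s (lo (\<not> h) r) (hi (\<not> h) r) (along (\<not> h) (fst e))"
    using r(2)[unfolded covers_def, rule_format, of "\<not> h"] z1 by auto
  have side: "(if s then lo (\<not> h) r else hi (\<not> h) r) = along (\<not> h) (fst e)"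
  proof (rule ccontr)
    assume "\<not> ?thesis"
    then have in1: "lo (\<not> h) r < along (\<not> h) (fst e)" "along (\<not> h) (fst e) < hi (\<not> h) r"
      using rn by (auto simp: covers_side_def split: if_splits)
    \<comment> \<open>a point of the edge slightly beyond \<open>z\<close>, strictly inside the cell\<close>
    obtain w where w: "along h w = (along h z + min (hi h r) (along h (snd e))) / 2"
        "along (\<not> h) w = along (\<not> h) (fst e)"
      using point_exists .
    have w1: "along h z < along h w" "along h w < hi h r" "along h w < along h (snd e)"
      using rh z1 unfolding w(1) by (auto simp: min_def)
    obtain r' where "r' \<in> C" "w \<in> frontier (rect_set r')"
      using edgesD(4)[OF e w(2)] w1 z1 by auto
    moreover have "\<forall>k. lo k r < along k w \<and> along k w < hi k r"
      unfolding all_bool_iff[of _ h] using w1 rh in1 w(2) by auto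
    ultimately show False using frontier_not_inside[OF r(1)] by blast
  qed
  have corner: "\<exists>v. v \<in> vertices C \<and> along h v = x \<and> along (\<not> h) v = along (\<not> h) (fst e)"
    if "x = lo h r \<or> x = hi h r" for x
  proof -
    obtain v where v: "along h v = x" "along (\<not> h) v = along (\<not> h) (fst e)" using point_exists .
    have "v \<in> vertices C"
      by (rule corner_vertex[OF r(1), of h]) (use v that side in \<open>auto split: if_splits\<close>)
    then show ?thesis using v by blast
  qed
  have "lo h r \<le> along h (fst e)" using corner[of "lo h r"] edgesD(3)[OF e] rh z1 by fastforce
  moreover have "along h (snd e) \<le> hi h r" using corner[of "hi h r"] edgesD(3)[OF e] rh z1
      by fastforce
  ultimately show ?thesis using r(1) side unfolding side_cell_def by blast
qed

lemma mem_interior_domain_if_box: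
  assumes "a < along h v" "along h v < b" "c < along (\<not> h) v" "along (\<not> h) v < d"
    and "\<And>w. a < along h w \<Longrightarrow> along h w < b \<Longrightarrow> c < along (\<not> h) w \<Longrightarrow> along (\<not> h) w < d \<Longrightarrow> w \<in> region"
  shows "v \<in> interior region"
proof (rule interiorI[OF open_box[of a h b c d]])
  show "v \<in> {w. a < along h w \<and> along h w < b \<and> c < along (\<not> h) w \<and> along (\<not> h) w < d}"
      using assms(1-4) by simp
  show "{w. a < along h w \<and> along h w < b \<and> c < along (\<not> h) w \<and> along (\<not> h) w < d} \<subseteq> region"
      using assms(5) by blast
qed

lemma mem_domainI:
  assumes "r \<in> C" "lo h r \<le> along h v" "along h v \<le> hi h r" "lo (\<not> h) r \<le> along (\<not> h) v"
      "along (\<not> h) v \<le> hi (\<not> h) r"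
  shows "v \<in> region"
  unfolding mem_domain using assms by (intro bexI[OF _ assms(1)]) (simp add: all_bool_iff[of _ h])

lemma interior_edge_if_side_cells:
  assumes e: "e \<in> edges C" "oseg h e" and r: "side_cell h e True r" "side_cell h e False r'"
  shows "e \<in> interior_edges C"
proof -
  have "v \<in> interior region" if v: "v \<in> open_segment (fst e) (snd e)" for v
  proof (rule mem_interior_domain_if_box[where a = "along h (fst e)" and b = "along h (snd e)"
        and c = "lo (\<not> h) r'" and d = "hi (\<not> h) r" and h = h])
    fix w assume "along h (fst e) < along h w" "along h w < along h (snd e)"
        "lo (\<not> h) r' < along (\<not> h) w" "along (\<not> h) w < hi (\<not> h) r"
    then show "w \<in> region"
      using mem_domainI[of r h w] mem_domainI[of r' h w] r unfolding side_cell_def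
      by (cases "along (\<not> h) w \<ge> along (\<not> h) (fst e)") auto
  qed (use v mem_open_segment_iff[OF e(2)] r lo_less_hi[of r "\<not> h"] lo_less_hi[of r'
      "\<not> h"] in \<open>auto simp: side_cell_def\<close>)
  then show ?thesis using e by (auto simp: interior_edges_def)
qed

text \<open>
  An edge with a point in the interior of the region also has an interior point strictly between
  its ends. There \<open>edge_side_cell\<close> gives cells on both sides of the whole edge.
\<close>
lemma edge_touching_interior:
  assumes e: "e \<in> edges C" and u: "u \<in> supp e" "u \<in> interior region"
  shows "e \<in> interior_edges C"
proof -
  obtain h where h: "oseg h e" using edges_oseg[OF e] .
  have ne: "fst e \<noteq> snd e" using h by (auto simp: oseg_def)
  have "closure (open_segment (fst e) (snd e)) = supp e"
    using ne by (simp add: supp_def)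
  then have "interior region \<inter> open_segment (fst e) (snd e) \<noteq> {}"
    using u open_Int_closure_eq_empty[of "interior region" "open_segment (fst e) (snd e)"] by auto
  then obtain z where "z \<in> open_segment (fst e) (snd e)" "z \<in> interior region" by auto
  then show ?thesis using edge_side_cell[OF e h] interior_edge_if_side_cells[OF e h] by metis
qed

lemma interior_edge_side_cell:
  assumes "e \<in> interior_edges C" "oseg h e"
  obtains r where "side_cell h e s r"
proof -
  have ne: "fst e \<noteq> snd e" using assms(2) by (auto simp: oseg_def)
  have "e \<in> edges C" "midpoint (fst e) (snd e) \<in> open_segment (fst e) (snd e)"
    "midpoint (fst e) (snd e) \<in> interior region"
    using assms(1) ne by (auto simp: interior_edges_def)
  then show ?thesis using edge_side_cell[OF _ assms(2)] that by blast
qed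

text \<open>
  The four cells adjacent to two consecutive interior edges surround their common end.
\<close>
lemma interior_if_between_edges:
  assumes "e \<in> interior_edges C" "oseg h e" "snd e = v"
    and "e' \<in> interior_edges C" "oseg h e'" "fst e' = v"
  shows "v \<in> interior region"
proof -
  obtain r1 r2 where r: "side_cell h e True r1" "side_cell h e False r2"
    using interior_edge_side_cell[OF assms(1,2)] by metis
  obtain r1' r2' where r': "side_cell h e' True r1'" "side_cell h e' False r2'"
    using interior_edge_side_cell[OF assms(4,5)] by metis
  have o: "along h (fst e) < along h v" "along (\<not> h) (fst e) = along (\<not> h) v"
      "along h v < along h (snd e')"
    "along (\<not> h) (snd e') = along (\<not> h) v"
    using assms by (auto simp: oseg_def)
  note cells = r[unfolded side_cell_def assms(3) if_True if_False]
      r'[unfolded side_cell_def assms(6) if_True if_False]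
  have inC: "r1 \<in> C" "r2 \<in> C" "r1' \<in> C" "r2' \<in> C" using cells by auto
  have c1: "lo (\<not> h) r1 = along (\<not> h) v" "lo h r1 \<le> along h (fst e)" "along h v \<le> hi h r1"
    and c2: "hi (\<not> h) r2 = along (\<not> h) v" "lo h r2 \<le> along h (fst e)" "along h v \<le> hi h r2"
    and c1': "lo (\<not> h) r1' = along (\<not> h) v" "lo h r1' \<le> along h v" "along h (snd e') \<le> hi h r1'"
    and c2': "hi (\<not> h) r2' = along (\<not> h) v" "lo h r2' \<le> along h v" "along h (snd e') \<le> hi h r2'"
    using cells o by auto
  note lh = lo_less_hi[OF inC(1), of "\<not> h"] lo_less_hi[OF inC(2), of "\<not> h"]
    lo_less_hi[OF inC(3), of "\<not> h"] lo_less_hi[OF inC(4), of "\<not> h"]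
  show ?thesis
  proof (rule mem_interior_domain_if_box[where a = "along h (fst e)" and b = "along h (snd e')"
        and c = "max (lo (\<not> h) r2) (lo (\<not> h) r2')" and d = "min (hi (\<not> h) r1) (hi (\<not> h) r1')"
            and h = h])
    fix w assume w: "along h (fst e) < along h w" "along h w < along h (snd e')"
      "max (lo (\<not> h) r2) (lo (\<not> h) r2') < along (\<not> h) w"
          "along (\<not> h) w < min (hi (\<not> h) r1) (hi (\<not> h) r1')"
    consider "along (\<not> h) v \<le> along (\<not> h) w" "along h w \<le> along h v" | "along (\<not> h) v \<le>
          along (\<not> h) w" "along h v \<le> along h w"
      | "along (\<not> h) w \<le> along (\<not> h) v" "along h w \<le> along h v" | "along (\<not> h) w \<le> along (\<not> h) v"
          "along h v \<le> along h w"
      by linarith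
    then show "w \<in> region"
    proof cases
      case 1 then show ?thesis using c1 w by (intro mem_domainI[OF inC(1), of h]) auto
    next
      case 2 then show ?thesis using c1' w by (intro mem_domainI[OF inC(3), of h]) auto
    next
      case 3 then show ?thesis using c2 w by (intro mem_domainI[OF inC(2), of h]) auto
    next
      case 4 then show ?thesis using c2' w by (intro mem_domainI[OF inC(4), of h]) auto
    qed
  qed (use o c1 c2 c1' c2' lh in auto)
qed

end

lemma finite_minimizer:
  fixes f :: "'a \<Rightarrow> real" assumes "finite N" "c \<in> N"
  obtains w where "w \<in> N" "\<And>u. u \<in> N \<Longrightarrow> f w \<le> f u"
proof -
  have "Min (f ` N) \<in> f ` N" using assms by (intro Min_in) auto
  then obtain w where "w \<in> N" "f w = Min (f ` N)" by auto
  then show ?thesis using that assms by (metis Min_le finite_imageI imageI)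
qed

context mesh begin

text \<open>
  The edge leaves \<open>v\<close> in direction \<open>h\<close>, towards larger coordinates for \<open>s = True\<close> and towards
  smaller ones for \<open>s = False\<close>.
\<close>
definition edge_dir :: "bool \<Rightarrow> bool \<Rightarrow> point \<Rightarrow> seg \<Rightarrow> bool" where
  "edge_dir h s v e \<longleftrightarrow> e \<in> edges C \<and> oseg h e \<and> (if s then fst e = v else snd e = v)"

lemma edge_dir_unique:
  assumes "edge_dir h s v e" "edge_dir h s v e'"
  shows "e = e'"
proof -
  have e: "e \<in> edges C" "oseg h e" "e' \<in> edges C" "oseg h e'" using assms
      by (auto simp: edge_dir_def)
  note o = e(2)[unfolded oseg_def] e(4)[unfolded oseg_def]
  show ?thesis
  proof (cases s)
    case True
    then have f: "fst e = v" "fst e' = v" using assms by (auto simp: edge_dir_def)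
    have "along h (snd e) = along h (snd e')"
      using edgesD(3)[OF e(1,2) edgesD(2)[OF e(3,4)]] edgesD(3)[OF e(3,4) edgesD(2)[OF e(1,2)]] o f
          by auto
    then have "snd e = snd e'" using o f point_eqI[of h "snd e" "snd e'"] by auto
    then show ?thesis using f by (simp add: prod_eq_iff)
  next
    case False
    then have f: "snd e = v" "snd e' = v" using assms by (auto simp: edge_dir_def)
    have "along h (fst e) = along h (fst e')"
      using edgesD(3)[OF e(1,2) edgesD(1)[OF e(3,4)]] edgesD(3)[OF e(3,4) edgesD(1)[OF e(1,2)]] o f
          by auto
    then have "fst e = fst e'" using o f point_eqI[of h "fst e" "fst e'"] by auto
    then show ?thesis using f by (simp add: prod_eq_iff)
  qed
qed

lemma edges_between_consecutive_vertices:
  assumes "oseg h e" "fst e \<in> vertices C" "snd e \<in> vertices C"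
    and gap: "\<And>v. v \<in> vertices C \<Longrightarrow> along (\<not> h) v = along (\<not> h) (fst e) \<Longrightarrow>
          along h v \<le> along h (fst e) \<or> along h (snd e) \<le> along h v"
    and r: "r \<in> C" "lo (\<not> h) r = along (\<not> h) (fst e) \<or> hi (\<not> h) r = along (\<not> h) (fst e)"
      "lo h r \<le> along h (fst e)" "along h (snd e) \<le> hi h r"
  shows "e \<in> edges C"
proof -
  have "v \<in> frontier (rect_set r)" if "v \<in> supp e" for v
    using that r lo_less_hi[OF r(1), of "\<not> h"]
        unfolding mem_supp_iff[OF assms(1)] mem_frontier_rect mem_rect_set
    by (auto simp: all_bool_iff[of _ h] intro!: exI[of _ "\<not> h"])
  moreover have "open_segment (fst e) (snd e) \<inter> vertices C = {}"
    using gap mem_open_segment_iff[OF assms(1)] by fastforce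
  ultimately show ?thesis
    unfolding edges_def using assms(1-3) r(1) hseg_or_vseg by blast
qed

text \<open>
  A side of a cell on the line through \<open>v\<close> ends in a corner. The edge goes from \<open>v\<close> to the nearest
  vertex on the way to this corner.
\<close>
lemma edge_dir_exists:
  assumes v: "v \<in> vertices C" and r: "r \<in> C" "lo (\<not> h) r = along (\<not> h) v \<or>
        hi (\<not> h) r = along (\<not> h) v"
    "covers_side s (lo h r) (hi h r) (along h v)"
  shows "\<exists>e. edge_dir h s v e"
proof (cases s)
  case True
  then have rh: "lo h r \<le> along h v" "along h v < hi h r" using r(3) by (auto simp: covers_side_def)
  define N where "N = {w \<in> vertices C. along (\<not> h) w = along (\<not> h) v \<and> along h v < along h w}"
  obtain c where c: "along h c = hi h r" "along (\<not> h) c = along (\<not> h) v" using point_exists .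
  have "c \<in> vertices C" by (rule corner_vertex[OF r(1), of h]) (use c r(2) in auto)
  then have cN: "c \<in> N" using c rh by (simp add: N_def)
  have "finite N" using finite_vertices by (simp add: N_def)
  then obtain w where w: "w \<in> N" "\<And>u. u \<in> N \<Longrightarrow> along h w \<le> along h u"
    using finite_minimizer[OF _ cN, of "along h"] by blast
  have "(v, w) \<in> edges C"
    by (rule edges_between_consecutive_vertices[of h _ r])
       (use v w r w(2)[OF cN] rh c in \<open>force simp: N_def oseg_def\<close>)+
  then show ?thesis using w(1) True
      by (intro exI[of _ "(v, w)"]) (auto simp: edge_dir_def oseg_def N_def)
next
  case False
  then have rh: "lo h r < along h v" "along h v \<le> hi h r" using r(3) by (auto simp: covers_side_def)
  define N where "N = {w \<in> vertices C. along (\<not> h) w = along (\<not> h) v \<and> along h w < along h v}"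
  obtain c where c: "along h c = lo h r" "along (\<not> h) c = along (\<not> h) v" using point_exists .
  have "c \<in> vertices C" by (rule corner_vertex[OF r(1), of h]) (use c r(2) in auto)
  then have cN: "c \<in> N" using c rh by (simp add: N_def)
  have "finite N" using finite_vertices by (simp add: N_def)
  then obtain w where w: "w \<in> N" "\<And>u. u \<in> N \<Longrightarrow> along h u \<le> along h w"
    using finite_minimizer[OF _ cN, of "\<lambda>u. - along h u"] by auto
  have "(w, v) \<in> edges C"
    by (rule edges_between_consecutive_vertices[of h _ r])
       (use v w r w(2)[OF cN] rh c in \<open>force simp: N_def oseg_def\<close>)+
  then show ?thesis using w(1) False
      by (intro exI[of _ "(w, v)"]) (auto simp: edge_dir_def oseg_def N_def)
qed

text \<open>
  If two different cells met along the ray from \<open>v\<close> in this direction, there would be an edge. So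
  one cell covers both quadrants next to the ray.
\<close>
lemma missing_direction_covered:
  assumes v: "v \<in> vertices C" "v \<in> interior region" and no: "\<not> (\<exists>e. edge_dir h s v e)"
  obtains r where "r \<in> C" "covers_side s (lo h r) (hi h r) (along h v)"
      "\<And>s'. covers_side s' (lo (\<not> h) r) (hi (\<not> h) r) (along (\<not> h) v)"
proof -
  obtain r where r: "r \<in> C" "covers r (\<lambda>k. if k = h then s else True) v"
      using quadrant_covered[OF v(2)] .
  have rh: "covers_side s (lo h r) (hi h r) (along h v)"
    using r(2)[unfolded covers_def, rule_format, of h] by simp
  have rn: "covers_side True (lo (\<not> h) r) (hi (\<not> h) r) (along (\<not> h) v)"
    using r(2)[unfolded covers_def, rule_format, of "\<not> h"] by simp
  have "lo (\<not> h) r \<noteq> along (\<not> h) v" using edge_dir_exists[OF v(1) r(1) _ rh] no by blast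
  then have "covers_side s' (lo (\<not> h) r) (hi (\<not> h) r) (along (\<not> h) v)" for s'
    using rn by (auto simp: covers_side_def)
  then show ?thesis using that r(1) rh by blast
qed

text \<open>
  Let \<open>r0\<close> be a cell with corner \<open>v\<close>; it covers one quadrant \<open>q\<close> only. A missing direction next to
  \<open>q\<close> would make one cell cover \<open>q\<close> and a neighbouring quadrant, so only the two opposite
  directions can be missing. If both were, one cell would cover the three quadrants other than
  \<open>q\<close>; being a rectangle it would cover \<open>q\<close> as well and thus be \<open>r0\<close>.
\<close>
lemma at_most_one_missing_direction:
  assumes v: "v \<in> vertices C" "v \<in> interior region"
    and no: "\<not> (\<exists>e. edge_dir h s v e)" "\<not> (\<exists>e. edge_dir h' s' v e)"
  shows "h = h' \<and> s = s'"
proof -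
  \<comment> \<open>\<open>q\<close> is the only quadrant at \<open>v\<close> that the cell \<open>r0\<close> covers\<close>
  obtain r0 where r0: "r0 \<in> C" "\<And>k. along k v = lo k r0 \<or> along k v = hi k r0"
    using v(1) unfolding vertices_def mem_corners[symmetric] by (auto simp: mem_corners)
  define q where "q k = (along k v = lo k r0)" for k
  have q: "covers_side s (lo k r0) (hi k r0) (along k v) \<longleftrightarrow> s = q k" for k s
    using r0(2)[of k] lo_less_hi[OF r0(1), of k] by (cases s) (auto simp: covers_side_def q_def)
  have r0_eq: "r = r0" if "r \<in> C" "\<And>k. covers_side (q k) (lo k r) (hi k r) (along k v)" for r
    by (rule quadrant_unique[of r r0 q v]) (use that r0(1) q in \<open>auto simp: covers_def\<close>)
  \<comment> \<open>a missing direction must point away from \<open>r0\<close>\<close>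
  have opposite: "s = (\<not> q h)" if no: "\<not> (\<exists>e. edge_dir h s v e)" for h s
  proof (rule ccontr)
    assume s: "s \<noteq> (\<not> q h)"
    obtain r where r: "r \<in> C" "covers_side s (lo h r) (hi h r) (along h v)"
        "\<And>s'. covers_side s' (lo (\<not> h) r) (hi (\<not> h) r) (along (\<not> h) v)"
      using missing_direction_covered[OF v no] by blast
    have "\<forall>k. covers_side (q k) (lo k r) (hi k r) (along k v)"
      unfolding all_bool_iff[of _ h] using r(2) r(3)[of "q (\<not> h)"] s by auto
    then have "r = r0" using r0_eq r(1) by blast
    then show False using r(3)[of True] r(3)[of False] q by auto
  qed
  have "h = h'"
  proof (rule ccontr)
    assume "h \<noteq> h'"
    then have h': "h' = (\<not> h)" by auto
    obtain r where r: "r \<in> C" "covers_side (\<not> q h) (lo h r) (hi h r) (along h v)"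
        "\<And>s'. covers_side s' (lo h' r) (hi h' r) (along h' v)"
      using missing_direction_covered[OF v no(1)] unfolding opposite[OF no(1)] h' by blast
    obtain r' where r': "r' \<in> C" "covers_side (\<not> q h') (lo h' r') (hi h' r') (along h' v)"
        "\<And>s'. covers_side s' (lo h r') (hi h r') (along h v)"
      using missing_direction_covered[OF v no(2)] unfolding opposite[OF no(2)] h' not_not by blast
    have "r = r'"
    proof (rule quadrant_unique[OF r(1) r'(1), of "\<lambda>k. \<not> q k" v])
      show "covers r (\<lambda>k. \<not> q k) v" "covers r' (\<lambda>k. \<not> q k) v"
        unfolding covers_def all_bool_iff[of _ h] using r(2,3) r'(2,3) h' by auto
    qed
    moreover from this have "\<forall>k. covers_side (q k) (lo k r) (hi k r) (along k v)"
      unfolding all_bool_iff[of _ h] using r(3) r'(3) h' by auto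
    ultimately have "r = r0" using r0_eq[OF r(1)] by blast
    then show False using r(3)[of True] r(3)[of False] q by auto
  qed
  then show ?thesis using opposite[OF no(1)] opposite[OF no(2)] by auto
qed

text \<open>The other three directions carry exactly one edge each.\<close>
lemma t_junction_if_missing_direction:
  assumes v: "v \<in> interior_vertices C" and no: "\<not> (\<exists>e. edge_dir h s v e)"
  shows "v \<in> t_junctions C"
proof -
  have v': "v \<in> vertices C" "v \<in> interior region" using v by (auto simp: interior_vertices_def)
  let ?P = "UNIV - {(h, s)} :: (bool \<times> bool) set"
  have ex: "\<exists>e. edge_dir k t v e" if "(k, t) \<in> ?P" for k t
    using at_most_one_missing_direction[OF v' no, of k t] that by auto
  define f where "f k t = (SOME e. edge_dir k t v e)" for k t
  have f: "edge_dir k t v (f k t)" if "(k, t) \<in> ?P" for k t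
    unfolding f_def by (rule someI_ex, rule ex, rule that)
  let ?f = "\<lambda>p. f (fst p) (snd p)"
  have fp: "edge_dir (fst p) (snd p) v (?f p)" if "p \<in> ?P" for p
    using f[of "fst p" "snd p"] that by simp
  have eq: "{e \<in> edges C. v = fst e \<or> v = snd e} = ?f ` ?P" (is "?L = ?R")
  proof
    show "?R \<subseteq> ?L"
    proof (rule image_subsetI)
      fix p assume "p \<in> ?P"
      from fp[OF this] show "?f p \<in> ?L" by (cases "snd p") (simp_all add: edge_dir_def)
    qed
    show "?L \<subseteq> ?R"
    proof
      fix e assume e: "e \<in> ?L"
      obtain k where "oseg k e" using e edges_oseg by blast
      then have kt: "edge_dir k (v = fst e) v e" using e unfolding edge_dir_def
          by (cases "v = fst e") auto
      have "(k, v = fst e) \<noteq> (h, s)"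
      proof
        assume "(k, v = fst e) = (h, s)"
        then have "edge_dir h s v e" using kt by simp
        then show False using no by blast
      qed
      then have p: "(k, v = fst e) \<in> ?P" by blast
      have "e = ?f (k, v = fst e)" using edge_dir_unique[OF fp[OF p]] kt by simp
      then show "e \<in> ?R" by (rule image_eqI[OF _ p])
    qed
  qed
  have "inj_on ?f ?P"
  proof (rule inj_onI)
    fix p p' assume a: "p \<in> ?P" "p' \<in> ?P" "?f p = ?f p'"
    have e: "edge_dir (fst p) (snd p) v (?f p)" "edge_dir (fst p') (snd p') v (?f p)"
      using fp[OF a(1)] fp[OF a(2)] a(3) by simp_all
    then have 1: "fst p = fst p'" using oseg_unique unfolding edge_dir_def by blast
    have "fst (?f p) \<noteq> snd (?f p)" using e(1) by (auto simp: edge_dir_def oseg_def)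
    then have "snd p = snd p'" using e unfolding edge_dir_def
        by (cases "snd p"; cases "snd p'") auto
    then show "p = p'" using 1 by (simp add: prod_eq_iff)
  qed
  then have "valence C v = card ?P" unfolding valence_def eq by (rule card_image)
  also have "\<dots> = 3" by (simp add: card_Diff_singleton)
  finally show ?thesis using v by (simp add: t_junctions_def)
qed

end

section \<open>Segments composed of interior edges\<close>

lemma endpoints_in_supp: "fst l \<in> supp l" "snd l \<in> supp l"
  by (auto simp: supp_def)

lemma oseg_if_supp_subset:
  assumes "oseg h l" "oseg k e" "supp e \<subseteq> supp l"
  shows "oseg h e"
proof (cases "k = h")
  case False
  then have "k = (\<not> h)" by auto
  then have "along (\<not> h) (fst e) < along (\<not> h) (snd e)" using assms(2) by (simp add: oseg_def)
  moreover have "fst e \<in> supp l" "snd e \<in> supp l" using assms(3) endpoints_in_supp[of e] by auto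
  then have "along (\<not> h) (fst e) = along (\<not> h) (snd e)" unfolding mem_supp_iff[OF assms(1)] by simp
  ultimately show ?thesis by simp
qed (use assms in simp)

lemma supp_subset_bounds:
  assumes "oseg h l" "oseg h l'" "supp l \<subseteq> supp l'"
  shows "along h (fst l') \<le> along h (fst l)" "along h (snd l) \<le> along h (snd l')"
      "along (\<not> h) (fst l') = along (\<not> h) (fst l)"
proof -
  have "fst l \<in> supp l'" "snd l \<in> supp l'" using assms(3) endpoints_in_supp[of l] by auto
  then show "along h (fst l') \<le> along h (fst l)" "along h (snd l) \<le> along h (snd l')"
      "along (\<not> h) (fst l') = along (\<not> h) (fst l)"
    unfolding mem_supp_iff[OF assms(2)] by auto
qed

lemma seg_eqI:
  assumes "oseg h l" "oseg h l'" "along h (fst l) = along h (fst l')" "along h (snd l) =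
        along h (snd l')"
    "along (\<not> h) (fst l) = along (\<not> h) (fst l')"
  shows "l = l'"
  using assms point_eqI[of h "fst l" "fst l'"] point_eqI[of h "snd l" "snd l'"]
  by (simp add: oseg_def prod_eq_iff)

context mesh begin

lemma interior_edges_subset: "e \<in> interior_edges C \<Longrightarrow> e \<in> edges C"
  by (simp add: interior_edges_def)

lemma composed_of_edgesD:
  assumes "composed_of_edges C l" "oseg h l" "v \<in> supp l"
  obtains e where "e \<in> interior_edges C" "oseg h e" "v \<in> supp e" "supp e \<subseteq> supp l"
proof -
  obtain E where E: "E \<subseteq> interior_edges C" "supp l = (\<Union>e\<in>E. supp e)"
    using assms(1) by (auto simp: composed_of_edges_def)
  obtain e where e: "e \<in> E" "v \<in> supp e" using assms(3) E(2) by auto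
  have sub: "supp e \<subseteq> supp l" using e E(2) by auto
  have "e \<in> edges C" using e E(1) interior_edges_subset by blast
  then obtain k where "oseg k e" by (rule edges_oseg)
  then show ?thesis using that[of e] e E(1) oseg_if_supp_subset[OF assms(2) _ sub] sub by blast
qed

lemma interior_edge_composed: "e \<in> interior_edges C \<Longrightarrow> composed_of_edges C e"
  unfolding composed_of_edges_def
      by (auto simp: interior_edges_def edges_def intro!: exI[of _ "{e}"])

lemma composed_endpoint_vertices:
  assumes "composed_of_edges C l" "oseg h l"
  shows "fst l \<in> vertices C" "snd l \<in> vertices C"
proof -
  obtain e where e: "e \<in> interior_edges C" "oseg h e" "fst l \<in> supp e" "supp e \<subseteq> supp l"
    using composed_of_edgesD[OF assms endpoints_in_supp(1)] .
  have "fst e = fst l"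
    using supp_subset_bounds[OF e(2) assms(2) e(4)] e(3)[unfolded mem_supp_iff[OF e(2)]]
    by (intro point_eqI[of h]) auto
  then show "fst l \<in> vertices C" using edgesD(1)[OF interior_edges_subset[OF e(1)] e(2)] by simp
  obtain e where e: "e \<in> interior_edges C" "oseg h e" "snd l \<in> supp e" "supp e \<subseteq> supp l"
    using composed_of_edgesD[OF assms endpoints_in_supp(2)] .
  have "snd e = snd l"
    using supp_subset_bounds[OF e(2) assms(2) e(4)] e(3)[unfolded mem_supp_iff[OF e(2)]] e(2)
    by (intro point_eqI[of h]) (auto simp: oseg_def)
  then show "snd l \<in> vertices C" using edgesD(2)[OF interior_edges_subset[OF e(1)] e(2)] by simp
qed

lemma composed_union:
  assumes l: "composed_of_edges C l" "oseg h l" and l': "composed_of_edges C l'" "oseg h l'"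
    and v: "v \<in> supp l" "v \<in> supp l'"
  obtains m where "composed_of_edges C m" "oseg h m" "supp m = supp l \<union> supp l'"
proof -
  define m where "m = (if along h (fst l) \<le> along h (fst l') then fst l else fst l',
    if along h (snd l) \<le> along h (snd l') then snd l' else snd l)"
  note o = l(2)[unfolded oseg_def] l'(2)[unfolded oseg_def]
  note vl = v(1)[unfolded mem_supp_iff[OF l(2)]] v(2)[unfolded mem_supp_iff[OF l'(2)]]
  have m: "oseg h m" using o vl by (auto simp: m_def oseg_def)
  have sm: "supp m = supp l \<union> supp l'"
  proof -
    have "w \<in> supp m \<longleftrightarrow> w \<in> supp l \<union> supp l'" for w
      unfolding Un_iff mem_supp_iff[OF m] mem_supp_iff[OF l(2)] mem_supp_iff[OF l'(2)]
      using vl o by (auto simp: m_def)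
    then show ?thesis by blast
  qed
  obtain E E' where "E \<subseteq> interior_edges C" "supp l = (\<Union>e\<in>E. supp e)"
    "E' \<subseteq> interior_edges C" "supp l' = (\<Union>e\<in>E'. supp e)"
    using l(1) l'(1) by (auto simp: composed_of_edges_def)
  then have "E \<union> E' \<subseteq> interior_edges C \<and> supp m = (\<Union>e\<in>E \<union> E'. supp e)"
    using sm by simp
  then have "composed_of_edges C m"
    unfolding composed_of_edges_def using m hseg_or_vseg by blast
  then show ?thesis using that m sm by blast
qed

text \<open>
  Points of the segment just before \<open>v\<close> lie on an edge of the segment. A step that is shorter than
  the distance to all other vertices leaves no vertex in between, so this edge ends at \<open>v\<close>.
\<close>
lemma composed_step_left:
  assumes l: "composed_of_edges C l" "oseg h l" and v: "v \<in> verts_on C l" "v \<noteq> fst l"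
  obtains e where "e \<in> interior_edges C" "oseg h e" "snd e = v" "fst e \<in> verts_on C l"
proof -
  have vv: "v \<in> vertices C" "v \<in> supp l" using v by (auto simp: verts_on_def)
  note vl = vv(2)[unfolded mem_supp_iff[OF l(2)]]
  have lt: "along h (fst l) < along h v"
    using vl v(2) point_eqI[of h v "fst l"] by force
  obtain d where d: "d > 0" "\<And>x. x \<in> along h ` vertices C \<Longrightarrow> x \<noteq> along h v \<Longrightarrow> d < \<bar>x - along h v\<bar>"
    using finite_gap[of "along h ` vertices C" "along h v"] finite_vertices by blast
  have gap: "d < \<bar>along h u - along h v\<bar>" if "u \<in> vertices C" "along h u \<noteq> along h v" for u
    using d(2) that by blast
  \<comment> \<open>no vertex lies strictly between \<open>z\<close> and \<open>v\<close>\<close>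
  obtain z where z: "along h z = along h v - d" "along (\<not> h) z = along (\<not> h) (fst l)"
      using point_exists .
  have "z \<in> supp l"
    using gap[OF composed_endpoint_vertices(1)[OF l]] lt d(1) vl z unfolding mem_supp_iff[OF l(2)]
        by auto
  then obtain e where e: "e \<in> interior_edges C" "oseg h e" "z \<in> supp e" "supp e \<subseteq> supp l"
    using composed_of_edgesD[OF l] by blast
  note ze = e(3)[unfolded mem_supp_iff[OF e(2)]]
  note ed = edgesD[OF interior_edges_subset[OF e(1)] e(2)]
  have ac: "along (\<not> h) v = along (\<not> h) (fst e)" using ze z vl by simp
  have "along h (snd e) = along h v"
    using gap[OF ed(2)] ed(3)[OF vv(1) ac] ze z d(1) by (cases "along h (snd e) = along h v") auto
  then have "snd e = v" using ac e(2) by (intro point_eqI[of h]) (auto simp: oseg_def)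
  moreover have "fst e \<in> verts_on C l" using ed(1) e(4) endpoints_in_supp(1)[of e]
      by (auto simp: verts_on_def)
  ultimately show ?thesis using that e by blast
qed

lemma composed_step_right:
  assumes l: "composed_of_edges C l" "oseg h l" and v: "v \<in> verts_on C l" "v \<noteq> snd l"
  obtains e where "e \<in> interior_edges C" "oseg h e" "fst e = v" "snd e \<in> verts_on C l"
proof -
  have vv: "v \<in> vertices C" "v \<in> supp l" using v by (auto simp: verts_on_def)
  note vl = vv(2)[unfolded mem_supp_iff[OF l(2)]]
  have lt: "along h v < along h (snd l)"
    using vl v(2) point_eqI[of h v "snd l"] l(2) by (force simp: oseg_def)
  obtain d where d: "d > 0" "\<And>x. x \<in> along h ` vertices C \<Longrightarrow> x \<noteq> along h v \<Longrightarrow> d < \<bar>x - along h v\<bar>"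
    using finite_gap[of "along h ` vertices C" "along h v"] finite_vertices by blast
  have gap: "d < \<bar>along h u - along h v\<bar>" if "u \<in> vertices C" "along h u \<noteq> along h v" for u
    using d(2) that by blast
  obtain z where z: "along h z = along h v + d" "along (\<not> h) z = along (\<not> h) (fst l)"
      using point_exists .
  have "z \<in> supp l"
    using gap[OF composed_endpoint_vertices(2)[OF l]] lt d(1) vl z unfolding mem_supp_iff[OF l(2)]
        by auto
  then obtain e where e: "e \<in> interior_edges C" "oseg h e" "z \<in> supp e" "supp e \<subseteq> supp l"
    using composed_of_edgesD[OF l] by blast
  note ze = e(3)[unfolded mem_supp_iff[OF e(2)]]
  note ed = edgesD[OF interior_edges_subset[OF e(1)] e(2)]
  have ac: "along (\<not> h) v = along (\<not> h) (fst e)" using ze z vl by simp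
  have "along h (fst e) = along h v"
    using gap[OF ed(1)] ed(3)[OF vv(1) ac] ze z d(1) by (cases "along h (fst e) = along h v") auto
  then have "fst e = v" using ac by (intro point_eqI[of h]) auto
  moreover have "snd e \<in> verts_on C l" using ed(2) e(4) endpoints_in_supp(2)[of e]
      by (auto simp: verts_on_def)
  ultimately show ?thesis using that e by blast
qed

lemma t_l_edgeD:
  assumes "l \<in> t_l_edges C"
  shows "composed_of_edges C l" "fst l \<in> interior_vertices C" "snd l \<in> interior_vertices C"
    and "\<And>l'. composed_of_edges C l' \<Longrightarrow> supp l \<subseteq> supp l' \<Longrightarrow> l' = l"
  using assms by (auto simp: t_l_edges_def interior_l_edges_def t_junctions_def)

lemma t_l_edge_oseg: assumes "l \<in> t_l_edges C" obtains h where "oseg h l"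
  using t_l_edgeD(1)[OF assms] hseg_or_vseg unfolding composed_of_edges_def by blast

text \<open>
  The union of two collinear segments with a common point is a segment composed of interior edges,
  so maximality applies.
\<close>
lemma t_l_edge_absorbs:
  assumes l: "l \<in> t_l_edges C" "oseg h l" and l': "composed_of_edges C l'" "oseg h l'"
    and v: "v \<in> supp l" "v \<in> supp l'"
  shows "supp l' \<subseteq> supp l"
  using composed_union[OF t_l_edgeD(1)[OF l(1)] l(2) l' v] t_l_edgeD(4)[OF l(1)]
      by (metis Un_upper1 Un_upper2)

lemma t_l_edge_unique:
  assumes "l \<in> t_l_edges C" "oseg h l" "l' \<in> t_l_edges C" "oseg h l'" "v \<in> supp l" "v \<in> supp l'"
  shows "l = l'"
  using t_l_edge_absorbs[OF assms(1,2) t_l_edgeD(1)[OF assms(3)] assms(4-6)]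
      t_l_edgeD(4)[OF assms(3)]
    t_l_edgeD(1)[OF assms(1)] by blast

lemma t_l_edge_interior_vertices:
  assumes "l \<in> t_l_edges C" "v \<in> verts_on C l"
  shows "v \<in> interior_vertices C"
proof -
  obtain h where h: "oseg h l" using t_l_edge_oseg[OF assms(1)] .
  note l = t_l_edgeD[OF assms(1)]
  consider "v = fst l" | "v = snd l" | "v \<noteq> fst l" "v \<noteq> snd l" by blast
  then show ?thesis
  proof cases
    case 3
    obtain e where e: "e \<in> interior_edges C" "oseg h e" "snd e = v"
      using composed_step_left[OF l(1) h assms(2) 3(1)] by blast
    obtain e' where e': "e' \<in> interior_edges C" "oseg h e'" "fst e' = v"
      using composed_step_right[OF l(1) h assms(2) 3(2)] by blast
    show ?thesis
      using interior_if_between_edges[OF e e'] assms(2)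
          by (simp add: interior_vertices_def verts_on_def)
  qed (use l in auto)
qed

lemma t_l_edge_contains_both_endpoints:
  assumes l: "l \<in> t_l_edges C" "oseg h l" and e: "e \<in> interior_edges C" "oseg h e"
  shows "fst e \<in> verts_on C l \<longleftrightarrow> snd e \<in> verts_on C l"
proof -
  have "fst e \<in> vertices C" "snd e \<in> vertices C"
    using edgesD(1,2)[OF interior_edges_subset[OF e(1)] e(2)] by auto
  moreover have "supp e \<subseteq> supp l" if "w \<in> supp l" "w \<in> supp e" for w
    by (rule t_l_edge_absorbs[OF l interior_edge_composed[OF e(1)] e(2) that])
  then have "fst e \<in> supp l \<longleftrightarrow> snd e \<in> supp l" using endpoints_in_supp[of e] by blast
  ultimately show ?thesis by (simp add: verts_on_def)
qed

lemma interior_vertex_edge: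
  assumes "v \<in> interior_vertices C"
  obtains e where "e \<in> interior_edges C" "oseg h e" "v \<in> supp e"
proof -
  have v: "v \<in> vertices C" "v \<in> interior region" using assms by (auto simp: interior_vertices_def)
  have "(\<exists>e. edge_dir h True v e) \<or> (\<exists>e. edge_dir h False v e)"
    using at_most_one_missing_direction[OF v, of h True h False] by blast
  then obtain s e where e: "edge_dir h s v e" by blast
  then have "v \<in> supp e" using endpoints_in_supp[of e] by (cases s) (auto simp: edge_dir_def)
  then show ?thesis using that edge_touching_interior[of e v] v(2) e by (auto simp: edge_dir_def)
qed

text \<open>
  Choose a longest composed segment through \<open>v\<close> in the given direction. If both its ends were
  interior vertices, no edge would continue it there, so both would be T-junctions and the segment
  would be a T \<open>l\<close>-edge.
\<close>
lemma line_reaches_boundary: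
  assumes v: "v \<in> interior_vertices C" and no: "\<not> (\<exists>l\<in>t_l_edges C. oseg h l \<and> v \<in> supp l)"
  obtains l where "composed_of_edges C l" "oseg h l" "v \<in> supp l"
    "fst l \<notin> interior_vertices C \<or> snd l \<notin> interior_vertices C"
proof -
  define S where "S = {l. composed_of_edges C l \<and> oseg h l \<and> v \<in> supp l}"
  have "l \<in> vertices C \<times> vertices C" if "l \<in> S" for l
    using composed_endpoint_vertices[of l h] that by (simp add: S_def mem_Times_iff)
  then have fin: "finite S" by (meson finite_SigmaI finite_vertices finite_subset subsetI)
  obtain e0 where "e0 \<in> interior_edges C" "oseg h e0" "v \<in> supp e0"
      using interior_vertex_edge[OF v] .
  then have "e0 \<in> S" using interior_edge_composed by (simp add: S_def)
  then obtain l where l0: "l \<in> S" "\<And>u. u \<in> S \<Longrightarrow> along h (fst l) - along h (snd l) \<le>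
        along h (fst u) - along h (snd u)"
    using finite_minimizer[OF fin, of e0 "\<lambda>u. along h (fst u) - along h (snd u)"] by blast
  have l: "l \<in> S" "along h (snd u) - along h (fst u) \<le> along h (snd l) - along h (fst l)"
      if "u \<in> S" for u
    using l0(1) l0(2)[OF that] by simp_all
  have l1: "composed_of_edges C l" "oseg h l" "v \<in> supp l" using l0(1) by (auto simp: S_def)
  have longest: "supp m \<subseteq> supp l" if m: "m \<in> S" "supp l \<subseteq> supp m" for m
  proof -
    have "oseg h m" using m by (simp add: S_def)
    then have "l = m"
      using supp_subset_bounds[OF l1(2) _ m(2)] l(2)[OF m(1)] by (intro seg_eqI[OF l1(2)]) auto
    then show ?thesis by simp
  qed
  have absorbs: "supp e \<subseteq> supp l" if ew: "e \<in> interior_edges C" "oseg h e" "w \<in> supp e"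
      "w \<in> supp l" for e w
  proof -
    obtain m where "composed_of_edges C m" "oseg h m" "supp m = supp l \<union> supp e"
      using composed_union[OF l1(1,2) interior_edge_composed[OF ew(1)] ew(2)] ew(3,4) by blast
    then show ?thesis using longest[of m] l1(3) by (simp add: S_def)
  qed
  have noint: "\<not> (fst l \<in> interior_vertices C \<and> snd l \<in> interior_vertices C)"
  proof
    assume int: "fst l \<in> interior_vertices C \<and> snd l \<in> interior_vertices C"
    have "\<not> edge_dir h False (fst l) e" for e
    proof
      assume e: "edge_dir h False (fst l) e"
      then have eh: "e \<in> edges C" "oseg h e" "snd e = fst l" by (auto simp: edge_dir_def)
      have in_e: "fst l \<in> supp e" using endpoints_in_supp(2)[of e] eh(3) by simp
      have "e \<in> interior_edges C"
        using edge_touching_interior[OF eh(1) in_e] int by (simp add: interior_vertices_def)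
      then have "supp e \<subseteq> supp l" using absorbs[OF _ eh(2) in_e endpoints_in_supp(1)] by blast
      then show False using supp_subset_bounds(1)[OF eh(2) l1(2)] eh by (auto simp: oseg_def)
    qed
    then have t1: "fst l \<in> t_junctions C" using t_junction_if_missing_direction int by blast
    have "\<not> edge_dir h True (snd l) e" for e
    proof
      assume e: "edge_dir h True (snd l) e"
      then have eh: "e \<in> edges C" "oseg h e" "fst e = snd l" by (auto simp: edge_dir_def)
      have in_e: "snd l \<in> supp e" using endpoints_in_supp(1)[of e] eh(3) by simp
      have "e \<in> interior_edges C"
        using edge_touching_interior[OF eh(1) in_e] int by (simp add: interior_vertices_def)
      then have "supp e \<subseteq> supp l" using absorbs[OF _ eh(2) in_e endpoints_in_supp(2)] by blast
      then show False using supp_subset_bounds(2)[OF eh(2) l1(2)] eh by (auto simp: oseg_def)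
    qed
    then have t2: "snd l \<in> t_junctions C" using t_junction_if_missing_direction int by blast
    have "l' = l" if l': "composed_of_edges C l'" "supp l \<subseteq> supp l'" for l'
    proof -
      obtain k where k: "oseg k l'" using l'(1) hseg_or_vseg unfolding composed_of_edges_def
          by blast
      have "oseg k l" by (rule oseg_if_supp_subset[OF k l1(2) l'(2)])
      then have kh: "oseg h l'" using k oseg_unique[OF l1(2)] by blast
      then have "supp l' \<subseteq> supp l" using longest[of l'] l' l1(3) by (auto simp: S_def)
      then show ?thesis
        using supp_subset_bounds[OF l1(2) kh l'(2)] supp_subset_bounds[OF kh l1(2)]
        by (intro seg_eqI[OF kh l1(2)]) auto
    qed
    then have "l \<in> t_l_edges C"
      using l1(1) t1 t2 by (simp add: t_l_edges_def interior_l_edges_def)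
    then show False using no l1 by blast
  qed
  show ?thesis by (rule that[OF l1]) (use noint in blast)
qed

lemma finite_t_l_edges: "finite (t_l_edges C)"
proof (rule finite_subset)
  show "t_l_edges C \<subseteq> vertices C \<times> vertices C"
    using t_l_edgeD(2,3) by (auto simp: interior_vertices_def mem_Times_iff)
qed (simp add: finite_vertices)

end

section \<open>Bivariate polynomials divisible by a power of a line\<close>

text \<open>
  The univariate polynomial \<open>f\<close> in the variable \<open>x\<close> if \<open>h = True\<close>, in \<open>y\<close> otherwise.
\<close>
definition axis_poly :: "bool \<Rightarrow> real poly \<Rightarrow> poly2" where
  "axis_poly h f = (if h then [:f:] else map_poly (\<lambda>c. [:c:]) f)"

text \<open>
  The coefficient of the monomial with exponent \<open>i\<close> in the variable along direction \<open>h\<close> and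
  exponent \<open>j\<close> in the other one.
\<close>
definition coeff2 :: "bool \<Rightarrow> poly2 \<Rightarrow> nat \<Rightarrow> nat \<Rightarrow> real" where
  "coeff2 h p i j = (if h then coeff (coeff p j) i else coeff (coeff p i) j)"

lemma poly2_eqI: "(\<And>i j. coeff2 h p i j = coeff2 h q i j) \<Longrightarrow> p = q"
  by (cases h) (auto simp: coeff2_def intro!: poly_eqI)

lemma coeff2_axis_poly_mult: "coeff2 h (axis_poly h f * axis_poly (\<not> h) g) i j =
      coeff f i * coeff g j"
proof (cases h)
  case True
  then show ?thesis by (simp add: coeff2_def axis_poly_def coeff_map_poly)
next
  case False
  have "axis_poly h f * axis_poly (\<not> h) g = [:g:] * map_poly (\<lambda>c. [:c:]) f" using False
      by (simp add: axis_poly_def mult.commute)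
  then show ?thesis using False by (simp add: coeff2_def coeff_map_poly)
qed

lemma bideg_iff: "p \<in> bideg_polys d \<longleftrightarrow> (\<forall>i j. coeff2 h p i j \<noteq> 0 \<longrightarrow> i \<le> d \<and> j \<le> d)"
proof -
  have "p \<in> bideg_polys d \<longleftrightarrow> (\<forall>i j. coeff2 True p i j \<noteq> 0 \<longrightarrow> i \<le> d \<and> j \<le> d)" for p
  proof
    assume p: "p \<in> bideg_polys d"
    show "\<forall>i j. coeff2 True p i j \<noteq> 0 \<longrightarrow> i \<le> d \<and> j \<le> d"
    proof (intro allI impI)
      fix i j assume nz: "coeff2 True p i j \<noteq> 0"
      then have "coeff p j \<noteq> 0" by (auto simp: coeff2_def)
      then have "j \<le> degree p" by (rule le_degree)
      moreover have "i \<le> degree (coeff p j)" using nz by (auto simp: coeff2_def intro: le_degree)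
      ultimately show "i \<le> d \<and> j \<le> d" using p unfolding bideg_polys_def by (auto intro: order_trans)
    qed
  next
    assume *: "\<forall>i j. coeff2 True p i j \<noteq> 0 \<longrightarrow> i \<le> d \<and> j \<le> d"
    have "degree (coeff p j) \<le> d" for j
      using * by (intro degree_le) (fastforce simp: coeff2_def not_le[symmetric])
    moreover have "degree p \<le> d"
    proof (intro degree_le allI impI)
      fix j assume "d < j"
      then show "coeff p j = 0" using * by (intro poly_eqI) (fastforce simp: coeff2_def)
    qed
    ultimately show "p \<in> bideg_polys d" by (simp add: bideg_polys_def)
  qed
  then show ?thesis by (cases h) (auto simp: coeff2_def)
qed

lemma monic_power: "degree ([:- c, 1:] ^ d :: real poly) = d"
    "coeff ([:- c, 1:] ^ d :: real poly) d = 1"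
proof -
  show *: "degree ([:- c, 1:] ^ d :: real poly) = d" by (simp add: degree_power_eq)
  have "lead_coeff ([:- c, 1:] ^ d :: real poly) = 1" by (simp add: lead_coeff_power)
  then show "coeff ([:- c, 1:] ^ d :: real poly) d = 1" by (simp add: *)
qed

lemma axis_poly_0_1 [simp]: "axis_poly h 0 = 0" "axis_poly h 1 = 1"
  by (auto simp: axis_poly_def simp flip: one_pCons)

lemma axis_poly_add: "axis_poly h (f + g) = axis_poly h f + axis_poly h g"
  by (auto simp: axis_poly_def intro!: poly_eqI simp: coeff_map_poly)

lemma axis_poly_smult: "axis_poly h (Polynomial.smult a f) = Polynomial.smult [:a:] (axis_poly h f)"
  by (auto simp: axis_poly_def coeff_map_poly mult.commute intro!: poly_eqI)

lemma const_poly_sum: "[:sum f A:] = (\<Sum>x\<in>A. [:f x:])" for f :: "'a \<Rightarrow> real"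
proof -
  have "[:a + b:] = [:a:] + [:b:]" for a b :: real by simp
  then show ?thesis
    by (induction A rule: infinite_finite_induct) (simp_all del: add_pCons)
qed

lemma smult_minus_one: "Polynomial.smult [:- 1:] p = - p" for p :: poly2
  by (intro poly_eqI) simp

lemma smult_minus_const: "Polynomial.smult [:- w:] p = - Polynomial.smult [:w:] p" for p :: poly2
  by (intro poly_eqI) simp

lemma smult_sum_right: "Polynomial.smult a (sum f A) = (\<Sum>x\<in>A. Polynomial.smult a (f x))"
  by (induction A rule: infinite_finite_induct) (auto simp: smult_add_right)

lemma axis_poly_mult: "axis_poly h (f * g) = axis_poly h f * axis_poly h g"
proof (cases h)
  case False
  have "coeff (map_poly (\<lambda>c. [:c:]) (f * g)) n
      = coeff (map_poly (\<lambda>c. [:c:]) f * map_poly (\<lambda>c. [:c:]) g) n" for n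
    by (simp add: coeff_map_poly coeff_mult const_poly_sum mult.commute)
  then show ?thesis using False by (auto simp: axis_poly_def intro: poly_eqI)
qed (simp add: axis_poly_def)

lemma axis_poly_power: "axis_poly h (f ^ n) = axis_poly h f ^ n"
  by (induction n) (auto simp: axis_poly_mult)

text \<open>
  The polynomials attached to edges of direction \<open>h\<close> on the line where the other coordinate is
  \<open>c\<close>.
\<close>
definition J_line :: "nat \<Rightarrow> bool \<Rightarrow> real \<Rightarrow> poly2 set" where
  "J_line d h c = {p \<in> bideg_polys d. axis_poly (\<not> h) ([:- c, 1:] ^ d) dvd p}"

definition line_poly :: "nat \<Rightarrow> bool \<Rightarrow> real \<Rightarrow> real poly \<Rightarrow> poly2" where
  "line_poly d h c f = axis_poly h f * axis_poly (\<not> h) ([:- c, 1:] ^ d)"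

lemma coeff2_line_poly_top: "coeff2 h (line_poly d h c f) i d = coeff f i"
  by (simp add: line_poly_def coeff2_axis_poly_mult monic_power)

lemma line_poly_inj: "line_poly d h c f = line_poly d h c g \<Longrightarrow> f = g"
  by (metis coeff2_line_poly_top poly_eqI)

lemma line_poly_linear:
  "line_poly d h c (f + g) = line_poly d h c f + line_poly d h c g"
  "line_poly d h c (Polynomial.smult a f) = Polynomial.smult [:a:] (line_poly d h c f)"
  "line_poly d h c 0 = 0"
  by (simp_all add: line_poly_def axis_poly_add axis_poly_smult algebra_simps)

lemma line_poly_in_J_line:
  assumes "degree f \<le> d"
  shows "line_poly d h c f \<in> J_line d h c"
proof -
  have "line_poly d h c f \<in> bideg_polys d"
    unfolding bideg_iff[of _ d h] line_poly_def coeff2_axis_poly_mult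
    using assms le_degree[of f] le_degree[of "[:- c, 1:] ^ d"] monic_power(1)[of c d] by fastforce
  then show ?thesis by (simp add: J_line_def line_poly_def)
qed

text \<open>
  For \<open>h = True\<close> the power of the linear factor is monic of full degree \<open>d\<close> in the outer variable,
  so the cofactor is constant in it. For \<open>h = False\<close> the power divides every coefficient of the
  outer variable, and by the bound on the degree each coefficient is a scalar multiple of it.
\<close>
lemma J_line_cases:
  assumes "p \<in> J_line d h c"
  obtains f where "degree f \<le> d" "p = line_poly d h c f"
proof -
  let ?m = "[:- c, 1:] ^ d :: real poly"
  have bounds: "degree p \<le> d" "degree (coeff p i) \<le> d" for i
    using assms by (auto simp: J_line_def bideg_polys_def)
  obtain q where q: "p = axis_poly (\<not> h) ?m * q" using assms by (auto simp: J_line_def)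
  have "\<exists>f. p = line_poly d h c f"
  proof (cases h)
    case True
    have dm: "degree (axis_poly False ?m) = d"
      by (simp add: axis_poly_def degree_map_poly monic_power)
    have "degree q = 0"
    proof (cases "q = 0")
      case False
      have "coeff (axis_poly False ?m) d = 1"
        by (simp add: axis_poly_def coeff_map_poly monic_power one_pCons)
      then have "axis_poly False ?m \<noteq> 0" by auto
      then have "degree p = d + degree q"
        using q True False dm by (simp add: degree_mult_eq)
      then show ?thesis using bounds by simp
    qed simp
    then obtain f where "q = [:f:]" by (metis degree_eq_zeroE)
    then show ?thesis using q True by (auto simp: line_poly_def axis_poly_def mult.commute)
  next
    case False
    have dv: "\<exists>k. coeff p n = Polynomial.smult k ?m" for n
    proof -
      have e: "coeff p n = ?m * coeff q n" using q False by (simp add: axis_poly_def)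
      have "degree (coeff q n) = 0"
      proof (cases "coeff q n = 0")
        case nz: False
        have "?m \<noteq> 0" by simp
        then have "degree (coeff p n) = d + degree (coeff q n)"
          unfolding e using nz by (simp add: degree_mult_eq monic_power)
        then show ?thesis using bounds(2)[of n] by simp
      qed simp
      then obtain k where "coeff q n = [:k:]" by (metis degree_eq_zeroE)
      then show ?thesis using e by (auto simp: mult.commute)
    qed
    define f where "f = map_poly (\<lambda>r. coeff r d) p"
    have "coeff2 h p i j = coeff2 h (line_poly d h c f) i j" for i j
    proof -
      obtain k where k: "coeff p i = Polynomial.smult k ?m" using dv by blast
      then have "coeff f i = k" by (simp add: f_def coeff_map_poly monic_power)
      then have "coeff2 h (line_poly d h c f) i j = k * coeff ?m j"
        by (simp only: line_poly_def coeff2_axis_poly_mult)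
      then show ?thesis using k False by (simp add: coeff2_def)
    qed
    then show ?thesis using poly2_eqI by blast
  qed
  then obtain f where f: "p = line_poly d h c f" by blast
  have "p \<in> bideg_polys d" using assms by (simp add: J_line_def)
  then have "degree f \<le> d"
    unfolding bideg_iff[of _ d h] f using coeff2_line_poly_top[of h d c f]
    by (intro degree_le) (metis not_less)
  then show ?thesis using that f by blast
qed

text \<open>
  The product \<open>(x - a)^d (y - b)^d\<close> for the vertex \<open>(a, b)\<close>.
\<close>
definition vertex_poly :: "nat \<Rightarrow> point \<Rightarrow> poly2" where
  "vertex_poly d v = axis_poly True ([:- fst v, 1:] ^ d) * axis_poly False ([:- snd v, 1:] ^ d)"

lemma vertex_poly_eq_line_poly: "vertex_poly d v =
      line_poly d h (along (\<not> h) v) ([:- along h v, 1:] ^ d)"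
  by (cases h) (auto simp: vertex_poly_def line_poly_def along_def mult.commute)

text \<open>
  Comparison of the coefficients of \<open>y^d\<close> shows that the cofactor \<open>f(x)\<close> of \<open>(y - b)^d\<close> is a
  multiple of \<open>(x - a)^d\<close>.
\<close>
lemma J_line_Int:
  assumes "p \<in> J_line d True (snd v)" "p \<in> J_line d False (fst v)"
  obtains w where "p = Polynomial.smult [:w:] (vertex_poly d v)"
proof -
  obtain f where f: "p = line_poly d True (snd v) f" using J_line_cases[OF assms(1)] by blast
  obtain g where g: "p = line_poly d False (fst v) g" using J_line_cases[OF assms(2)] by blast
  have "coeff f i = coeff g d * coeff ([:- fst v, 1:] ^ d) i" for i
  proof -
    have "coeff f i = coeff2 True p i d" unfolding f coeff2_line_poly_top ..
    also have "\<dots> = coeff2 False p d i" by (simp add: coeff2_def)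
    also have "\<dots> = coeff g d * coeff ([:- fst v, 1:] ^ d) i"
      unfolding g line_poly_def coeff2_axis_poly_mult ..
    finally show ?thesis .
  qed
  then have "f = Polynomial.smult (coeff g d) ([:- fst v, 1:] ^ d)"
    by (intro poly_eqI) simp
  then have "p = Polynomial.smult [:coeff g d:] (vertex_poly d v)"
    using f vertex_poly_eq_line_poly[of d v True] by (simp add: line_poly_linear along_def)
  then show ?thesis using that by blast
qed

lemma vertex_poly_in_J_line: "vertex_poly d v \<in> J_line d h (along (\<not> h) v)"
  unfolding vertex_poly_eq_line_poly[of d v h] by (rule line_poly_in_J_line) (simp add: monic_power)

lemma J_line_closed:
  "0 \<in> J_line d h c" "p \<in> J_line d h c \<Longrightarrow> q \<in> J_line d h c \<Longrightarrow> p + q \<in> J_line d h c"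
  "p \<in> J_line d h c \<Longrightarrow> Polynomial.smult [:a:] p \<in> J_line d h c"
  "p \<in> J_line d h c \<Longrightarrow> - p \<in> J_line d h c"
  "p \<in> J_line d h c \<Longrightarrow> q \<in> J_line d h c \<Longrightarrow> p - q \<in> J_line d h c"
proof -
  show "0 \<in> J_line d h c" by (simp add: J_line_def bideg_polys_def)
  show add: "p \<in> J_line d h c \<Longrightarrow> q \<in> J_line d h c \<Longrightarrow> p + q \<in> J_line d h c" for p q
    by (auto simp: J_line_def bideg_polys_def intro: degree_add_le)
  show sm: "p \<in> J_line d h c \<Longrightarrow> Polynomial.smult [:a:] p \<in> J_line d h c" for p a
    by (auto simp: J_line_def bideg_polys_def intro: order_trans[OF degree_smult_le] dvd_smult)
  show ng: "p \<in> J_line d h c \<Longrightarrow> - p \<in> J_line d h c" for p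
    by (auto simp: J_line_def bideg_polys_def)
  show "p \<in> J_line d h c \<Longrightarrow> q \<in> J_line d h c \<Longrightarrow> p - q \<in> J_line d h c"
    using add[of p "- q"] ng[of q] by simp
qed

lemma J_line_sum: "(\<And>x. x \<in> A \<Longrightarrow> f x \<in> J_line d h c) \<Longrightarrow> sum f A \<in> J_line d h c"
  by (induction A rule: infinite_finite_induct) (auto intro: J_line_closed)

lemma J_edge_eq: assumes "oseg h e" shows "J_edge d e = J_line d h (along (\<not> h) (fst e))"
proof -
  have "edge_line e = axis_poly (\<not> h) [:- along (\<not> h) (fst e), 1:]"
    using assms by (auto simp: edge_line_def hseg_iff_oseg axis_poly_def along_def y_minus_def
        x_minus_def map_poly_pCons simp flip: one_pCons)
  then show ?thesis by (simp add: J_edge_def J_line_def axis_poly_power)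
qed

lemma J_vertex_eq: "J_vertex d v = {p + q | p q. p \<in> J_line d False (fst v) \<and>
      q \<in> J_line d True (snd v)}"
proof -
  have "x_minus a = axis_poly True [:- a, 1:]" "y_minus b = axis_poly False [:- b, 1:]" for a b
    by (auto simp: axis_poly_def y_minus_def x_minus_def map_poly_pCons simp flip: one_pCons)
  then show ?thesis by (auto simp: J_vertex_def J_line_def axis_poly_power)
qed

section \<open>Chains modulo boundaries\<close>

context mesh begin

text \<open>
  The polynomial \<open>p\<close> placed at \<open>v\<close>, and the zero chain if \<open>v\<close> is a boundary vertex: this is the
  convention of the boundary map.
\<close>
definition delta :: "point \<Rightarrow> poly2 \<Rightarrow> point \<Rightarrow> poly2" where
  "delta v p = (\<lambda>u. if u = v \<and> v \<in> interior_vertices C then p else 0)"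

definition is_boundary :: "nat \<Rightarrow> (point \<Rightarrow> poly2) \<Rightarrow> bool" where
  "is_boundary d c \<longleftrightarrow> c \<in> boundary_map C ` edge_chains C d"

lemma is_boundaryI: "e \<in> edge_chains C d \<Longrightarrow> boundary_map C e = c \<Longrightarrow> is_boundary d c"
  unfolding is_boundary_def by blast

lemma finite_interior_edges: "finite (interior_edges C)"
proof (rule finite_subset)
  show "interior_edges C \<subseteq> vertices C \<times> vertices C"
    by (auto simp: interior_edges_def edges_def)
qed (simp add: finite_vertices)

lemma finite_interior_vertices: "finite (interior_vertices C)"
  using finite_vertices by (simp add: interior_vertices_def)

lemma finite_verts_on: "finite (verts_on C l)"
  using finite_vertices by (simp add: verts_on_def)

lemma J_edge_closed:
  assumes "e \<in> interior_edges C"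
  shows "0 \<in> J_edge d e" "p \<in> J_edge d e \<Longrightarrow> q \<in> J_edge d e \<Longrightarrow> p + q \<in> J_edge d e"
    "p \<in> J_edge d e \<Longrightarrow> Polynomial.smult [:a:] p \<in> J_edge d e"
  using edges_oseg[OF interior_edges_subset[OF assms]] J_edge_eq J_line_closed by metis+

lemma boundary_add: assumes "is_boundary d c" "is_boundary d c'" shows
    "is_boundary d (\<lambda>v. c v + c' v)"
proof -
  obtain e e' where e: "e \<in> edge_chains C d" "c = boundary_map C e" "e' \<in> edge_chains C d"
      "c' = boundary_map C e'"
    using assms by (auto simp: is_boundary_def)
  have "(\<lambda>x. e x + e' x) \<in> edge_chains C d"
    using e(1,3) J_edge_closed(2) by (auto simp: edge_chains_def)
  moreover have "boundary_map C (\<lambda>x. e x + e' x) = (\<lambda>v. c v + c' v)"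
    unfolding e by (rule ext) (simp add: boundary_map_def sum.distrib)
  ultimately show ?thesis by (rule is_boundaryI)
qed

lemma boundary_smult: assumes "is_boundary d c" shows
    "is_boundary d (\<lambda>v. Polynomial.smult [:a:] (c v))"
proof -
  obtain e where e: "e \<in> edge_chains C d" "c = boundary_map C e"
    using assms by (auto simp: is_boundary_def)
  have "(\<lambda>x. Polynomial.smult [:a:] (e x)) \<in> edge_chains C d"
    using e(1) J_edge_closed(3) by (auto simp: edge_chains_def)
  moreover have "boundary_map C (\<lambda>x. Polynomial.smult [:a:] (e x)) =
        (\<lambda>v. Polynomial.smult [:a:] (c v))"
    unfolding e by (rule ext) (simp add: boundary_map_def smult_sum_right smult_diff_right)
  ultimately show ?thesis by (rule is_boundaryI)
qed

lemma boundary_zero: "is_boundary d (\<lambda>v. 0)"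
proof -
  have "(\<lambda>x. 0) \<in> edge_chains C d" using J_edge_closed(1) by (auto simp: edge_chains_def)
  moreover have "boundary_map C (\<lambda>x. 0) = (\<lambda>v. 0)" by (rule ext) (simp add: boundary_map_def)
  ultimately show ?thesis by (rule is_boundaryI)
qed

lemma boundary_diff: assumes "is_boundary d c" "is_boundary d c'" shows
    "is_boundary d (\<lambda>v. c v - c' v)"
  using boundary_add[OF assms(1) boundary_smult[OF assms(2), of "-1"]]
      by (simp add: smult_minus_one)

lemma boundary_sum: "(\<And>x. x \<in> A \<Longrightarrow> is_boundary d (f x)) \<Longrightarrow> is_boundary d (\<lambda>v. \<Sum>x\<in>A. f x v)"
  by (induction A rule: infinite_finite_induct) (simp_all add: boundary_zero boundary_add)

lemma boundary_edge:
  assumes e: "e \<in> interior_edges C" "oseg h e" and p: "p \<in> J_line d h (along (\<not> h) (fst e))"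
  shows "is_boundary d (\<lambda>u. delta (snd e) p u - delta (fst e) p u)"
proof -
  define c where "c = (\<lambda>x. if x = e then p else 0)"
  have "c \<in> edge_chains C d"
    using e p J_edge_eq[OF e(2)] J_edge_closed(1) by (auto simp: c_def edge_chains_def)
  moreover have "boundary_map C c = (\<lambda>u. delta (snd e) p u - delta (fst e) p u)"
  proof (rule ext)
    fix u
    have "(\<Sum>x | x \<in> interior_edges C \<and> P x. c x) = (if P e then p else 0)" for P
      using finite_interior_edges e(1) by (simp add: c_def sum.delta)
    then show "boundary_map C c u = delta (snd e) p u - delta (fst e) p u"
      by (auto simp: boundary_map_def delta_def)
  qed
  ultimately show ?thesis by (rule is_boundaryI)
qed

text \<open>
  Induction on the number of vertices between the start of the segment and \<open>v\<close>: each step is the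
  boundary of \<open>p\<close> on a single edge.
\<close>
lemma boundary_move_to_start:
  assumes l: "composed_of_edges C l" "oseg h l" and p: "p \<in> J_line d h (along (\<not> h) (fst l))"
    and v: "v \<in> verts_on C l"
  shows "is_boundary d (\<lambda>u. delta v p u - delta (fst l) p u)"
  using v
proof (induction "card {u \<in> verts_on C l. along h u < along h v}" arbitrary: v rule: less_induct)
  case less
  show ?case
  proof (cases "v = fst l")
    case False
    obtain e where e: "e \<in> interior_edges C" "oseg h e" "snd e = v" "fst e \<in> verts_on C l"
      using composed_step_left[OF l less.prems False] .
    have lt: "along h (fst e) < along h v" "along (\<not> h) (fst e) = along (\<not> h) (fst l)"
      using e mem_supp_iff[OF l(2), of "fst e"] by (auto simp: oseg_def verts_on_def)
    have "{u \<in> verts_on C l. along h u < along h (fst e)} \<subset>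
          {u \<in> verts_on C l. along h u < along h v}"
      using lt e(4) by fastforce
    then have "card {u \<in> verts_on C l. along h u < along h (fst e)} < card
          {u \<in> verts_on C l. along h u < along h v}"
      using finite_verts_on by (intro psubset_card_mono) auto
    then have "is_boundary d (\<lambda>u. delta (fst e) p u - delta (fst l) p u)" using less.hyps e(4)
        by blast
    moreover have "is_boundary d (\<lambda>u. delta v p u - delta (fst e) p u)"
        using boundary_edge[OF e(1,2)] p lt e(3) by simp
    ultimately show ?thesis using boundary_add by fastforce
  qed (simp add: boundary_zero)
qed

text \<open>
  Some segment through \<open>v\<close> has an end that is not an interior vertex. Moved to that end, the chain
  becomes zero.
\<close>
lemma boundary_delta_if_no_t_l_edge:
  assumes v: "v \<in> interior_vertices C" and no: "\<not> (\<exists>l\<in>t_l_edges C. oseg h l \<and> v \<in> supp l)"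
    and p: "p \<in> J_line d h (along (\<not> h) v)"
  shows "is_boundary d (delta v p)"
proof -
  obtain l where l: "composed_of_edges C l" "oseg h l" "v \<in> supp l"
    and out: "fst l \<notin> interior_vertices C \<or> snd l \<notin> interior_vertices C"
    using line_reaches_boundary[OF v no] by blast
  have "along (\<not> h) v = along (\<not> h) (fst l)" using l mem_supp_iff by blast
  then have pl: "p \<in> J_line d h (along (\<not> h) (fst l))" using p by simp
  have vl: "v \<in> verts_on C l" "snd l \<in> verts_on C l"
    using v l composed_endpoint_vertices[OF l(1,2)] endpoints_in_supp[of l]
    by (auto simp: verts_on_def interior_vertices_def)
  note b1 = boundary_move_to_start[OF l(1,2) pl vl(1)]
      and b2 = boundary_move_to_start[OF l(1,2) pl vl(2)]
  show ?thesis
  proof (cases "fst l \<in> interior_vertices C")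
    case False
    then have "delta (fst l) p = (\<lambda>u. 0)" by (auto simp: delta_def)
    then show ?thesis using b1 by simp
  next
    case True
    then have "delta (snd l) p = (\<lambda>u. 0)" using out by (auto simp: delta_def)
    then show ?thesis using boundary_diff[OF b1 b2] by simp
  qed
qed

text \<open>
  The relation at a vertex is a difference of a horizontal and a vertical term, whereas a column
  of the conformality matrix has the powers of both coordinates with the same sign. Reversing the
  sign on vertical edges reconciles the two.
\<close>
definition sgn_of :: "bool \<Rightarrow> real" where
  "sgn_of h = (if h then 1 else - 1)"

definition edge_term :: "nat \<Rightarrow> seg \<Rightarrow> real poly \<Rightarrow> poly2" where
  "edge_term d l f = Polynomial.smult [:sgn_of (hseg l):]
        (line_poly d (hseg l) (along (\<not> hseg l) (fst l)) f)"

text \<open>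
  The polynomials \<open>F l\<close> on the T \<open>l\<close>-edges, each turned into an element of \<open>J\<close> and placed at the
  first end of \<open>l\<close>.
\<close>
definition t_chain :: "nat \<Rightarrow> (seg \<Rightarrow> real poly) \<Rightarrow> point \<Rightarrow> poly2" where
  "t_chain d F = (\<lambda>u. \<Sum>l\<in>t_l_edges C. delta (fst l) (edge_term d l (F l)) u)"

lemma edge_term_linear:
  "edge_term d l (f + g) = edge_term d l f + edge_term d l g"
  "edge_term d l (Polynomial.smult a f) = Polynomial.smult [:a:] (edge_term d l f)"
  "edge_term d l 0 = 0"
  by (simp_all add: edge_term_def line_poly_linear smult_add_right mult.commute)

lemma edge_term_sum: "edge_term d l (sum f A) = (\<Sum>x\<in>A. edge_term d l (f x))"
  by (induction A rule: infinite_finite_induct) (auto simp: edge_term_linear)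

lemma delta_linear:
  "delta v (p + q) u = delta v p u + delta v q u"
  "delta v (Polynomial.smult [:a:] p) u = Polynomial.smult [:a:] (delta v p u)"
  "delta v 0 u = 0"
  by (simp_all add: delta_def)

lemma delta_sum: "delta v (sum f A) u = (\<Sum>x\<in>A. delta v (f x) u)"
  by (induction A rule: infinite_finite_induct) (auto simp: delta_linear)

lemma t_chain_linear:
  "t_chain d (\<lambda>l. F l + G l) u = t_chain d F u + t_chain d G u"
  "t_chain d (\<lambda>l. Polynomial.smult a (F l)) u = Polynomial.smult [:a:] (t_chain d F u)"
  by (simp_all add: t_chain_def edge_term_linear delta_linear sum.distrib smult_sum_right)

lemma edge_term_vertex_poly:
  assumes "oseg h l" "v \<in> verts_on C l"
  shows "edge_term d l ([:- coord l v, 1:] ^ d) = Polynomial.smult [:sgn_of h:] (vertex_poly d v)"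
proof -
  have "along (\<not> h) v = along (\<not> h) (fst l)" using assms mem_supp_iff by (auto simp: verts_on_def)
  then show ?thesis
    using vertex_poly_eq_line_poly[of d v h] coord_eq_along[OF assms(1)]
    by (simp add: edge_term_def hseg_iff_oseg[OF assms(1)])
qed

text \<open>
  If \<open>v\<close> is on two T \<open>l\<close>-edges, the signs are opposite. Otherwise there is a direction in which
  \<open>v\<close> is on no T \<open>l\<close>-edge; the polynomial of the vertex also belongs to that direction, along
  which it can be moved to the boundary.
\<close>
lemma vertex_contributions_cancel:
  assumes v: "v \<in> interior_vertices C"
  shows "is_boundary d (\<lambda>u. \<Sum>l | l \<in> t_l_edges C \<and> v \<in> verts_on C l.
    delta v (Polynomial.smult [:w * sgn_of (hseg l):] (vertex_poly d v)) u)"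
    (is "is_boundary d (\<lambda>u. \<Sum>l\<in>?L. ?f l u)")
proof (cases "\<exists>h. \<not> (\<exists>l\<in>t_l_edges C. oseg h l \<and> v \<in> supp l)")
  case True
  then obtain h where h: "\<not> (\<exists>l\<in>t_l_edges C. oseg h l \<and> v \<in> supp l)" by blast
  show ?thesis
    by (intro boundary_sum boundary_delta_if_no_t_l_edge[OF v h] J_line_closed(3)
        vertex_poly_in_J_line)
next
  case False
  then obtain l l' where l: "l \<in> t_l_edges C" "oseg True l" "v \<in> supp l"
    and l': "l' \<in> t_l_edges C" "oseg False l'" "v \<in> supp l'" by blast
  have "k = l \<or> k = l'" if "k \<in> ?L" for k
  proof -
    have k: "k \<in> t_l_edges C" "v \<in> supp k" using that by (auto simp: verts_on_def)
    obtain h where h: "oseg h k" using t_l_edge_oseg[OF k(1)] .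
    show ?thesis
    proof (cases h)
      case True
      then show ?thesis using t_l_edge_unique[OF k(1) _ l(1,2) k(2) l(3)] h by simp
    next
      case False
      then show ?thesis using t_l_edge_unique[OF k(1) _ l'(1,2) k(2) l'(3)] h by simp
    qed
  qed
  moreover have "v \<in> vertices C" using v by (simp add: interior_vertices_def)
  ultimately have L: "?L = {l, l'}" using l l' by (auto simp: verts_on_def)
  have hs: "hseg l" "\<not> hseg l'" using l(2) l'(2) oseg_unique[of False l' True]
      by (auto simp: oseg_simps)
  have ne: "l \<noteq> l'" using hs by auto
  have "(\<Sum>l\<in>?L. ?f l u) = 0" for u
    unfolding L using ne hs by (simp add: sgn_of_def delta_def smult_minus_const)
  then show ?thesis by (simp add: boundary_zero)
qed

text \<open>
  Moving each term from the first end of its \<open>l\<close>-edge to the vertex that it belongs to changes the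
  chain by boundaries, and the terms at each vertex add up to a boundary.
\<close>
lemma boundary_t_chain_if_column_combination:
  assumes F: "\<And>l. l \<in> t_l_edges C \<Longrightarrow>
    F l = (\<Sum>v\<in>verts_on C l. Polynomial.smult (w v) ([:- coord l v, 1:] ^ d))"
  shows "is_boundary d (t_chain d F)"
proof -
  let ?T = "t_l_edges C"
  let ?p = "\<lambda>l v. Polynomial.smult [:w v * sgn_of (hseg l):] (vertex_poly d v)"
  have tm: "edge_term d l (F l) = (\<Sum>v\<in>verts_on C l. ?p l v)" if l: "l \<in> ?T" for l
  proof -
    obtain h where h: "oseg h l" using t_l_edge_oseg[OF l] .
    show ?thesis
      unfolding F[OF l] edge_term_sum
      by (intro sum.cong refl) (simp add: edge_term_linear edge_term_vertex_poly[OF h]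
          hseg_iff_oseg[OF h] mult.commute)
  qed
  have eq: "t_chain d F u =
      (\<Sum>l\<in>?T. \<Sum>v\<in>verts_on C l. - (delta v (?p l v) u - delta (fst l) (?p l v) u)) +
      (\<Sum>v\<in>interior_vertices C. \<Sum>l | l \<in> ?T \<and> v \<in> verts_on C l. delta v (?p l v) u)" for u
  proof -
    have "(\<Sum>v\<in>interior_vertices C. \<Sum>l | l \<in> ?T \<and> v \<in> verts_on C l. delta v (?p l v) u) =
        (\<Sum>l\<in>?T. \<Sum>v | v \<in> interior_vertices C \<and> v \<in> verts_on C l. delta v (?p l v) u)"
      by (rule sum.swap_restrict[OF finite_interior_vertices finite_t_l_edges])
    also have "\<dots> = (\<Sum>l\<in>?T. \<Sum>v\<in>verts_on C l. delta v (?p l v) u)"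
      using t_l_edge_interior_vertices by (intro sum.cong refl) auto
    finally show ?thesis
      by (simp add: t_chain_def tm delta_sum sum_subtractf sum.distrib sum_negf)
  qed
  have "is_boundary d (\<lambda>u. \<Sum>l\<in>?T. \<Sum>v\<in>verts_on C l.
        - (delta v (?p l v) u - delta (fst l) (?p l v) u))"
  proof (intro boundary_sum)
    fix l v assume l: "l \<in> ?T" and v: "v \<in> verts_on C l"
    obtain h where h: "oseg h l" using t_l_edge_oseg[OF l] .
    have "along (\<not> h) v = along (\<not> h) (fst l)" using v mem_supp_iff[OF h]
        by (auto simp: verts_on_def)
    then have "?p l v \<in> J_line d h (along (\<not> h) (fst l))"
      using vertex_poly_in_J_line[of d v h] J_line_closed(3) by metis
    from boundary_smult[OF boundary_move_to_start[OF t_l_edgeD(1)[OF l] h this v], of "-1"]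
    show "is_boundary d (\<lambda>u. - (delta v (?p l v) u - delta (fst l) (?p l v) u))"
        by (simp only: smult_minus_one)
  qed
  moreover have "is_boundary d (\<lambda>u. \<Sum>v\<in>interior_vertices C. \<Sum>l | l \<in> ?T \<and>
        v \<in> verts_on C l. delta v (?p l v) u)"
    by (intro boundary_sum vertex_contributions_cancel)
  ultimately have "is_boundary d (\<lambda>u. t_chain d F u)" unfolding eq by (rule boundary_add)
  then show ?thesis by simp
qed

end

context mesh begin

text \<open>
  Let \<open>c\<close> be a chain with boundary \<open>t_chain d F\<close>. At every interior vertex split both sides into
  the horizontal and the vertical part. The defects of the two parts are opposite, so they lie in
  the intersection of both spaces and are multiples \<open>w v\<close> of the vertex polynomial. Summing one
  part over the vertices of an \<open>l\<close>-edge makes the contribution of \<open>c\<close> telescope to zero and leaves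
  \<open>F l\<close>.
\<close>
lemma column_combination_if_boundary_t_chain:
  assumes "is_boundary d (t_chain d F)" and deg: "\<And>l. l \<in> t_l_edges C \<Longrightarrow> degree (F l) \<le> d"
  shows "\<exists>w. \<forall>l\<in>t_l_edges C. F l =
        (\<Sum>v\<in>verts_on C l. Polynomial.smult (w v) ([:- coord l v, 1:] ^ d))"
proof -
  let ?T = "t_l_edges C" and ?E = "interior_edges C"
  obtain c where c: "c \<in> edge_chains C d" "t_chain d F = boundary_map C c"
    using assms(1) unfolding is_boundary_def by blast
  define b where "b h v = (\<Sum>e | e \<in> ?E \<and> oseg h e \<and> snd e = v. c e) - (\<Sum>e | e \<in> ?E \<and> oseg h e \<and>
        fst e = v. c e)" for h v
  \<comment> \<open>\<open>b h v\<close> and \<open>g h v\<close> are the parts of direction \<open>h\<close> at \<open>v\<close> of the two sides of the equation\<close>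
  define g where "g h v = (\<Sum>l | l \<in> ?T \<and> oseg h l \<and> fst l = v. edge_term d l (F l))" for h v
  have split: "(\<Sum>x | x \<in> A \<and> P x. f x) = (\<Sum>x | x \<in> A \<and> oseg True x \<and> P x. f x) +
        (\<Sum>x | x \<in> A \<and> oseg False x \<and> P x. f x)"
    if "finite A" "\<And>x. x \<in> A \<Longrightarrow> \<exists>h. oseg h x" for A P and f :: "seg \<Rightarrow> poly2"
  proof -
    have "{x. x \<in> A \<and> P x} = {x. x \<in> A \<and> oseg True x \<and> P x} \<union> {x. x \<in> A \<and> oseg False x \<and> P x}"
      using that(2) by (auto, metis (full_types))
    moreover have "{x. x \<in> A \<and> oseg True x \<and> P x} \<inter> {x. x \<in> A \<and> oseg False x \<and> P x} = {}"
      using oseg_unique by blast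
    ultimately show ?thesis using that(1) by (simp add: sum.union_disjoint)
  qed
  have bsplit: "boundary_map C c v = b True v + b False v" if "v \<in> interior_vertices C" for v
  proof -
    have "\<exists>h. oseg h e" if "e \<in> ?E" for e using edges_oseg[OF interior_edges_subset[OF that]]
        by blast
    then show ?thesis
      using that split[OF finite_interior_edges, where P = "\<lambda>e. snd e = v"
          and f = c] split[OF finite_interior_edges, where P = "\<lambda>e. fst e = v" and f = c]
      by (simp add: boundary_map_def b_def)
  qed
  have gsplit: "t_chain d F v = g True v + g False v" if "v \<in> interior_vertices C" for v
  proof -
    have "t_chain d F v = (\<Sum>l | l \<in> ?T \<and> fst l = v. edge_term d l (F l))"
      unfolding t_chain_def
      by (rule sum.mono_neutral_cong_right) (use that finite_t_l_edges in \<open>auto simp: delta_def\<close>)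
    moreover have "\<exists>h. oseg h l" if "l \<in> ?T" for l using t_l_edge_oseg[OF that] by blast
    ultimately show ?thesis
      using split[OF finite_t_l_edges, where P = "\<lambda>l. fst l = v" and f = "\<lambda>l. edge_term d l (F l)"]
          by (simp add: g_def)
  qed
  have bJ: "b h v \<in> J_line d h (along (\<not> h) v)" for h v
  proof -
    have "c e \<in> J_line d h (along (\<not> h) v)" if "e \<in> ?E" "oseg h e" "snd e = v \<or> fst e = v" for e
    proof -
      have "c e \<in> J_edge d e" using c(1) that(1) by (simp add: edge_chains_def)
      moreover have "along (\<not> h) (fst e) = along (\<not> h) v" using that by (auto simp: oseg_def)
      ultimately show ?thesis using J_edge_eq[OF that(2)] by simp
    qed
    then show ?thesis unfolding b_def by (intro J_line_closed(5) J_line_sum) auto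
  qed
  have termJ: "edge_term d l (F l) \<in> J_line d h (along (\<not> h) (fst l))" if "l \<in> ?T" "oseg h l"
      for l h
    unfolding edge_term_def hseg_iff_oseg[OF that(2)]
    by (intro J_line_closed(3) line_poly_in_J_line deg that(1))
  have gJ: "g h v \<in> J_line d h (along (\<not> h) v)" for h v
    unfolding g_def by (rule J_line_sum) (use termJ in auto)
  have "\<exists>w. g True v - b True v = Polynomial.smult [:w:] (vertex_poly d v)"
      if v: "v \<in> interior_vertices C" for v
  proof -
    have eq: "g True v - b True v = b False v - g False v"
      using bsplit[OF v] gsplit[OF v] c(2) by (simp add: algebra_simps)
    have 1: "g True v - b True v \<in> J_line d True (snd v)"
      using J_line_closed(5)[OF gJ bJ, of True v] by (simp add: along_def)
    have 2: "g True v - b True v \<in> J_line d False (fst v)"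
      unfolding eq using J_line_closed(5)[OF bJ gJ, of False v] by (simp add: along_def)
    show ?thesis using J_line_Int[OF 1 2] by blast
  qed
  then obtain w where w: "g True v - b True v = Polynomial.smult [:w v:] (vertex_poly d v)"
    if "v \<in> interior_vertices C" for v by metis
  have gb: "g h v = b h v + Polynomial.smult [:w v * sgn_of h:] (vertex_poly d v)"
    if v: "v \<in> interior_vertices C" for h v
  proof (cases h)
    case True
    then show ?thesis using w[OF v] by (simp add: sgn_of_def algebra_simps)
  next
    case False
    have "b False v - g False v = Polynomial.smult [:w v:] (vertex_poly d v)"
      using w[OF v] bsplit[OF v] gsplit[OF v] c(2) by (simp add: algebra_simps)
    then show ?thesis using False by (simp add: sgn_of_def smult_minus_const algebra_simps)
  qed
  have "F l = (\<Sum>v\<in>verts_on C l. Polynomial.smult (w v) ([:- coord l v, 1:] ^ d))" if l: "l \<in> ?T"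
      for l
  proof -
    obtain h where h: "oseg h l" using t_l_edge_oseg[OF l] .
    let ?V = "verts_on C l"
    have "fst l \<in> ?V"
      using composed_endpoint_vertices(1)[OF t_l_edgeD(1)[OF l] h] endpoints_in_supp(1)[of l]
          by (simp add: verts_on_def)
    \<comment> \<open>other T \<open>l\<close>-edges of the same direction are disjoint from \<open>l\<close>\<close>
    have gv: "g h v = (if v = fst l then edge_term d l (F l) else 0)" if v: "v \<in> ?V" for v
    proof -
      have uniq: "l' = l" if "l' \<in> ?T" "oseg h l'" "fst l' = v" for l'
        using t_l_edge_unique[OF that(1,2) l h, of v] endpoints_in_supp(1)[of l'] that(3) v
            by (auto simp: verts_on_def)
      show ?thesis
      proof (cases "v = fst l")
        case True
        then have "{l' \<in> ?T. oseg h l' \<and> fst l' = v} = {l}" using uniq l h by blast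
        then have "g h v = edge_term d l (F l)" unfolding g_def by simp
        then show ?thesis using True by simp
      next
        case False
        then have "{l' \<in> ?T. oseg h l' \<and> fst l' = v} = {}" using uniq by blast
        then have "g h v = 0" unfolding g_def by (simp only: sum.empty)
        then show ?thesis using False by simp
      qed
    qed
    have "(\<Sum>v\<in>?V. g h v) = edge_term d l (F l)"
      using \<open>fst l \<in> ?V\<close> finite_verts_on by (simp add: gv sum.delta)
    moreover have "(\<Sum>v\<in>?V. b h v) = 0"
    proof -
      \<comment> \<open>an edge on the line of \<open>l\<close> has both or none of its ends on \<open>l\<close>, so the two sums run over
          the same edges\<close>
      let ?S = "{e \<in> ?E. oseg h e \<and> fst e \<in> ?V}"
      have fS: "finite ?S" using finite_interior_edges by simp
      have S: "?S = {e \<in> ?E. oseg h e \<and> snd e \<in> ?V}"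
        using t_l_edge_contains_both_endpoints[OF l h] by blast
      have "(\<Sum>v\<in>?V. \<Sum>e | e \<in> ?E \<and> oseg h e \<and> fst e = v. c e) = (\<Sum>v\<in>?V. sum c {e \<in> ?S. fst e = v})"
        by (intro sum.cong refl arg_cong[where f = "sum c"]) auto
      also have "\<dots> = sum c ?S" by (rule sum.group[OF fS finite_verts_on]) auto
      finally have 1: "(\<Sum>v\<in>?V. \<Sum>e | e \<in> ?E \<and> oseg h e \<and> fst e = v. c e) = sum c ?S" .
      have "(\<Sum>v\<in>?V. \<Sum>e | e \<in> ?E \<and> oseg h e \<and> snd e = v. c e) = (\<Sum>v\<in>?V. sum c {e \<in> ?S. snd e = v})"
        unfolding S by (intro sum.cong refl arg_cong[where f = "sum c"]) auto
      also have "\<dots> = sum c ?S" by (rule sum.group[OF fS finite_verts_on]) (use S in auto)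
      finally show ?thesis using 1 by (simp add: b_def sum_subtractf)
    qed
    moreover have "(\<Sum>v\<in>?V. g h v) = (\<Sum>v\<in>?V. b h v) +
          (\<Sum>v\<in>?V. Polynomial.smult [:w v * sgn_of h:] (vertex_poly d v))"
      unfolding sum.distrib[symmetric]
      by (intro sum.cong refl gb t_l_edge_interior_vertices[OF l])
    moreover have "(\<Sum>v\<in>?V. Polynomial.smult [:w v * sgn_of h:] (vertex_poly d v))
        = edge_term d l (\<Sum>v\<in>?V. Polynomial.smult (w v) ([:- coord l v, 1:] ^ d))"
      unfolding edge_term_sum
      by (intro sum.cong refl) (simp add: edge_term_linear edge_term_vertex_poly[OF h] mult.commute)
    ultimately have "edge_term d l (F l) =
          edge_term d l (\<Sum>v\<in>?V. Polynomial.smult (w v) ([:- coord l v, 1:] ^ d))"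
      by simp
    moreover have "sgn_of h * sgn_of h = 1" for h by (simp add: sgn_of_def)
    then have "line_poly d (hseg l) (along (\<not> hseg l) (fst l)) f =
          Polynomial.smult [:sgn_of (hseg l):] (edge_term d l f)" for f
      by (simp add: edge_term_def flip: one_pCons)
    ultimately show ?thesis by (metis line_poly_inj)
  qed
  then show ?thesis by blast
qed

text \<open>
  Decompose a chain into its horizontal and vertical parts at the single vertices. Each part
  either is a boundary or can be moved to the first end of a T \<open>l\<close>-edge.
\<close>
lemma t_chain_represents:
  assumes c: "c \<in> carrier (vertex_chains C d)"
  shows "\<exists>F. (\<forall>l\<in>t_l_edges C. degree (F l) \<le> d) \<and> is_boundary d (\<lambda>u. t_chain d F u - c u)"
proof -
  define R where "R c \<longleftrightarrow> (\<exists>F. (\<forall>l\<in>t_l_edges C. degree (F l) \<le> d) \<and>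
        is_boundary d (\<lambda>u. t_chain d F u - c u))" for c
  have R_add: "R (\<lambda>u. c u + c' u)" if Rc: "R c" "R c'" for c c'
  proof -
    obtain F G where F: "\<forall>l\<in>t_l_edges C. degree (F l) \<le> d" "is_boundary d (\<lambda>u. t_chain d F u - c u)"
      and G: "\<forall>l\<in>t_l_edges C. degree (G l) \<le> d" "is_boundary d (\<lambda>u. t_chain d G u - c' u)"
      using Rc unfolding R_def by blast
    have "is_boundary d (\<lambda>u. t_chain d (\<lambda>l. F l + G l) u - (c u + c' u))"
      using boundary_add[OF F(2) G(2)] by (simp add: t_chain_linear algebra_simps)
    moreover have "\<forall>l\<in>t_l_edges C. degree (F l + G l) \<le> d" using F(1) G(1)
        by (auto intro: degree_add_le)
    ultimately show ?thesis unfolding R_def by (intro exI[of _ "\<lambda>l. F l + G l"] conjI)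
  qed
  have t0: "t_chain d (\<lambda>l. 0) u = 0" for u by (simp add: t_chain_def edge_term_linear delta_linear)
  have R0: "R (\<lambda>u. 0)" unfolding R_def using t0 boundary_zero by (intro exI[of _ "\<lambda>l. 0"]) simp
  have R_delta: "R (delta v p)" if v: "v \<in> interior_vertices C"
      and p: "p \<in> J_line d h (along (\<not> h) v)" for v p h
  proof (cases "\<exists>l\<in>t_l_edges C. oseg h l \<and> v \<in> supp l")
    case False
    have "is_boundary d (\<lambda>u. t_chain d (\<lambda>l. 0) u - delta v p u)"
      using boundary_diff[OF boundary_zero boundary_delta_if_no_t_l_edge[OF v False p]] t0 by simp
    then show ?thesis unfolding R_def by (intro exI[of _ "\<lambda>l. 0"]) simp
  next
    case True
    then obtain l where l: "l \<in> t_l_edges C" "oseg h l" "v \<in> supp l" by blast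
    have "along (\<not> h) v = along (\<not> h) (fst l)" using l mem_supp_iff by blast
    then have p': "p \<in> J_line d h (along (\<not> h) (fst l))" using p by simp
    then obtain f where f: "degree f \<le> d" "p = line_poly d h (along (\<not> h) (fst l)) f"
      by (rule J_line_cases)
    have s: "sgn_of h * sgn_of h = 1" by (simp add: sgn_of_def)
    define F where "F = (\<lambda>k. if k = l then Polynomial.smult (sgn_of h) f else 0)"
    have "edge_term d l (F l) = p"
      using s f(2) by (simp add: F_def edge_term_def hseg_iff_oseg[OF l(2)] line_poly_linear
          flip: one_pCons)
    then have "delta (fst k) (edge_term d k (F k)) u = (if k = l then delta (fst l) p u else 0)"
        for k u
      by (auto simp: F_def edge_term_linear delta_linear)
    then have "t_chain d F u = delta (fst l) p u" for u
      using l(1) finite_t_l_edges by (simp add: t_chain_def sum.delta)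
    moreover have "v \<in> verts_on C l" using v l by (simp add: verts_on_def interior_vertices_def)
    then have "is_boundary d (\<lambda>u. Polynomial.smult [:- 1:] (delta v p u - delta (fst l) p u))"
      by (intro boundary_smult boundary_move_to_start[OF t_l_edgeD(1)[OF l(1)] l(2) p'])
    moreover have "\<forall>k\<in>t_l_edges C. degree (F k) \<le> d"
      using f(1) degree_smult_le[of "sgn_of h" f] by (auto simp: F_def)
    ultimately show ?thesis unfolding R_def by (intro exI[of _ F]) (simp add: smult_minus_one)
  qed
  have R_sum: "R (\<lambda>u. \<Sum>x\<in>A. f x u)" if "\<And>x. x \<in> A \<Longrightarrow> R (f x)" for f :: "point \<Rightarrow> point \<Rightarrow> poly2" and A
    using that by (induction A rule: infinite_finite_induct) (auto intro: R0 R_add)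
  have "\<exists>p q. c v = p + q \<and> p \<in> J_line d False (fst v) \<and> q \<in> J_line d True (snd v)"
    if "v \<in> interior_vertices C" for v
    using c that J_vertex_eq[of d v] by (fastforce simp: vertex_chains_def)
  then obtain p q where pq: "c v = p v + q v" "p v \<in> J_line d False (fst v)"
      "q v \<in> J_line d True (snd v)"
    if "v \<in> interior_vertices C" for v by metis
  have ceq: "c u = (\<Sum>v\<in>interior_vertices C. delta v (p v) u + delta v (q v) u)" for u
  proof (cases "u \<in> interior_vertices C")
    case True
    have "(\<Sum>v\<in>interior_vertices C. delta v (p v) u + delta v (q v) u) =
          (\<Sum>v\<in>interior_vertices C. if v = u then c u else 0)"
      by (intro sum.cong refl) (use pq(1) in \<open>auto simp: delta_def\<close>)
    then show ?thesis using True finite_interior_vertices by simp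
  next
    case False
    moreover have "\<forall>v. v \<notin> interior_vertices C \<longrightarrow> c v = 0" using c unfolding vertex_chains_def
        by simp
    ultimately have "c u = 0" by blast
    moreover have "(\<Sum>v\<in>interior_vertices C. delta v (p v) u + delta v (q v) u) = 0"
      by (rule sum.neutral) (use False in \<open>auto simp: delta_def\<close>)
    ultimately show ?thesis by simp
  qed
  have "R (\<lambda>u. \<Sum>v\<in>interior_vertices C. delta v (p v) u + delta v (q v) u)"
    using pq(2,3) R_delta[of _ _ False] R_delta[of _ _ True]
    by (intro R_sum R_add) (simp_all add: along_def)
  moreover have "c = (\<lambda>u. \<Sum>v\<in>interior_vertices C. delta v (p v) u + delta v (q v) u)" using ceq
      by (rule ext)
  ultimately have "R c" by simp
  then show ?thesis by (simp add: R_def)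
qed

end

section \<open>Coefficient vectors of polynomials on edges\<close>

text \<open>
  The entries of index \<open>i (d + 1), \<dots>, i (d + 1) + d\<close> hold the coefficients of the polynomial of
  the \<open>i\<close>-th edge with respect to the basis \<open>g\<close>.
\<close>
definition decode :: "nat \<Rightarrow> seg list \<Rightarrow> (nat \<Rightarrow> real poly) \<Rightarrow> real vec \<Rightarrow> seg \<Rightarrow> real poly" where
  "decode d ls g x l = (\<Sum>i<length ls. if ls ! i =
        l then \<Sum>k\<le>d. Polynomial.smult (x $ (i * (d + 1) + k)) (g k) else 0)"

definition poly_basis :: "nat \<Rightarrow> (nat \<Rightarrow> real poly) \<Rightarrow> bool" where
  "poly_basis d g \<longleftrightarrow> (\<forall>k\<le>d. degree (g k) \<le> d) \<and>
     (\<forall>f. degree f \<le> d \<longrightarrow> (\<exists>a. f = (\<Sum>k\<le>d. Polynomial.smult (a k) (g k)))) \<and>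
     (\<forall>a. (\<Sum>k\<le>d. Polynomial.smult (a k) (g k)) = 0 \<longrightarrow> (\<forall>k\<le>d. a k = 0))"

lemma row_index_less: "i < n \<Longrightarrow> k \<le> d \<Longrightarrow> i * (d + 1) + k < n * (d + 1)" for d :: nat
proof -
  assume "i < n" "k \<le> d"
  then have "i * (d + 1) + k < Suc i * (d + 1)" by simp
  also have "\<dots> \<le> n * (d + 1)" using \<open>i < n\<close> by (intro mult_le_mono1) simp
  finally show ?thesis .
qed

lemma row_index_div_mod: "k \<le> d \<Longrightarrow> (i * (d + 1) + k) div (d + 1) = i" "k \<le> d \<Longrightarrow>
      (i * (d + 1) + k) mod (d + 1) = k"
  for d :: nat
  by (simp_all add: div_mult_self3 less_Suc_eq_le del: mult_Suc_right add: mult.commute)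

lemma sum_rows: "(\<Sum>i<n * (d + 1). f i) = (\<Sum>i<n. \<Sum>k\<le>d. f (i * (d + 1) + k))" for d :: nat
proof -
  have "(\<Sum>i<n * (d + 1). f i) = (\<Sum>i<n. \<Sum>j = i * (d + 1)..<i * (d + 1) + (d + 1). f j)"
    by (rule sum.nat_group[symmetric])
  also have "\<dots> = (\<Sum>i<n. \<Sum>k\<le>d. f (i * (d + 1) + k))"
  proof (rule sum.cong[OF refl])
    fix i show "(\<Sum>j = i * (d + 1)..<i * (d + 1) + (d + 1). f j) = (\<Sum>k\<le>d. f (i * (d + 1) + k))"
      by (rule sum.reindex_bij_witness[of _ "\<lambda>k. i * (d + 1) + k" "\<lambda>j. j - i * (d + 1)"]) auto
  qed
  finally show ?thesis .
qed

lemma decode_nth: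
  assumes "distinct ls" "i < length ls"
  shows "decode d ls g x (ls ! i) = (\<Sum>k\<le>d. Polynomial.smult (x $ (i * (d + 1) + k)) (g k))"
proof -
  have "decode d ls g x (ls ! i) =
        (\<Sum>j<length ls. if j = i then \<Sum>k\<le>d. Polynomial.smult (x $ (i * (d + 1) + k)) (g k) else 0)"
    unfolding decode_def using assms by (intro sum.cong refl) (auto simp: nth_eq_iff_index_eq)
  then show ?thesis using assms by simp
qed

lemma decode_outside: "l \<notin> set ls \<Longrightarrow> decode d ls g x l = 0"
  unfolding decode_def by (rule sum.neutral) auto

lemma decode_linear:
  assumes "x \<in> carrier_vec (length ls * (d + 1))" "y \<in> carrier_vec (length ls * (d + 1))"
  shows "decode d ls g (x + y) l = decode d ls g x l + decode d ls g y l"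
    and "decode d ls g (a \<cdot>\<^sub>v x) l = Polynomial.smult a (decode d ls g x l)"
proof -
  have ix: "i * (d + 1) + k < length ls * (d + 1)" if "i < length ls" "k \<le> d" for i k
    using row_index_less that .
  have "(\<Sum>k\<le>d. Polynomial.smult ((x + y) $ (i * (d + 1) + k)) (g k)) =
      (\<Sum>k\<le>d. Polynomial.smult (x $ (i * (d + 1) + k)) (g k)) +
          (\<Sum>k\<le>d. Polynomial.smult (y $ (i * (d + 1) + k)) (g k))"
    if "i < length ls" for i
    unfolding sum.distrib[symmetric] using ix[OF that] assms
        by (intro sum.cong refl) (simp add: smult_add_left)
  then show "decode d ls g (x + y) l = decode d ls g x l + decode d ls g y l"
    unfolding decode_def sum.distrib[symmetric] by (intro sum.cong refl) simp
  have sm: "(\<Sum>k\<le>d. Polynomial.smult ((a \<cdot>\<^sub>v x) $ (i * (d + 1) + k)) (g k)) =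
      Polynomial.smult a (\<Sum>k\<le>d. Polynomial.smult (x $ (i * (d + 1) + k)) (g k))"
    if "i < length ls" for i
    unfolding smult_sum_right using ix[OF that] assms by (intro sum.cong refl) simp
  show "decode d ls g (a \<cdot>\<^sub>v x) l = Polynomial.smult a (decode d ls g x l)"
    unfolding decode_def smult_sum_right[of a _ "{..<length ls}"]
    by (intro sum.cong refl) (simp only: sm lessThan_iff if_distrib[of "Polynomial.smult a"]
        smult_0_right)
qed

lemma degree_decode:
  assumes "poly_basis d g"
  shows "degree (decode d ls g x l) \<le> d"
proof -
  have "degree (\<Sum>k\<le>d. Polynomial.smult (a k) (g k)) \<le> d" for a
    using assms by (intro degree_sum_le)
        (auto simp: poly_basis_def intro: order_trans[OF degree_smult_le])
  then show ?thesis unfolding decode_def by (intro degree_sum_le) auto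
qed

lemma decode_surj:
  assumes g: "poly_basis d g" and ls: "distinct ls"
    and F: "\<And>l. l \<in> set ls \<Longrightarrow> degree (F l) \<le> d"
  obtains x where "x \<in> carrier_vec (length ls * (d + 1))" "\<And>l. l \<in> set ls \<Longrightarrow> decode d ls g x l = F l"
proof -
  have "\<forall>l\<in>set ls. \<exists>a. F l = (\<Sum>k\<le>d. Polynomial.smult (a k) (g k))"
    using g F unfolding poly_basis_def by blast
  then obtain a where a: "\<And>l. l \<in> set ls \<Longrightarrow> F l = (\<Sum>k\<le>d. Polynomial.smult (a l k) (g k))" by metis
  define x where "x = vec (length ls * (d + 1)) (\<lambda>j. a (ls ! (j div (d + 1))) (j mod (d + 1)))"
  have x: "x $ (i * (d + 1) + k) = a (ls ! i) k" if "i < length ls" "k \<le> d" for i k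
    unfolding x_def using row_index_less[OF that] row_index_div_mod[OF that(2), of i] by simp
  have "decode d ls g x l = F l" if "l \<in> set ls" for l
  proof -
    obtain i where i: "i < length ls" "l = ls ! i" using \<open>l \<in> set ls\<close> by (metis in_set_conv_nth)
    show ?thesis unfolding i(2) decode_nth[OF ls i(1)]
      using a[of "ls ! i"] i x by (auto intro!: sum.cong)
  qed
  then show ?thesis using that[of x] by (simp add: x_def)
qed

lemma decode_inj:
  assumes g: "poly_basis d g" and ls: "distinct ls"
    and xy: "x \<in> carrier_vec (length ls * (d + 1))" "y \<in> carrier_vec (length ls * (d + 1))"
    and eq: "\<And>l. l \<in> set ls \<Longrightarrow> decode d ls g x l = decode d ls g y l"
  shows "x = y"
proof (rule eq_vecI)
  fix j assume "j < dim_vec y"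
  then have j: "j < length ls * (d + 1)" using xy by simp
  define i k where "i = j div (d + 1)" and "k = j mod (d + 1)"
  have ik: "i < length ls" "k \<le> d" "j = i * (d + 1) + k"
    using less_mult_imp_div_less[OF j] mod_less_divisor[of "d + 1" j] unfolding i_def k_def
    by (auto simp only: div_mult_mod_eq less_Suc_eq_le Suc_eq_plus1[symmetric] zero_less_Suc)
  let ?a = "\<lambda>k. x $ (i * (d + 1) + k) - y $ (i * (d + 1) + k)"
  have zero: "(\<Sum>k\<le>d. Polynomial.smult (?a k) (g k)) = 0"
    using eq[OF nth_mem[OF ik(1)]] unfolding decode_nth[OF ls ik(1)] smult_diff_left sum_subtractf
    by (simp only: diff_self)
  have "\<forall>a. (\<Sum>k\<le>d. Polynomial.smult (a k) (g k)) = 0 \<longrightarrow> (\<forall>k\<le>d. a k = 0)"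
    using g unfolding poly_basis_def by blast
  from this[rule_format, of ?a k, OF zero ik(2)] have "?a k = 0" .
  then show "x $ j = y $ j" using ik(3) by simp
qed (use xy in simp)

text \<open>
  The basis in which \<open>(X - a)^d\<close> has the coefficients \<open>a^k\<close>, by the binomial theorem.
\<close>
definition shift_basis :: "nat \<Rightarrow> nat \<Rightarrow> real poly" where
  "shift_basis d k = monom (of_nat (d choose k) * (- 1) ^ k) (d - k)"

lemma power_linear_factor: "(\<Sum>k\<le>d. Polynomial.smult (a ^ k) (shift_basis d k)) = [:- a, 1:] ^ d"
proof -
  have "[:- a, 1:] ^ d = ([:- a:] + [:0, 1:]) ^ d" by simp
  also have "\<dots> = (\<Sum>k\<le>d. of_nat (d choose k) * [:- a:] ^ k * [:0, 1:] ^ (d - k))"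
      by (rule binomial_ring)
  also have "\<dots> = (\<Sum>k\<le>d. Polynomial.smult (a ^ k) (shift_basis d k))"
  proof (rule sum.cong[OF refl])
    fix k
    have "[:- a:] ^ k = [:(- 1) ^ k * a ^ k:]"
      by (simp add: poly_const_pow power_mult_distrib[symmetric])
    then show "of_nat (d choose k) * [:- a:] ^ k * [:0, 1:] ^ (d - k) =
          Polynomial.smult (a ^ k) (shift_basis d k)"
      by (simp add: shift_basis_def smult_monom of_nat_poly monom_altdef mult_ac)
  qed
  finally show ?thesis by simp
qed

lemma poly_basis_monomI:
  assumes "\<And>k. k \<le> d \<Longrightarrow> b k \<noteq> (0::real)" "bij_betw s {..d} {..d}"
  shows "poly_basis d (\<lambda>k. monom (b k) (s k))"
proof -
  have co: "coeff (\<Sum>k\<le>d. Polynomial.smult (a k) (monom (b k) (s k))) (s j) = a j * b j"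
    if "j \<le> d" for a j
  proof -
    have "(\<Sum>k\<le>d. a k * (if s k = s j then b k else 0)) = (\<Sum>k\<le>d. if k = j then a j * b j else 0)"
      using assms(2) that by (intro sum.cong refl) (auto simp: bij_betw_def inj_on_def)
    then show ?thesis using that by (simp add: coeff_sum)
  qed
  have s: "s k \<le> d" if "k \<le> d" for k using assms(2) that by (auto simp: bij_betw_def)
  show ?thesis
    unfolding poly_basis_def
  proof (intro conjI allI impI)
    show "degree (monom (b k) (s k)) \<le> d" if "k \<le> d" for k
      using s[OF that] by (rule order_trans[OF degree_monom_le])
  next
    fix f :: "real poly" assume f: "degree f \<le> d"
    let ?r = "\<Sum>k\<le>d. Polynomial.smult (coeff f (s k) / b k) (monom (b k) (s k))"
    have "coeff f n = coeff ?r n" for n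
    proof (cases "n \<le> d")
      case True
      then obtain j where "j \<le> d" "n = s j" using assms(2) by (auto simp: bij_betw_def)
      then show ?thesis using co[of j] assms(1) by simp
    next
      case False
      then have "s k \<noteq> n" if "k \<le> d" for k using s that by blast
      then show ?thesis using False f by (simp add: coeff_sum coeff_eq_0)
    qed
    then have "f = ?r" by (rule poly_eqI)
    then show "\<exists>a. f = (\<Sum>k\<le>d. Polynomial.smult (a k) (monom (b k) (s k)))"
        by (intro exI[of _ "\<lambda>k. coeff f (s k) / b k"])
  next
    fix a k assume "(\<Sum>k\<le>d. Polynomial.smult (a k) (monom (b k) (s k))) = 0" "k \<le> d"
    then show "a k = 0" using co[of k a] assms(1) by simp
  qed
qed

lemma poly_basis_shift: "poly_basis d (shift_basis d)"
proof -
  have "bij_betw (\<lambda>k. d - k) {..d} {..d}"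
    by (rule bij_betwI[of _ _ _ "\<lambda>k. d - k"]) auto
  then show ?thesis unfolding shift_basis_def by (intro poly_basis_monomI) auto
qed

lemma poly_basis_monom: "poly_basis d (\<lambda>k. monom 1 k)"
  using poly_basis_monomI[of d "\<lambda>_. 1" "\<lambda>k. k"] by (simp add: bij_betw_def)

lemma conformality_mat_dims:
  "dim_row (conformality_mat d ls vs) = length ls * (d + 1)" "dim_col (conformality_mat d ls vs) =
        length vs"
  by (simp_all add: conformality_mat_def)

lemma conformality_mat_index:
  assumes "i < length ls" "k \<le> d" "j < length vs"
  shows "conformality_mat d ls vs $$ (i * (d + 1) + k, j) =
    (if vs ! j \<in> supp (ls ! i) then coord (ls ! i) (vs ! j) ^ k else 0)"
  using assms row_index_less[OF assms(1,2)] row_index_div_mod[OF assms(2), of i]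
  by (simp add: conformality_mat_def Let_def)

lemma sum_nth_set: "distinct xs \<Longrightarrow> (\<Sum>j<length xs. f (xs ! j)) = sum f (set xs)"
  using sum.reindex_bij_betw[OF bij_betw_nth[of xs "{..<length xs}" "set xs"]] by simp

text \<open>
  The column of a vertex \<open>v\<close> is the family of the powers \<open>(X - z)^d\<close> on the edges through \<open>v\<close>,
  where \<open>z\<close> is the coordinate of \<open>v\<close> along the edge.
\<close>
lemma decode_conformality_mat:
  assumes ls: "distinct ls" "l \<in> set ls" and vs: "distinct vs" "w \<in> carrier_vec (length vs)"
    and f: "\<And>j. j < length vs \<Longrightarrow> f (vs ! j) = w $ j"
  shows "decode d ls (shift_basis d) (conformality_mat d ls vs *\<^sub>v w) l =
    (\<Sum>v\<in>set vs \<inter> supp l. Polynomial.smult (f v) ([:- coord l v, 1:] ^ d))"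
proof -
  obtain i where i: "i < length ls" "l = ls ! i" using ls(2) by (metis in_set_conv_nth)
  let ?A = "conformality_mat d ls vs"
  have e: "(?A *\<^sub>v w) $ (i * (d + 1) + k) =
        (\<Sum>j<length vs. (if vs ! j \<in> supp l then coord l (vs ! j) ^ k else 0) * f (vs ! j))"
    if "k \<le> d" for k
  proof -
    have "(?A *\<^sub>v w) $ (i * (d + 1) + k) = (\<Sum>j<length vs. ?A $$ (i * (d + 1) + k, j) * w $ j)"
      using row_index_less[OF i(1) that] vs(2)
      by (simp only: index_mult_mat_vec conformality_mat_dims scalar_prod_def carrier_vecD
          atLeast0LessThan)
         (intro sum.cong refl, simp only: index_row conformality_mat_dims lessThan_iff)
    also have "\<dots> = (\<Sum>j<length vs. (if vs ! j \<in> supp l then coord l (vs ! j) ^ k else 0) * f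
          (vs ! j))"
    proof (rule sum.cong[OF refl])
      fix j assume "j \<in> {..<length vs}"
      then have j: "j < length vs" by simp
      show "?A $$ (i * (d + 1) + k, j) * w $ j =
            (if vs ! j \<in> supp l then coord l (vs ! j) ^ k else 0) * f (vs ! j)"
        unfolding conformality_mat_index[OF i(1) that j] f[OF j] i(2) ..
    qed
    finally show ?thesis .
  qed
  have "decode d ls (shift_basis d) (?A *\<^sub>v w) l =
      (\<Sum>k\<le>d. Polynomial.smult ((?A *\<^sub>v w) $ (i * (d + 1) + k)) (shift_basis d k))"
    unfolding i(2) by (rule decode_nth[OF ls(1) i(1)])
  also have "\<dots> = (\<Sum>k\<le>d. \<Sum>j<length vs. Polynomial.smult
        ((if vs ! j \<in> supp l then coord l (vs ! j) ^ k else 0) * f (vs ! j)) (shift_basis d k))"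
    by (rule sum.cong[OF refl]) (simp only: e atMost_iff smult_sum)
  also have "\<dots> = (\<Sum>j<length vs. \<Sum>k\<le>d. Polynomial.smult
        ((if vs ! j \<in> supp l then coord l (vs ! j) ^ k else 0) * f (vs ! j)) (shift_basis d k))"
    by (rule sum.swap)
  also have "\<dots> = (\<Sum>j<length vs. if vs ! j \<in> supp l then Polynomial.smult (f (vs ! j))
        ([:- coord l (vs ! j), 1:] ^ d) else 0)"
    by (intro sum.cong refl) (simp add: power_linear_factor[symmetric] smult_sum_right mult.commute)
  also have "\<dots> = (\<Sum>v\<in>set vs. if v \<in> supp l then Polynomial.smult (f v) ([:- coord l v, 1:] ^ d)
        else 0)"
    by (rule sum_nth_set[OF vs(1)])
  also have "\<dots> = (\<Sum>v\<in>set vs \<inter> supp l. Polynomial.smult (f v) ([:- coord l v, 1:] ^ d))"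
    by (simp add: sum.inter_restrict)
  finally show ?thesis .
qed

section \<open>The homological term as the corank of the conformality matrix\<close>

lemma verts_of_inter_supp:
  assumes "l \<in> A" shows "verts_of C A \<inter> supp l = verts_on C l"
  using assms by (auto simp: verts_of_def verts_on_def)

lemma vec_as_function:
  assumes "distinct xs" shows "\<exists>f. \<forall>j<length xs. f (xs ! j) = (w :: real vec) $ j"
proof (intro exI allI impI)
  fix j assume j: "j < length xs"
  have "(\<Sum>i<length xs. if xs ! i = xs ! j then w $ i else 0) =
        (\<Sum>i<length xs. if i = j then w $ j else 0)"
    using assms j by (intro sum.cong refl) (auto simp: nth_eq_iff_index_eq)
  then show "(\<lambda>v. \<Sum>i<length xs. if xs ! i = v then w $ i else 0) (xs ! j) = w $ j" using j by simp
qed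

lemma J_vertex_closed:
  "0 \<in> J_vertex d v" "p \<in> J_vertex d v \<Longrightarrow> q \<in> J_vertex d v \<Longrightarrow> p + q \<in> J_vertex d v"
  "p \<in> J_vertex d v \<Longrightarrow> Polynomial.smult [:a:] p \<in> J_vertex d v"
proof -
  show "0 \<in> J_vertex d v"
    unfolding J_vertex_eq using J_line_closed(1) by (auto intro!: exI[of _ 0])
  show "p + q \<in> J_vertex d v" if pq: "p \<in> J_vertex d v" "q \<in> J_vertex d v"
  proof -
    obtain p1 p2 q1 q2 where "p = p1 + p2" "q = q1 + q2"
      and J: "p1 \<in> J_line d False (fst v)" "p2 \<in> J_line d True (snd v)"
        "q1 \<in> J_line d False (fst v)" "q2 \<in> J_line d True (snd v)"
      using pq unfolding J_vertex_eq by blast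
    then have "p + q = (p1 + q1) + (p2 + q2)" by simp
    then show ?thesis unfolding J_vertex_eq using J_line_closed(2) J by blast
  qed
  show "Polynomial.smult [:a:] p \<in> J_vertex d v" if p: "p \<in> J_vertex d v"
  proof -
    obtain p1 p2 where "p = p1 + p2"
        and J: "p1 \<in> J_line d False (fst v)" "p2 \<in> J_line d True (snd v)"
      using p unfolding J_vertex_eq by blast
    then have "Polynomial.smult [:a:] p = Polynomial.smult [:a:] p1 + Polynomial.smult [:a:] p2"
      by (simp add: smult_add_right)
    then show ?thesis unfolding J_vertex_eq using J_line_closed(3) J by blast
  qed
qed

lemma J_line_subset_J_vertex: "J_line d h (along (\<not> h) v) \<subseteq> J_vertex d v"
proof
  fix p assume p: "p \<in> J_line d h (along (\<not> h) v)"
  show "p \<in> J_vertex d v"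
  proof (cases h)
    case True
    then have "p = 0 + p" "0 \<in> J_line d False (fst v)" "p \<in> J_line d True (snd v)"
      using p J_line_closed(1) by (auto simp: along_def)
    then show ?thesis unfolding J_vertex_eq by blast
  next
    case False
    then have "p = p + 0" "p \<in> J_line d False (fst v)" "0 \<in> J_line d True (snd v)"
      using p J_line_closed(1) by (auto simp: along_def)
    then show ?thesis unfolding J_vertex_eq by blast
  qed
qed

lemma mem_vertex_chains:
  "c \<in> carrier (vertex_chains C d) \<longleftrightarrow>
    (\<forall>v\<in>interior_vertices C. c v \<in> J_vertex d v) \<and> (\<forall>v. v \<notin> interior_vertices C \<longrightarrow> c v = 0)"
  by (simp add: vertex_chains_def)

lemma vertex_chains_simps:
  "\<zero>\<^bsub>vertex_chains C d\<^esub> = (\<lambda>v. 0)" "c \<oplus>\<^bsub>vertex_chains C d\<^esub> c' = (\<lambda>v. c v + c' v)"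
  "a \<odot>\<^bsub>vertex_chains C d\<^esub> c = (\<lambda>v. Polynomial.smult [:a:] (c v))"
  by (simp_all add: vertex_chains_def)

lemma vertex_chains_vectorspace: "vectorspace (class_ring :: real ring) (vertex_chains C d)"
proof (rule vs_criteria)
  show "field (class_ring :: real ring)" by (rule class_field)
  show "\<forall>c\<in>carrier (vertex_chains C d). \<exists>c'\<in>carrier (vertex_chains C d).
      c \<oplus>\<^bsub>vertex_chains C d\<^esub> c' = \<zero>\<^bsub>vertex_chains C d\<^esub>"
  proof
    fix c assume c: "c \<in> carrier (vertex_chains C d)"
    show "\<exists>c'\<in>carrier (vertex_chains C d). c \<oplus>\<^bsub>vertex_chains C d\<^esub> c' = \<zero>\<^bsub>vertex_chains C d\<^esub>"
    proof
      show "c \<oplus>\<^bsub>vertex_chains C d\<^esub> (\<lambda>v. Polynomial.smult [:- 1:] (c v)) = \<zero>\<^bsub>vertex_chains C d\<^esub>"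
        by (simp only: vertex_chains_simps smult_minus_one) simp
      show "(\<lambda>v. Polynomial.smult [:- 1:] (c v)) \<in> carrier (vertex_chains C d)"
        using c J_vertex_closed(3) unfolding mem_vertex_chains by auto
    qed
  qed
qed (auto simp: mem_vertex_chains vertex_chains_simps class_ring_simps J_vertex_closed
    smult_add_right smult_add_left ac_simps
      simp flip: one_pCons intro!: ext poly_eqI)

lemma vertex_chains_minus:
  assumes "c \<in> carrier (vertex_chains C d)" "c' \<in> carrier (vertex_chains C d)"
  shows "c \<ominus>\<^bsub>vertex_chains C d\<^esub> c' = (\<lambda>v. c v - c' v)"
proof -
  interpret V: vectorspace class_ring "vertex_chains C d" by (rule vertex_chains_vectorspace)
  have m: "(\<lambda>v. Polynomial.smult [:- 1:] (c' v)) \<in> carrier (vertex_chains C d)"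
    using assms(2) J_vertex_closed(3) unfolding mem_vertex_chains by auto
  have "\<ominus>\<^bsub>vertex_chains C d\<^esub> c' = (\<lambda>v. Polynomial.smult [:- 1:] (c' v))"
    by (rule V.minus_equality[OF _ assms(2) m]) (simp only: vertex_chains_simps smult_minus_one,
        simp)
  then show ?thesis by (simp only: V.minus_eq vertex_chains_simps smult_minus_one) simp
qed

context mesh begin

lemma delta_in_vertex_chains:
  assumes "p \<in> J_line d h (along (\<not> h) v)" shows "delta v p \<in> carrier (vertex_chains C d)"
  using assms J_line_subset_J_vertex[of d h v] J_vertex_closed(1)
      unfolding mem_vertex_chains delta_def by auto

lemma sum_in_vertex_chains:
  assumes "\<And>x. x \<in> A \<Longrightarrow> f x \<in> carrier (vertex_chains C d)"
  shows "(\<lambda>u. \<Sum>x\<in>A. f x u) \<in> carrier (vertex_chains C d)"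
  using assms by (induction A rule: infinite_finite_induct)
      (auto simp: mem_vertex_chains J_vertex_closed)

lemma boundary_in_vertex_chains:
  assumes "is_boundary d c" shows "c \<in> carrier (vertex_chains C d)"
proof -
  obtain e where e: "e \<in> edge_chains C d" "c = boundary_map C e" using assms
      by (auto simp: is_boundary_def)
  have J: "e x \<in> J_vertex d v" if x: "x \<in> interior_edges C" "fst x = v \<or> snd x = v" for x v
  proof -
    obtain h where h: "oseg h x" using edges_oseg[OF interior_edges_subset[OF x(1)]] .
    have "e x \<in> J_line d h (along (\<not> h) (fst x))" using e(1) x(1) J_edge_eq[OF h]
        by (auto simp: edge_chains_def)
    moreover have "along (\<not> h) (fst x) = along (\<not> h) v" using x(2) h by (auto simp: oseg_def)
    ultimately show ?thesis using J_line_subset_J_vertex[of d h v] by auto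
  qed
  have sumJ: "sum e S \<in> J_vertex d v" if "\<And>x. x \<in> S \<Longrightarrow> e x \<in> J_vertex d v" for S v
    using that by (induction S rule: infinite_finite_induct) (auto simp: J_vertex_closed)
  have diffJ: "p - q \<in> J_vertex d v" if "p \<in> J_vertex d v" "q \<in> J_vertex d v" for p q v
    using J_vertex_closed(2)[OF that(1) J_vertex_closed(3)[OF that(2), of "- 1"]]
        by (simp only: smult_minus_one) simp
  show ?thesis
    unfolding mem_vertex_chains e(2) boundary_map_def by (auto intro!: diffJ sumJ J)
qed

lemma t_chain_in_vertex_chains:
  assumes "\<And>l. l \<in> t_l_edges C \<Longrightarrow> degree (F l) \<le> d"
  shows "t_chain d F \<in> carrier (vertex_chains C d)"
  unfolding t_chain_def
proof (rule sum_in_vertex_chains)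
  fix l assume l: "l \<in> t_l_edges C"
  show "delta (fst l) (edge_term d l (F l)) \<in> carrier (vertex_chains C d)"
    by (rule delta_in_vertex_chains[of _ _ "hseg l"])
       (unfold edge_term_def, intro J_line_closed(3) line_poly_in_J_line assms l)
qed

lemma boundary_image_subspace:
  "subspace class_ring (boundary_map C ` edge_chains C d) (vertex_chains C d)"
proof -
  have U: "c \<in> boundary_map C ` edge_chains C d \<longleftrightarrow> is_boundary d c" for c
      by (simp add: is_boundary_def)
  interpret V: vectorspace class_ring "vertex_chains C d" by (rule vertex_chains_vectorspace)
  have "boundary_map C ` edge_chains C d \<subseteq> carrier (vertex_chains C d)"
    using U boundary_in_vertex_chains by blast
  then have "submodule class_ring (boundary_map C ` edge_chains C d) (vertex_chains C d)"
    by (intro submodule.intro) (simp_all only: U vertex_chains_simps boundary_zero boundary_add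
        boundary_smult V.module_axioms)
  then show ?thesis unfolding subspace_def using vertex_chains_vectorspace by blast
qed

text \<open>
  The map from coefficient vectors to classes of chains is surjective by \<open>t_chain_represents\<close>. Its
  kernel is the column space of the conformality matrix by
  \<open>boundary_t_chain_if_column_combination\<close> and \<open>column_combination_if_boundary_t_chain\<close>.
\<close>
theorem h_term_plus_mrank:
  assumes ts: "enumerates ts (t_l_edges C)" and tvs: "enumerates tvs (verts_of C (t_l_edges C))"
  shows "h_term d C + mrank (conformality_mat d ts tvs) = length ts * (d + 1)"
proof -
  let ?A = "conformality_mat d ts tvs" and ?V = "vertex_chains C d"
      and ?U = "boundary_map C ` edge_chains C d"
  have ts': "distinct ts" "set ts = t_l_edges C"
      and tvs': "distinct tvs" "set tvs = verts_of C (t_l_edges C)"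
    using ts tvs by (auto simp: enumerates_def)
  let ?f = "\<lambda>x. t_chain d (decode d ts (shift_basis d) x)"
  have U: "c \<in> ?U \<longleftrightarrow> is_boundary d c" for c by (simp add: is_boundary_def)
  have deg: "degree (decode d ts (shift_basis d) x l) \<le> d" for x l
    by (rule degree_decode[OF poly_basis_shift])
  have closed: "?f x \<in> carrier ?V" for x by (rule t_chain_in_vertex_chains[OF deg])
  have column: "decode d ts (shift_basis d) (?A *\<^sub>v w) l =
      (\<Sum>v\<in>verts_on C l. Polynomial.smult (f v) ([:- coord l v, 1:] ^ d))"
    if "w \<in> carrier_vec (length tvs)" "\<And>j. j < length tvs \<Longrightarrow> f (tvs ! j) = w $ j" "l \<in> t_l_edges C"
        for w f l
  proof -
    have "l \<in> set ts" using that(3) ts'(2) by simp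
    from decode_conformality_mat[OF ts'(1) this tvs'(1) that(1,2)]
    show ?thesis unfolding tvs'(2) verts_of_inter_supp[OF that(3)] .
  qed
  have "vectorspace.dim class_ring (quotient_space ?V ?U) + mrank ?A = dim_row ?A"
  proof (rule dim_quotient_space[OF boundary_image_subspace vertex_chains_vectorspace, of ?A ?f],
      unfold conformality_mat_dims)
    fix x :: "real vec" assume x: "x \<in> carrier_vec (length ts * (d + 1))"
    show "?f x \<in> carrier ?V" by (rule closed)
    show "?f (a \<cdot>\<^sub>v x) = a \<odot>\<^bsub>?V\<^esub> ?f x" for a
    proof -
      have "decode d ts (shift_basis d) (a \<cdot>\<^sub>v x) =
            (\<lambda>l. Polynomial.smult a (decode d ts (shift_basis d) x l))"
        by (rule ext) (rule decode_linear(2)[OF x x])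
      then show ?thesis unfolding vertex_chains_simps by (intro ext) (simp only: t_chain_linear)
    qed
    show "?f (x + y) = ?f x \<oplus>\<^bsub>?V\<^esub> ?f y" if "y \<in> carrier_vec (length ts * (d + 1))" for y
    proof -
      have "decode d ts (shift_basis d) (x + y) =
            (\<lambda>l. decode d ts (shift_basis d) x l + decode d ts (shift_basis d) y l)"
        by (rule ext) (rule decode_linear(1)[OF x that])
      then show ?thesis unfolding vertex_chains_simps by (intro ext) (simp only: t_chain_linear)
    qed
    show "?f x \<in> ?U \<longleftrightarrow> x \<in> (\<lambda>y. ?A *\<^sub>v y) ` carrier_vec (length tvs)"
    proof
      assume "?f x \<in> ?U"
      then obtain w where w: "\<And>l. l \<in> t_l_edges C \<Longrightarrow> decode d ts (shift_basis d) x l =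
          (\<Sum>v\<in>verts_on C l. Polynomial.smult (w v) ([:- coord l v, 1:] ^ d))"
        using column_combination_if_boundary_t_chain[of d "decode d ts (shift_basis d) x"] deg
            unfolding U by blast
      define y where "y = vec (length tvs) (\<lambda>j. w (tvs ! j))"
      have "x = ?A *\<^sub>v y"
      proof (rule decode_inj[OF poly_basis_shift[of d] ts'(1) x])
        show "?A *\<^sub>v y \<in> carrier_vec (length ts * (d + 1))"
          using mult_mat_vec_in_carrier[of ?A y] unfolding conformality_mat_dims .
        fix l assume "l \<in> set ts"
        then have l: "l \<in> t_l_edges C" using ts'(2) by simp
        have "decode d ts (shift_basis d) (?A *\<^sub>v y) l =
              (\<Sum>v\<in>verts_on C l. Polynomial.smult (w v) ([:- coord l v, 1:] ^ d))"
          by (rule column[OF _ _ l]) (auto simp: y_def)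
        then show "decode d ts (shift_basis d) x l = decode d ts (shift_basis d) (?A *\<^sub>v y) l"
          using w[OF l] by simp
      qed
      moreover have "y \<in> carrier_vec (length tvs)" by (simp add: y_def)
      ultimately show "x \<in> (\<lambda>y. ?A *\<^sub>v y) ` carrier_vec (length tvs)" by (rule image_eqI)
    next
      assume "x \<in> (\<lambda>y. ?A *\<^sub>v y) ` carrier_vec (length tvs)"
      then obtain w where w: "w \<in> carrier_vec (length tvs)" "x = ?A *\<^sub>v w" by blast
      obtain f where f: "\<forall>j<length tvs. f (tvs ! j) = w $ j" using vec_as_function[OF tvs'(1)]
          by blast
      show "?f x \<in> ?U"
        unfolding U w(2) by (rule boundary_t_chain_if_column_combination[where w = f])
            (use column[OF w(1)] f in blast)
    qed
  next
    fix c assume c: "c \<in> carrier ?V"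
    obtain F where F: "\<forall>l\<in>t_l_edges C. degree (F l) \<le> d" "is_boundary d (\<lambda>u. t_chain d F u - c u)"
      using t_chain_represents[OF c] by blast
    obtain x where x: "x \<in> carrier_vec (length ts * (d + 1))" "\<And>l. l \<in> set ts \<Longrightarrow>
          decode d ts (shift_basis d) x l = F l"
      using decode_surj[OF poly_basis_shift[of d] ts'(1), of F] F(1) ts'(2) by blast
    have "t_chain d F = ?f x"
      unfolding t_chain_def using x(2) ts'(2) by (intro ext sum.cong refl) simp
    then have "?f x \<ominus>\<^bsub>?V\<^esub> c \<in> ?U" unfolding vertex_chains_minus[OF closed c] U using F(2) by simp
    then show "\<exists>x\<in>carrier_vec (length ts * (d + 1)). ?f x \<ominus>\<^bsub>?V\<^esub> c \<in> ?U" using x(1) by blast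
  qed
  then show ?thesis unfolding h_term_def conformality_mat_dims .
qed

end

section \<open>Syzygies and reasonable orders\<close>

abbreviation decode_monom :: "nat \<Rightarrow> seg list \<Rightarrow> real vec \<Rightarrow> seg \<Rightarrow> real poly" where
  "decode_monom d ls \<equiv> decode d ls (\<lambda>k. monom 1 k)"

text \<open>
  A column of powers, supported on the edges that satisfy \<open>P\<close>, evaluates the polynomials of these
  edges.
\<close>
lemma sum_vandermonde_column:
  assumes ls: "distinct ls"
    and a: "\<And>i k. i < length ls \<Longrightarrow> k \<le> d \<Longrightarrow> a (i * (d + 1) + k) =
          (if P (ls ! i) then z (ls ! i) ^ k else 0)"
  shows "(\<Sum>i<length ls * (d + 1). y $ i * a i) =
    (\<Sum>l | l \<in> set ls \<and> P l. poly (decode_monom d ls y l) (z l))"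
proof -
  have "(\<Sum>i<length ls * (d + 1). y $ i * a i) =
        (\<Sum>i<length ls. \<Sum>k\<le>d. y $ (i * (d + 1) + k) * a (i * (d + 1) + k))"
    by (rule sum_rows)
  also have "\<dots> = (\<Sum>i<length ls. if P (ls ! i) then poly (decode_monom d ls y (ls ! i)) (z (ls ! i))
        else 0)"
  proof (rule sum.cong[OF refl])
    fix i assume "i \<in> {..<length ls}"
    then have i: "i < length ls" by simp
    have "(\<Sum>k\<le>d. y $ (i * (d + 1) + k) * a (i * (d + 1) + k)) =
        (\<Sum>k\<le>d. if P (ls ! i) then y $ (i * (d + 1) + k) * z (ls ! i) ^ k else 0)"
      by (rule sum.cong[OF refl]) (cases "P (ls ! i)"; simp only: a[OF i] atMost_iff if_True
          if_False mult_zero_right)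
    also have "\<dots> = (if P (ls ! i) then poly (decode_monom d ls y (ls ! i)) (z (ls ! i)) else 0)"
      unfolding decode_nth[OF ls i] by (simp add: poly_sum poly_monom)
    finally show "(\<Sum>k\<le>d. y $ (i * (d + 1) + k) * a (i * (d + 1) + k)) =
        (if P (ls ! i) then poly (decode_monom d ls y (ls ! i)) (z (ls ! i)) else 0)" .
  qed
  also have "\<dots> = (\<Sum>l\<in>set ls. if P l then poly (decode_monom d ls y l) (z l) else 0)"
    by (rule sum_nth_set[OF ls])
  also have "\<dots> = (\<Sum>l | l \<in> set ls \<and> P l. poly (decode_monom d ls y l) (z l))"
    using sum.inter_filter[of "set ls" "\<lambda>l. poly (decode_monom d ls y l) (z l)" P] by simp
  finally show ?thesis .
qed

text \<open>
  A family is extended by zero outside \<open>A\<close>, so that the syzygies of different sets of edges can be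
  compared as functions.
\<close>
definition syzygies :: "rect set \<Rightarrow> nat \<Rightarrow> seg set \<Rightarrow> (seg \<Rightarrow> real poly) set" where
  "syzygies C d A = {p. (\<forall>l. l \<notin> A \<longrightarrow> p l = 0) \<and> (\<forall>l\<in>A. degree (p l) \<le> d) \<and>
     (\<forall>v\<in>verts_of C A. (\<Sum>l | l \<in> A \<and> v \<in> supp l. poly (p l) (coord l v)) = 0)}"

lemma syzygiesI:
  assumes "\<And>l. l \<notin> A \<Longrightarrow> p l = 0" "\<And>l. l \<in> A \<Longrightarrow> degree (p l) \<le> d"
    and "\<And>v. v \<in> verts_of C A \<Longrightarrow> (\<Sum>l | l \<in> A \<and> v \<in> supp l. poly (p l) (coord l v)) = 0"
  shows "p \<in> syzygies C d A"
  using assms unfolding syzygies_def by blast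

lemma syzygiesD:
  assumes "p \<in> syzygies C d A"
  shows "l \<notin> A \<Longrightarrow> p l = 0" "l \<in> A \<Longrightarrow> degree (p l) \<le> d"
    and "v \<in> verts_of C A \<Longrightarrow> (\<Sum>l | l \<in> A \<and> v \<in> supp l. poly (p l) (coord l v)) = 0"
  using assms unfolding syzygies_def by blast+

lemma mem_left_kernel_conformality_iff:
  assumes ls: "enumerates ls A" and vs: "enumerates vs (verts_of C A)"
  shows "y \<in> left_kernel (conformality_mat d ls vs) \<longleftrightarrow>
    y \<in> carrier_vec (length ls * (d + 1)) \<and> decode_monom d ls y \<in> syzygies C d A"
proof -
  have ls': "distinct ls" "set ls = A" and vs': "distinct vs" "set vs = verts_of C A"
    using ls vs by (auto simp: enumerates_def)
  have col: "(\<Sum>i<length ls * (d + 1). y $ i * conformality_mat d ls vs $$ (i, j)) =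
      (\<Sum>l | l \<in> A \<and> vs ! j \<in> supp l. poly (decode_monom d ls y l) (coord l (vs ! j)))"
    if "j < length vs" for j
    using sum_vandermonde_column[OF ls'(1), of d "\<lambda>i. conformality_mat d ls vs $$ (i, j)"
        "\<lambda>l. vs ! j \<in> supp l" "\<lambda>l. coord l (vs ! j)" y, OF conformality_mat_index[OF _ _ that]]
    unfolding ls'(2) .
  have "(\<forall>j<length vs. (\<Sum>i<length ls * (d + 1). y $ i * conformality_mat d ls vs $$ (i, j)) = 0) \<longleftrightarrow>
      (\<forall>v\<in>set vs. (\<Sum>l | l \<in> A \<and> v \<in> supp l. poly (decode_monom d ls y l) (coord l v)) = 0)"
    unfolding all_set_conv_all_nth using col by simp
  moreover have "\<forall>l. l \<notin> A \<longrightarrow> decode_monom d ls y l = 0" using decode_outside[of _ ls] ls'(2) by simp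
  moreover have "\<forall>l\<in>A. degree (decode_monom d ls y l) \<le> d"
    using degree_decode[OF poly_basis_monom] by blast
  ultimately show ?thesis
    unfolding mem_left_kernel_iff conformality_mat_dims syzygies_def vs'(2)[symmetric] by simp
qed

lemma decode_left_kernel_image:
  assumes ls: "enumerates ls A" and vs: "enumerates vs (verts_of C A)"
  shows "decode_monom d ls ` left_kernel (conformality_mat d ls vs) = syzygies C d A"
    and "inj_on (decode_monom d ls) (left_kernel (conformality_mat d ls vs))"
proof -
  have ls': "distinct ls" "set ls = A" using ls by (auto simp: enumerates_def)
  note iff = mem_left_kernel_conformality_iff[OF ls vs]
  show "decode_monom d ls ` left_kernel (conformality_mat d ls vs) = syzygies C d A"
  proof
    show "decode_monom d ls ` left_kernel (conformality_mat d ls vs) \<subseteq> syzygies C d A" using iff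
        by blast
    show "syzygies C d A \<subseteq> decode_monom d ls ` left_kernel (conformality_mat d ls vs)"
    proof
      fix p assume p: "p \<in> syzygies C d A"
      then have "degree (p l) \<le> d" if "l \<in> set ls" for l using that ls'(2)
          by (auto simp: syzygies_def)
      then obtain y where y: "y \<in> carrier_vec (length ls * (d + 1))" "\<And>l. l \<in> set ls \<Longrightarrow>
            decode_monom d ls y l = p l"
        using decode_surj[OF poly_basis_monom ls'(1)] by blast
      have eq: "decode_monom d ls y = p"
      proof (rule ext)
        fix l
        have "p l = 0" if "l \<notin> A" using p that unfolding syzygies_def by blast
        then show "decode_monom d ls y l = p l"
          using y(2)[of l] decode_outside[of l ls] ls'(2) by (cases "l \<in> A") simp_all
      qed
      then have "y \<in> left_kernel (conformality_mat d ls vs)" using iff y(1) p by simp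
      then show "p \<in> decode_monom d ls ` left_kernel (conformality_mat d ls vs)" using eq by blast
    qed
  qed
  show "inj_on (decode_monom d ls) (left_kernel (conformality_mat d ls vs))"
  proof (rule inj_onI)
    fix x y assume "x \<in> left_kernel (conformality_mat d ls vs)"
        "y \<in> left_kernel (conformality_mat d ls vs)"
      and eq: "decode_monom d ls x = decode_monom d ls y"
    then have "x \<in> carrier_vec (length ls * (d + 1))" "y \<in> carrier_vec (length ls * (d + 1))"
      using iff by auto
    then show "x = y" by (rule decode_inj[OF poly_basis_monom ls'(1)]) (simp add: eq)
  qed
qed

lemma decode_left_kernel_linear:
  assumes "x \<in> left_kernel (conformality_mat d ls vs)" "y \<in> left_kernel (conformality_mat d ls vs)"
  shows "decode d ls g (x + y) = (\<lambda>l. decode d ls g x l + decode d ls g y l)"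
    and "decode d ls g (a \<cdot>\<^sub>v x) = (\<lambda>l. Polynomial.smult a (decode d ls g x l))"
proof -
  have c: "x \<in> carrier_vec (length ls * (d + 1))" "y \<in> carrier_vec (length ls * (d + 1))"
    using assms unfolding mem_left_kernel_iff conformality_mat_dims by auto
  show "decode d ls g (x + y) = (\<lambda>l. decode d ls g x l + decode d ls g y l)"
    "decode d ls g (a \<cdot>\<^sub>v x) = (\<lambda>l. Polynomial.smult a (decode d ls g x l))"
    by (rule ext, rule decode_linear[OF c])+
qed

lemma poly_eq_if_agree_on_many:
  fixes p q :: "real poly"
  assumes "degree p \<le> d" "degree q \<le> d" "d + 1 \<le> card S"
    and "\<And>x. x \<in> S \<Longrightarrow> poly p x = poly q x"
  shows "p = q"
proof (rule ccontr)
  assume "p \<noteq> q"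
  then have nz: "p - q \<noteq> 0" by simp
  have "S \<subseteq> {x. poly (p - q) x = 0}" using assms(4) by auto
  then have "card S \<le> card {x. poly (p - q) x = 0}" by (intro card_mono poly_roots_finite[OF nz])
  also have "\<dots> \<le> degree (p - q)" by (rule card_poly_roots_bound[OF nz])
  also have "\<dots> \<le> d" using assms(1,2) by (rule degree_diff_le)
  finally show False using assms(3) by simp
qed

context mesh begin

lemma inj_on_coord_verts:
  assumes "l \<in> t_l_edges C"
  shows "inj_on (coord l) (verts_on C l)"
proof (rule inj_onI)
  fix u v assume uv: "u \<in> verts_on C l" "v \<in> verts_on C l" "coord l u = coord l v"
  obtain h where h: "oseg h l" using t_l_edge_oseg[OF assms] .
  have "u \<in> supp l" "v \<in> supp l" using uv by (auto simp: verts_on_def)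
  then have "along (\<not> h) u = along (\<not> h) v" unfolding mem_supp_iff[OF h] by simp
  then show "u = v" using uv(3) coord_eq_along[OF h] by (intro point_eqI[of h]) auto
qed

lemma edge_poly_eq_if_agree:
  assumes "l \<in> t_l_edges C" "degree p \<le> d" "degree q \<le> d"
    and S: "S \<subseteq> verts_on C l" "d + 1 \<le> card S" "\<And>v. v \<in> S \<Longrightarrow> poly p (coord l v) = poly q (coord l v)"
  shows "p = q"
proof (rule poly_eq_if_agree_on_many[OF assms(2,3)])
  have "card (coord l ` S) = card S"
    using inj_on_subset[OF inj_on_coord_verts[OF assms(1)] S(1)] by (rule card_image)
  then show "d + 1 \<le> card (coord l ` S)" using S(2) by simp
qed (use S(3) in auto)

text \<open>
  A syzygy of \<open>T1\<close> remains one on the whole mesh, since the other polynomials are zero. Conversely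
  the polynomials outside \<open>T1\<close> vanish one after the other, from the end of the reasonable order:
  at the vertices that the order leaves on an edge, only edges that come later, with polynomials
  already known to be zero, can cross it.
\<close>
lemma syzygies_regular_partition:
  assumes "regular_partition C d T1"
  shows "syzygies C d (t_l_edges C) = syzygies C d T1"
proof
  let ?T = "t_l_edges C"
  have T1: "T1 \<subseteq> ?T" and order: "has_reasonable_order C d (?T - T1) (verts_of C T1)"
    using assms by (auto simp: regular_partition_def)
  have restrict: "(\<Sum>l | l \<in> ?T \<and> v \<in> supp l. poly (p l) (coord l v)) =
        (\<Sum>l | l \<in> T1 \<and> v \<in> supp l. poly (p l) (coord l v))"
    if "\<And>l. l \<in> ?T - T1 \<Longrightarrow> p l = 0" for p v
  proof (rule sum.mono_neutral_right)
    show "\<forall>l\<in>{l. l \<in> ?T \<and> v \<in> supp l} - {l. l \<in> T1 \<and> v \<in> supp l}. poly (p l) (coord l v) = 0"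
    proof
      fix l assume "l \<in> {l. l \<in> ?T \<and> v \<in> supp l} - {l. l \<in> T1 \<and> v \<in> supp l}"
      then have "p l = 0" using that by blast
      then show "poly (p l) (coord l v) = 0" by simp
    qed
  qed (use T1 finite_t_l_edges in auto)
  have mono: "verts_of C T1 \<subseteq> verts_of C ?T" using T1 by (auto simp: verts_of_def)
  show "syzygies C d T1 \<subseteq> syzygies C d ?T"
  proof
    fix p assume p: "p \<in> syzygies C d T1"
    then have out: "p l = 0" if "l \<notin> T1" for l using that unfolding syzygies_def by blast
    have "(\<Sum>l | l \<in> ?T \<and> v \<in> supp l. poly (p l) (coord l v)) = 0" if "v \<in> verts_of C ?T" for v
    proof (cases "v \<in> verts_of C T1")
      case True
      then show ?thesis using restrict[of p v] out p by (simp add: syzygies_def)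
    next
      case False
      have "v \<in> vertices C" using that by (auto simp: verts_of_def verts_on_def)
      then have none: "{l. l \<in> T1 \<and> v \<in> supp l} = {}" using False
          by (auto simp: verts_of_def verts_on_def)
      show ?thesis using restrict[of p v] out unfolding none by simp
    qed
    moreover have "degree (p l) \<le> d" for l using syzygiesD(2)[OF p, of l] out[of l]
        by (cases "l \<in> T1") simp_all
    moreover have "p l = 0" if "l \<notin> ?T" for l using out[of l] that T1 by blast
    ultimately show "p \<in> syzygies C d ?T" by (intro syzygiesI)
  qed
  show "syzygies C d ?T \<subseteq> syzygies C d T1"
  proof
    fix p assume p: "p \<in> syzygies C d ?T"
    obtain qs where qs: "distinct qs" "set qs = ?T - T1"
      "\<And>i. i < length qs \<Longrightarrow> d + 1 \<le>
            card (verts_on C (qs ! i) - verts_of C T1 - (\<Union>j<i. verts_on C (qs ! j)))"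
      using order by (auto simp: has_reasonable_order_def enumerates_def)
    have zero: "p (qs ! i) = 0" if "i < length qs" for i
      using that
    proof (induction "length qs - i" arbitrary: i rule: less_induct)
      case less
      let ?l = "qs ! i" and ?S = "verts_on C (qs ! i) - verts_of C T1 - (\<Union>j<i. verts_on C (qs ! j))"
      have l: "?l \<in> ?T" using less.prems qs(2) nth_mem by blast
      have later: "p (qs ! j) = 0" if "i < j" "j < length qs" for j
        using less.hyps[of j] that by simp
      show ?case
      proof (rule edge_poly_eq_if_agree[OF l, of _ d _ ?S])
        show "degree (p ?l) \<le> d" using p l by (simp add: syzygies_def)
        show "d + 1 \<le> card ?S" by (rule qs(3)[OF less.prems])
        fix v assume v: "v \<in> ?S"
        then have "v \<in> vertices C" "v \<in> supp ?l" by (auto simp: verts_on_def)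
        have "poly (p k) (coord k v) = 0" if k: "k \<in> {k. k \<in> ?T \<and> v \<in> supp k} - {?l}" for k
        proof -
          have vk: "v \<in> verts_on C k" using k \<open>v \<in> vertices C\<close> by (simp add: verts_on_def)
          then have "k \<notin> T1" using v by (auto simp: verts_of_def)
          then have "k \<in> set qs" using k qs(2) by blast
          then obtain j where j: "j < length qs" "k = qs ! j" unfolding in_set_conv_nth by blast
          have "\<not> j < i" using v vk j by blast
          moreover have "j \<noteq> i" using k j by auto
          ultimately have "p k = 0" using later j by simp
          then show ?thesis by simp
        qed
        then have "(\<Sum>k | k \<in> ?T \<and> v \<in> supp k. poly (p k) (coord k v)) = poly (p ?l) (coord ?l v)"
          using l \<open>v \<in> supp ?l\<close> finite_t_l_edges
              by (subst sum.remove[of _ ?l]) (auto intro!: sum.neutral)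
        moreover have "v \<in> verts_of C ?T" using v l by (auto simp: verts_of_def)
        ultimately show "poly (p ?l) (coord ?l v) = poly 0 (coord ?l v)" using p
            by (simp add: syzygies_def)
      qed auto
    qed
    have T2: "p l = 0" if "l \<in> ?T - T1" for l
    proof -
      have "l \<in> set qs" using that qs(2) by blast
      then show ?thesis unfolding in_set_conv_nth using zero by blast
    qed
    have "(\<Sum>l | l \<in> T1 \<and> v \<in> supp l. poly (p l) (coord l v)) = 0" if "v \<in> verts_of C T1" for v
      using restrict[of p v, OF T2] syzygiesD(3)[OF p, of v] mono that by auto
    moreover have "p l = 0" if "l \<notin> T1" for l using T2[of l] syzygiesD(1)[OF p, of l] that by blast
    moreover have "degree (p l) \<le> d" if "l \<in> T1" for l using syzygiesD(2)[OF p, of l] that T1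
        by blast
    ultimately show "p \<in> syzygies C d T1" by (intro syzygiesI)
  qed
qed

theorem corank_regular_partition:
  assumes T1: "regular_partition C d T1"
    and ts: "enumerates ts (t_l_edges C)" "enumerates tvs (verts_of C (t_l_edges C))"
    and ls: "enumerates ls T1" "enumerates vs (verts_of C T1)"
  shows "int (length ts * (d + 1)) - int (mrank (conformality_mat d ts tvs)) =
    int (length ls * (d + 1)) - int (mrank (conformality_mat d ls vs))"
proof -
  have "int (dim_row (conformality_mat d ts tvs)) - int (mrank (conformality_mat d ts tvs)) =
      int (dim_row (conformality_mat d ls vs)) - int (mrank (conformality_mat d ls vs))"
  proof (rule corank_eq_if_left_kernels_same_image[where f = "decode_monom d ts"
      and g = "decode_monom d ls"
        and add = "\<lambda>p q l. p l + q l" and sc = "\<lambda>a p l. Polynomial.smult a (p l)"])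
    show "decode_monom d ts ` left_kernel (conformality_mat d ts tvs) =
          decode_monom d ls ` left_kernel (conformality_mat d ls vs)"
      unfolding decode_left_kernel_image(1)[OF ts] decode_left_kernel_image(1)[OF ls]
          by (rule syzygies_regular_partition[OF T1])
  qed (use decode_left_kernel_image(2)[OF ts] decode_left_kernel_image(2)[OF ls]
      decode_left_kernel_linear in blast)+
  then show ?thesis unfolding conformality_mat_dims .
qed

end

section \<open>The left kernel of the condensed coupling matrix\<close>

lemma pick_lessThan: "i < n \<Longrightarrow> pick {..<n} i = i"
proof -
  assume i: "i < n"
  then have "{a \<in> {..<n}. a < i} = {..<i}" by auto
  then show "pick {..<n} i = i" using pick_card_in_set[of i "{..<n}"] i by simp
qed

lemma condensed_coupling_mat_dims:
  "dim_row (condensed_coupling_mat m B) = m" "dim_col (condensed_coupling_mat m B) = dim_col B"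
  by (simp_all add: condensed_coupling_mat_def K2_mat_def dim_submatrix)

lemma condensed_coupling_mat_index:
  assumes "i < m" "c < dim_col B" "2 * m \<le> dim_row B"
  shows "condensed_coupling_mat m B $$ (i, c) = B $$ (i, c) - B $$ (m + i, c)"
proof -
  have rows: "{i. i < dim_row B \<and> i \<in> {..<2 * m}} = {..<2 * m}" using assms(3) by auto
  have sub: "submatrix B {..<2 * m} UNIV $$ (j, c) = B $$ (j, c)" if "j < 2 * m" for j
    using submatrix_index[of j B "{..<2 * m}" c UNIV] that assms(2)
    unfolding rows by (simp add: pick_lessThan pick_UNIV)
  have "condensed_coupling_mat m B $$ (i, c) =
      (\<Sum>j<2 * m. (if j = i then 1 else if j = m + i then - 1 else 0) * B $$ (j, c))"
  proof -
    let ?S = "submatrix B {..<2 * m} UNIV"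
    have dS: "dim_row ?S = 2 * m" "dim_col ?S = dim_col B" unfolding dim_submatrix rows by simp_all
    have "condensed_coupling_mat m B $$ (i, c) =
          (\<Sum>j<2 * m. (if j = i then 1 else if j = m + i then - 1 else 0) * ?S $$ (j, c))"
      unfolding condensed_coupling_mat_def using assms dS
      by (simp add: K2_mat_def scalar_prod_def atLeast0LessThan)
    then show ?thesis using sub by simp
  qed
  also have "\<dots> = (\<Sum>j<2 * m. (if j = i then B $$ (j, c) else 0) - (if j = m +
        i then B $$ (j, c) else 0))"
    by (rule sum.cong) (use assms(1) in auto)
  also have "\<dots> = B $$ (i, c) - B $$ (m + i, c)"
    using assms(1) by (simp add: sum_subtractf)
  finally show ?thesis .
qed

text \<open>
  The vector \<open>(w, -w, 0)\<close> of length \<open>n\<close>; its product with a kernel vector of \<open>K\<^sub>1\<close> is the product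
  of \<open>w\<close> with the image of that vector under \<open>K\<^sub>2\<close>.
\<close>
definition antidiagonal_vec :: "nat \<Rightarrow> nat \<Rightarrow> real vec \<Rightarrow> real vec" where
  "antidiagonal_vec n m w = vec n (\<lambda>j. if j < m then w $ j else if j < 2 * m then - w $ (j - m)
        else 0)"

lemma antidiagonal_scalar_prod:
  assumes "b \<in> carrier_vec n" "2 * m \<le> n"
  shows "antidiagonal_vec n m w \<bullet> b = (\<Sum>i<m. w $ i * (b $ i - b $ (m + i)))"
proof -
  let ?g = "\<lambda>j. (if j < m then w $ j else if j < 2 * m then - w $ (j - m) else 0) * b $ j"
  have "antidiagonal_vec n m w \<bullet> b = (\<Sum>j<n. ?g j)"
    using assms(1) by (simp add: antidiagonal_vec_def scalar_prod_def atLeast0LessThan)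
  also have "\<dots> = (\<Sum>j\<in>{..<m} \<union> {m..<2 * m}. ?g j)"
    by (rule sum.mono_neutral_right) (use assms(2) in auto)
  also have "\<dots> = (\<Sum>j<m. ?g j) + (\<Sum>j = m..<2 * m. ?g j)"
    by (rule sum.union_disjoint) auto
  also have "(\<Sum>j = m..<2 * m. ?g j) = (\<Sum>i<m. ?g (m + i))"
    by (rule sum.reindex_bij_witness[of _ "\<lambda>i. m + i" "\<lambda>j. j - m"]) auto
  also have "(\<Sum>j<m. ?g j) + (\<Sum>i<m. ?g (m + i)) = (\<Sum>i<m. w $ i * (b $ i - b $ (m + i)))"
    unfolding sum.distrib[symmetric] by (intro sum.cong refl) (simp add: algebra_simps)
  finally show ?thesis .
qed

text \<open>
  The columns of \<open>B\<close> span the kernel of \<open>A\<close>, so orthogonality to them is orthogonality to the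
  kernel, and \<open>orthogonal_to_kernel\<close> applies.
\<close>
lemma left_kernel_condensed_coupling_iff:
  fixes A :: "real mat"
  assumes B: "kernel_basis_mat A B" and m: "2 * m \<le> dim_col A"
  shows "w \<in> left_kernel (condensed_coupling_mat m B) \<longleftrightarrow>
    w \<in> carrier_vec m \<and> (\<exists>y\<in>carrier_vec (dim_row A). antidiagonal_vec (dim_col A) m w = A\<^sup>T *\<^sub>v y)"
proof -
  let ?n = "dim_col A" and ?a = "antidiagonal_vec (dim_col A) m w"
  interpret K: kernel "dim_row A" ?n A by unfold_locales simp
  have dB: "dim_row B = ?n" and basis: "K.basis (set (cols B))" using B
      by (auto simp: kernel_basis_mat_def)
  have sub: "set (cols B) \<subseteq> mat_kernel A" and gen: "K.span (set (cols B)) = mat_kernel A"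
    using basis unfolding K.Ker.basis_def by auto
  have colsc: "set (cols B) \<subseteq> carrier_vec ?n" using cols_dim[of B] dB by simp
  have span: "K.NC.span (set (cols B)) = mat_kernel A" using K.span_same[OF sub] gen by simp
  have a: "?a \<in> carrier_vec ?n" by (simp add: antidiagonal_vec_def)
  have col: "col B c \<in> carrier_vec ?n" for c using dB by (auto intro: carrier_vecI)
  have K: "(\<Sum>i<m. w $ i * condensed_coupling_mat m B $$ (i, c)) = ?a \<bullet> col B c"
      if c: "c < dim_col B" for c
    unfolding antidiagonal_scalar_prod[OF col m]
    by (intro sum.cong refl) (use c m dB in \<open>simp add: condensed_coupling_mat_index\<close>)
  have "(\<forall>c<dim_col B. ?a \<bullet> col B c = 0) \<longleftrightarrow> (\<forall>b\<in>set (cols B). ?a \<bullet> b = 0)"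
    by (metis cols_length cols_nth in_set_conv_nth)
  also have "\<dots> \<longleftrightarrow> ?a \<in> K.NC.orthogonal_complement (set (cols B))"
    using a by (simp add: K.NC.orthogonal_complement_def)
  also have "\<dots> \<longleftrightarrow> ?a \<in> K.NC.orthogonal_complement (mat_kernel A)"
    using K.NC.in_orthogonal_complement_span[OF colsc] span by simp
  also have "\<dots> \<longleftrightarrow> (\<forall>z\<in>mat_kernel A. ?a \<bullet> z = 0)"
    using a by (simp add: K.NC.orthogonal_complement_def)
  also have "\<dots> \<longleftrightarrow> (\<exists>y\<in>carrier_vec (dim_row A). ?a = A\<^sup>T *\<^sub>v y)"
  proof
    assume "\<forall>z\<in>mat_kernel A. ?a \<bullet> z = 0"
    then obtain y where "y \<in> carrier_vec (dim_row A)" "?a = A\<^sup>T *\<^sub>v y"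
      using orthogonal_to_kernel[OF a] by blast
    then show "\<exists>y\<in>carrier_vec (dim_row A). ?a = A\<^sup>T *\<^sub>v y" by blast
  next
    assume "\<exists>y\<in>carrier_vec (dim_row A). ?a = A\<^sup>T *\<^sub>v y"
    then obtain y where y: "y \<in> carrier_vec (dim_row A)" "?a = A\<^sup>T *\<^sub>v y" by blast
    show "\<forall>z\<in>mat_kernel A. ?a \<bullet> z = 0"
    proof
      fix z assume z: "z \<in> mat_kernel A"
      then have zc: "z \<in> carrier_vec ?n" "A *\<^sub>v z = 0\<^sub>v (dim_row A)" by (auto simp: mat_kernel_def)
      have "?a \<bullet> z = y \<bullet> (A *\<^sub>v z)"
        unfolding y(2) by (rule transpose_vec_mult_scalar[OF _ zc(1) y(1)]) simp
      then show "?a \<bullet> z = 0" using zc(2) y(1) by simp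
    qed
  qed
  finally have "(\<forall>c<dim_col B. ?a \<bullet> col B c = 0) \<longleftrightarrow> (\<exists>y\<in>carrier_vec (dim_row A). ?a = A\<^sup>T *\<^sub>v y)" .
  then show ?thesis
    unfolding mem_left_kernel_iff condensed_coupling_mat_dims using K by simp
qed

definition edge_through :: "seg set \<Rightarrow> bool \<Rightarrow> point \<Rightarrow> seg" where
  "edge_through A h v = (THE l. l \<in> A \<and> (if h then hseg l else vseg l) \<and> v \<in> supp l)"

abbreviation edge_value :: "seg set \<Rightarrow> (seg \<Rightarrow> real poly) \<Rightarrow> bool \<Rightarrow> point \<Rightarrow> real" where
  "edge_value A p h v \<equiv> poly (p (edge_through A h v)) (coord (edge_through A h v) v)"

definition mono_edge :: "seg set \<Rightarrow> point \<Rightarrow> seg" where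
  "mono_edge A v = (THE l. l \<in> A \<and> v \<in> supp l)"

lemma coupling_vars_eq:
  "coupling_vars A ms us = map (\<lambda>v. (edge_through A True v, v)) ms @
    map (\<lambda>v. (edge_through A False v, v)) ms @ map (\<lambda>v. (mono_edge A v, v)) us"
  by (simp add: coupling_vars_def edge_through_def mono_edge_def)

lemma K1_mat_dims: "dim_row (K1_mat d ls ms us) = length ls * (d + 1)"
    "dim_col (K1_mat d ls ms us) = 2 * length ms + length us"
  by (simp_all add: K1_mat_def Let_def coupling_vars_def)

lemma K1_mat_index:
  assumes "i < length ls" "k \<le> d" "j < 2 * length ms + length us"
      "coupling_vars (set ls) ms us ! j = (e, v)"
  shows "K1_mat d ls ms us $$ (i * (d + 1) + k, j) =
        (if e = ls ! i then coord (ls ! i) v ^ k else 0)"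
proof -
  have "length (coupling_vars (set ls) ms us) = 2 * length ms + length us"
      by (simp add: coupling_vars_def)
  then show ?thesis
    using assms row_index_less[OF assms(1,2)] row_index_div_mod[OF assms(2), of i]
    by (simp add: K1_mat_def Let_def)
qed

lemma K1_mat_transpose_mult:
  assumes ls: "distinct ls" and j: "j < 2 * length ms + length us"
    and var: "coupling_vars (set ls) ms us ! j = (e, v)" "e \<in> set ls"
    and y: "y \<in> carrier_vec (length ls * (d + 1))"
  shows "((K1_mat d ls ms us)\<^sup>T *\<^sub>v y) $ j = poly (decode_monom d ls y e) (coord e v)"
proof -
  have "((K1_mat d ls ms us)\<^sup>T *\<^sub>v y) $ j =
        (\<Sum>i<length ls * (d + 1). y $ i * K1_mat d ls ms us $$ (i, j))"
    using j y by (simp add: K1_mat_dims scalar_prod_def atLeast0LessThan mult.commute)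
  also have "\<dots> = (\<Sum>l | l \<in> set ls \<and> e = l. poly (decode_monom d ls y l) (coord l v))"
    by (rule sum_vandermonde_column[OF ls K1_mat_index[OF _ _ j var(1)]])
  also have "{l. l \<in> set ls \<and> e = l} = {e}" using var(2) by blast
  finally show ?thesis by simp
qed

context mesh begin

lemma edge_through_unique:
  assumes A: "A \<subseteq> t_l_edges C" and l: "l \<in> A" "oseg h l" "v \<in> supp l"
  shows "edge_through A h v = l"
  unfolding edge_through_def
proof (rule the_equality)
  have o: "(if h then hseg k else vseg k) \<longleftrightarrow> oseg h k" for k using oseg_simps[of k]
      by (cases h) simp_all
  show "l \<in> A \<and> (if h then hseg l else vseg l) \<and> v \<in> supp l" using l o by blast
  show "k = l" if "k \<in> A \<and> (if h then hseg k else vseg k) \<and> v \<in> supp k" for k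
    using t_l_edge_unique[of k h l v] that A l unfolding o by blast
qed

lemma multi_vertex_edges:
  assumes A: "A \<subseteq> t_l_edges C" and v: "v \<in> multi_vertices C A"
  shows "edge_through A h v \<in> A" "oseg h (edge_through A h v)" "v \<in> supp (edge_through A h v)"
    and "{l. l \<in> A \<and> v \<in> supp l} = {edge_through A True v, edge_through A False v}"
proof -
  obtain l l' where l: "l \<in> A" "oseg True l" "v \<in> supp l"
      and l': "l' \<in> A" "oseg False l'" "v \<in> supp l'"
    using v unfolding multi_vertices_def oseg_simps by blast
  note e = edge_through_unique[OF A l] edge_through_unique[OF A l']
  show "edge_through A h v \<in> A" "oseg h (edge_through A h v)" "v \<in> supp (edge_through A h v)"
    using l l' e by (cases h; simp)+
  have "k = l \<or> k = l'" if k: "k \<in> A" "v \<in> supp k" for k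
  proof -
    have "k \<in> t_l_edges C" using k A by blast
    then obtain h where "oseg h k" by (rule t_l_edge_oseg)
    then show ?thesis using edge_through_unique[OF A k(1) _ k(2), of h] e by (cases h) auto
  qed
  then show "{l. l \<in> A \<and> v \<in> supp l} = {edge_through A True v, edge_through A False v}"
    using l l' unfolding e by blast
qed

lemma mono_vertex_edges:
  assumes A: "A \<subseteq> t_l_edges C" and v: "v \<in> mono_vertices C A"
  shows "mono_edge A v \<in> A" "{l. l \<in> A \<and> v \<in> supp l} = {mono_edge A v}"
proof -
  obtain l where l: "l \<in> A" "v \<in> supp l" "v \<in> vertices C"
    using v unfolding mono_vertices_def verts_of_def verts_on_def by blast
  have not_multi: "v \<notin> multi_vertices C A" using v unfolding mono_vertices_def by blast
  have uniq: "k = l" if k: "k \<in> A" "v \<in> supp k" for k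
  proof -
    have kT: "k \<in> t_l_edges C" and lT: "l \<in> t_l_edges C" using k l A by blast+
    obtain h where h: "oseg h k" using t_l_edge_oseg[OF kT] .
    obtain h' where h': "oseg h' l" using t_l_edge_oseg[OF lT] .
    have "h = h'"
    proof (rule ccontr)
      assume "h \<noteq> h'"
      then have "(oseg True k \<and> oseg False l) \<or> (oseg True l \<and> oseg False k)" using h h'
          by (cases h; cases h') auto
      then have "v \<in> multi_vertices C A" unfolding multi_vertices_def oseg_simps using k l by blast
      then show False using not_multi by blast
    qed
    then show ?thesis using t_l_edge_unique[OF kT h lT _ k(2) l(2)] h' by blast
  qed
  have "mono_edge A v = l"
    unfolding mono_edge_def by (rule the_equality) (use l uniq in blast)+
  then show "mono_edge A v \<in> A" "{l. l \<in> A \<and> v \<in> supp l} = {mono_edge A v}" using l uniq by blast+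
qed

text \<open>
  The value at a multi-vertex is taken on the horizontal edge; on the vertical edge a syzygy has
  the opposite value.
\<close>
definition coupling_value :: "seg set \<Rightarrow> (seg \<Rightarrow> real poly) \<Rightarrow> point \<Rightarrow> real" where
  "coupling_value A p v = (if v \<in> multi_vertices C A
     then edge_value A p True v else 0)"

lemma syzygies_iff_coupled:
  assumes A: "A \<subseteq> t_l_edges C"
    and p: "\<And>l. l \<notin> A \<Longrightarrow> p l = 0" "\<And>l. l \<in> A \<Longrightarrow> degree (p l) \<le> d"
  shows "p \<in> syzygies C d A \<longleftrightarrow>
    (\<forall>v\<in>multi_vertices C A. edge_value A p True v +
       edge_value A p False v = 0) \<and>
    (\<forall>v\<in>mono_vertices C A. poly (p (mono_edge A v)) (coord (mono_edge A v) v) = 0)"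
proof -
  let ?s = "\<lambda>v. \<Sum>l | l \<in> A \<and> v \<in> supp l. poly (p l) (coord l v)"
  have multi: "?s v = edge_value A p True v +
       edge_value A p False v" if v: "v \<in> multi_vertices C A" for v
  proof -
    have "edge_through A True v \<noteq> edge_through A False v"
      using multi_vertex_edges(2)[OF A v, of True] multi_vertex_edges(2)[OF A v, of False]
          oseg_unique by metis
    then show ?thesis unfolding multi_vertex_edges(4)[OF A v] by simp
  qed
  have mono: "?s v = poly (p (mono_edge A v)) (coord (mono_edge A v) v)"
      if v: "v \<in> mono_vertices C A" for v
    unfolding mono_vertex_edges(2)[OF A v] by simp
  have "multi_vertices C A \<subseteq> verts_of C A"
    unfolding multi_vertices_def verts_of_def verts_on_def by blast
  then have "verts_of C A = multi_vertices C A \<union> mono_vertices C A" unfolding mono_vertices_def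
      by blast
  then have "p \<in> syzygies C d A \<longleftrightarrow> (\<forall>v\<in>multi_vertices C A. ?s v = 0) \<and>
        (\<forall>v\<in>mono_vertices C A. ?s v = 0)"
    unfolding syzygies_def using p by blast
  then show ?thesis using multi mono by simp
qed

lemma syzygies_value_on_edge:
  assumes A: "A \<subseteq> t_l_edges C" and p: "p \<in> syzygies C d A" and l: "l \<in> A" "v \<in> verts_on C l"
  shows "poly (p l) (coord l v) = (if hseg l then 1 else - 1) * coupling_value A p v"
proof -
  have lT: "l \<in> t_l_edges C" using A l by blast
  obtain h where h: "oseg h l" using t_l_edge_oseg[OF lT] .
  have vl: "v \<in> supp l" using l(2) by (simp add: verts_on_def)
  \<comment> \<open>a syzygy takes opposite values on the two edges at a multi-vertex
      and the value zero at a mono-vertex\<close>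
  note coupled = syzygies_iff_coupled[OF A syzygiesD(1,2)[OF p], THEN iffD1, OF _ _ p]
  have vA: "v \<in> verts_of C A" using l unfolding verts_of_def by blast
  show ?thesis
  proof (cases "v \<in> multi_vertices C A")
    case True
    have "edge_through A h v = l" by (rule edge_through_unique[OF A l(1) h vl])
    then show ?thesis using coupled True hseg_iff_oseg[OF h]
        by (cases h) (auto simp: coupling_value_def)
  next
    case False
    then have mono: "v \<in> mono_vertices C A" using vA by (simp add: mono_vertices_def)
    have "l \<in> {k. k \<in> A \<and> v \<in> supp k}" using l(1) vl by simp
    then have "mono_edge A v = l" unfolding mono_vertex_edges(2)[OF A mono] by simp
    then show ?thesis using mono using coupled False by (auto simp: coupling_value_def)
  qed
qed

text \<open>
  Both left kernels are mapped to functions on vertices: a syzygy to its values on the horizontal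
  edges at the multi-vertices, a vector \<open>w\<close> to its entries at the multi-vertices. The first map is
  injective because a polynomial of degree at most \<open>d\<close> is determined by its values on an edge with
  more than \<open>d\<close> vertices. That the images agree is the row space description of the left kernel of
  the coupling matrix.
\<close>
theorem corank_condensed_coupling:
  assumes A: "A \<subseteq> t_l_edges C" and long: "\<And>l. l \<in> A \<Longrightarrow> d + 1 \<le> card (verts_on C l)"
    and ls: "enumerates ls A" and ms: "enumerates ms (multi_vertices C A)"
        and us: "enumerates us (mono_vertices C A)"
    and B: "kernel_basis_mat (K1_mat d ls ms us) B"
  shows "int (length ls * (d + 1)) - int (mrank (conformality_mat d ls (ms @ us))) =
    int (length ms) - int (mrank (condensed_coupling_mat (length ms) B))"
proof -
  let ?m = "length ms" and ?n = "2 * length ms + length us"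
  let ?M = "conformality_mat d ls (ms @ us)" and ?K = "condensed_coupling_mat (length ms) B"
  let ?dec = "decode_monom d ls" and ?K1 = "K1_mat d ls ms us"
  let ?vars = "coupling_vars A ms us"
  have ls': "distinct ls" "set ls = A" and ms': "distinct ms" "set ms = multi_vertices C A"
    and us': "distinct us" "set us = mono_vertices C A"
    using ls ms us by (auto simp: enumerates_def)
  have "multi_vertices C A \<subseteq> verts_of C A"
    unfolding multi_vertices_def verts_of_def verts_on_def by blast
  then have vs: "enumerates (ms @ us) (verts_of C A)"
    using ms' us' by (auto simp: enumerates_def mono_vertices_def)
  note M_iff = mem_left_kernel_conformality_iff[OF ls vs]
  have K_iff: "w \<in> left_kernel ?K \<longleftrightarrow> w \<in> carrier_vec ?m \<and>
      (\<exists>y\<in>carrier_vec (length ls * (d + 1)). antidiagonal_vec ?n ?m w = ?K1\<^sup>T *\<^sub>v y)" for w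
    using left_kernel_condensed_coupling_iff[OF B, of ?m w] by (simp add: K1_mat_dims)
  have syzygies_coupled: "?dec y \<in> syzygies C d A \<longleftrightarrow>
      (\<forall>v\<in>multi_vertices C A. edge_value A (?dec y) True v +
         edge_value A (?dec y) False v = 0) \<and>
      (\<forall>v\<in>mono_vertices C A. poly (?dec y (mono_edge A v)) (coord (mono_edge A v) v) = 0)" for y
    by (rule syzygies_iff_coupled[OF A])
        (use decode_outside[of _ ls] degree_decode[OF poly_basis_monom] ls'(2) in blast)+
  \<comment> \<open>the equation \<open>K\<^sub>1\<^sup>T y = (w, -w, 0)\<close> for the three blocks of variables\<close>
  have antidiag: "antidiagonal_vec ?n ?m w = ?K1\<^sup>T *\<^sub>v y \<longleftrightarrow>
      (\<forall>j<?m. edge_value A (?dec y) True (ms ! j) = w $ j) \<and>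
      (\<forall>j<?m. edge_value A (?dec y) False (ms ! j) = - w $ j) \<and>
      (\<forall>v\<in>mono_vertices C A. poly (?dec y (mono_edge A v)) (coord (mono_edge A v) v) = 0)"
    if y: "y \<in> carrier_vec (length ls * (d + 1))" for w y
  proof -
    have ms_in: "ms ! j \<in> multi_vertices C A" if "j < ?m" for j using nth_mem[OF that] ms'(2)
        by simp
    have us_in: "us ! j \<in> mono_vertices C A" if "j < length us" for j using nth_mem[OF that] us'(2)
        by simp
    have entry: "(?K1\<^sup>T *\<^sub>v y) $ j = poly (?dec y e) (coord e v)"
        if "j < ?n" "?vars ! j = (e, v)" "e \<in> A" for j e v
      using K1_mat_transpose_mult[OF ls'(1) that(1) _ _ y] that(2,3) ls'(2) by simp
    have h: "(?K1\<^sup>T *\<^sub>v y) $ j = edge_value A (?dec y) True (ms ! j)"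
      if "j < ?m" for j
      by (rule entry) (use that multi_vertex_edges(1)[OF A ms_in[OF that]] in \<open>auto
          simp: coupling_vars_eq nth_append\<close>)
    have v: "(?K1\<^sup>T *\<^sub>v y) $ (?m + j) = edge_value A (?dec y) False (ms ! j)"
      if "j < ?m" for j
      by (rule entry) (use that multi_vertex_edges(1)[OF A ms_in[OF that]] in \<open>auto
          simp: coupling_vars_eq nth_append\<close>)
    have u: "(?K1\<^sup>T *\<^sub>v y) $ (2 * ?m + j) =
          poly (?dec y (mono_edge A (us ! j))) (coord (mono_edge A (us ! j)) (us ! j))"
      if "j < length us" for j
      by (rule entry) (use that mono_vertex_edges(1)[OF A us_in[OF that]] in \<open>auto
          simp: coupling_vars_eq nth_append\<close>)
    let ?Y = "?K1\<^sup>T *\<^sub>v y" and ?a = "antidiagonal_vec ?n ?m w"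
    have "?a = ?Y \<longleftrightarrow> (\<forall>j<?n. ?Y $ j = ?a $ j)"
      by (auto simp: vec_eq_iff antidiagonal_vec_def K1_mat_dims)
    also have "\<dots> \<longleftrightarrow> (\<forall>j<?m. ?Y $ j = ?a $ j) \<and> (\<forall>j<?m. ?Y $ (?m + j) = ?a $ (?m + j)) \<and>
        (\<forall>j<length us. ?Y $ (2 * ?m + j) = ?a $ (2 * ?m + j))" (is "?l \<longleftrightarrow> ?r")
    proof
      assume r: ?r
      show ?l
      proof (intro allI impI)
        fix j assume j: "j < ?n"
        consider "j < ?m" | i where "j = ?m + i" "i < ?m" | i where "j = 2 * ?m + i" "i < length us"
          using j by (metis add.assoc le_add_diff_inverse linorder_not_less mult_2
              nat_add_left_cancel_less)
        then show "?Y $ j = ?a $ j" using r by cases blast+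
      qed
    qed auto
    also have "\<dots> \<longleftrightarrow> (\<forall>j<?m. ?Y $ j = w $ j) \<and> (\<forall>j<?m. ?Y $ (?m + j) = - w $ j) \<and>
          (\<forall>j<length us. ?Y $ (2 * ?m + j) = 0)"
      by (simp add: antidiagonal_vec_def)
    also have "\<dots> \<longleftrightarrow> (\<forall>j<?m. edge_value A (?dec y) True (ms ! j) = w $ j) \<and>
        (\<forall>j<?m. edge_value A (?dec y) False (ms ! j) = - w $ j) \<and>
        (\<forall>j<length us. poly (?dec y (mono_edge A (us ! j))) (coord (mono_edge A (us ! j)) (us ! j))
            = 0)"
      using h v u by simp
    finally show ?thesis unfolding us'(2)[symmetric] all_set_conv_all_nth .
  qed
  define g where "g w v = (\<Sum>j<?m. if ms ! j = v then w $ j else 0)" for w :: "real vec" and v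
  have g_nth: "g w (ms ! j) = w $ j" if "j < ?m" for w j
  proof -
    have "g w (ms ! j) = (\<Sum>i<?m. if i = j then w $ j else 0)"
      unfolding g_def using ms'(1) that by (intro sum.cong refl) (auto simp: nth_eq_iff_index_eq)
    then show ?thesis using that by simp
  qed
  have g_out: "g w v = 0" if "v \<notin> multi_vertices C A" for w v
    unfolding g_def by (rule sum.neutral) (use that ms'(2) nth_mem in force)
  have g_eqI: "g w = coupling_value A p"
    if "\<And>j. j < ?m \<Longrightarrow> coupling_value A p (ms ! j) = w $ j" for w p
  proof (rule ext)
    fix v show "g w v = coupling_value A p v"
    proof (cases "v \<in> multi_vertices C A")
      case True
      then obtain j where "j < ?m" "v = ms ! j" using ms'(2) by (metis in_set_conv_nth)
      then show ?thesis using that g_nth by simp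
    qed (simp add: g_out coupling_value_def)
  qed
  have value_nth: "coupling_value A p (ms ! j) = edge_value A p True (ms ! j)"
    if "j < ?m" for p j
    using that ms'(2) nth_mem by (force simp: coupling_value_def)
  let ?f = "\<lambda>y. coupling_value A (?dec y)"
  have "int (dim_row ?M) - int (mrank ?M) = int (dim_row ?K) - int (mrank ?K)"
  proof (rule corank_eq_if_left_kernels_same_image[where f = ?f and g = g
        and add = "\<lambda>a b v. a v + b v" and sc = "\<lambda>c a v. c * a v"])
    fix x y assume xy: "x \<in> left_kernel ?M" "y \<in> left_kernel ?M"
    show "?f (x + y) = (\<lambda>v. ?f x v + ?f y v)"
      unfolding decode_left_kernel_linear(1)[OF xy] by (rule ext) (simp add: coupling_value_def)
  next
    fix a x assume x: "x \<in> left_kernel ?M"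
    show "?f (a \<cdot>\<^sub>v x) = (\<lambda>v. a * ?f x v)"
      unfolding decode_left_kernel_linear(2)[OF x x] by (rule ext) (simp add: coupling_value_def)
  next
    fix x y assume "x \<in> left_kernel ?K" "y \<in> left_kernel ?K"
    then have c: "x \<in> carrier_vec ?m" "y \<in> carrier_vec ?m" using K_iff by blast+
    show "g (x + y) = (\<lambda>v. g x v + g y v)"
      unfolding g_def sum.distrib[symmetric] by (intro ext sum.cong refl) (use c in auto)
  next
    fix a x assume "x \<in> left_kernel ?K"
    then have c: "x \<in> carrier_vec ?m" using K_iff by blast
    show "g (a \<cdot>\<^sub>v x) = (\<lambda>v. a * g x v)"
      unfolding g_def sum_distrib_left by (intro ext sum.cong refl) (use c in auto)
  next
    show "inj_on ?f (left_kernel ?M)"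
    proof (rule inj_onI)
      fix x y assume x: "x \<in> left_kernel ?M" and y: "y \<in> left_kernel ?M" and eq: "?f x = ?f y"
      have sx: "?dec x \<in> syzygies C d A" and sy: "?dec y \<in> syzygies C d A" using x y M_iff by blast+
      have "?dec x l = ?dec y l" if l: "l \<in> A" for l
      proof (rule edge_poly_eq_if_agree[of l _ d _ "verts_on C l"])
        show "l \<in> t_l_edges C" using A l by blast
        show "degree (?dec x l) \<le> d" "degree (?dec y l) \<le> d"
          using syzygiesD(2)[OF sx l] syzygiesD(2)[OF sy l] .
        show "d + 1 \<le> card (verts_on C l)" by (rule long[OF l])
        show "poly (?dec x l) (coord l v) = poly (?dec y l) (coord l v)" if "v \<in> verts_on C l" for v
          using syzygies_value_on_edge[OF A sx l that] syzygies_value_on_edge[OF A sy l that] eq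
              by simp
      qed simp
      then have "?dec x l = ?dec y l" for l
          using syzygiesD(1)[OF sx, of l] syzygiesD(1)[OF sy, of l] by (cases "l \<in> A") simp_all
      then have "?dec x = ?dec y" by (rule ext)
      then show "x = y" using decode_left_kernel_image(2)[OF ls vs] x y by (auto dest: inj_onD)
    qed
  next
    show "inj_on g (left_kernel ?K)"
    proof (rule inj_onI)
      fix x y assume "x \<in> left_kernel ?K" "y \<in> left_kernel ?K" and eq: "g x = g y"
      then have c: "x \<in> carrier_vec ?m" "y \<in> carrier_vec ?m" using K_iff by blast+
      show "x = y" using c g_nth[of _ x] g_nth[of _ y] eq by (intro eq_vecI) auto
    qed
  next
    show "?f ` left_kernel ?M = g ` left_kernel ?K"
    proof (intro equalityI subsetI)
      fix a assume "a \<in> ?f ` left_kernel ?M"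
      then obtain y where y: "y \<in> carrier_vec (length ls * (d + 1))" "?dec y \<in> syzygies C d A"
          and a: "a = ?f y"
        using M_iff by blast
      define w where "w = vec ?m (\<lambda>j. ?f y (ms ! j))"
      have w: "w $ j = ?f y (ms ! j)" if "j < ?m" for j using that by (simp add: w_def)
      have "antidiagonal_vec ?n ?m w = ?K1\<^sup>T *\<^sub>v y"
        unfolding antidiag[OF y(1)]
      proof (intro conjI)
        note s = y(2)[unfolded syzygies_coupled]
        show "\<forall>v\<in>mono_vertices C A. poly (?dec y (mono_edge A v)) (coord (mono_edge A v) v) = 0"
            using s by blast
        show "\<forall>j<?m. edge_value A (?dec y) True (ms ! j) = w $ j"
          using w value_nth by simp
        show "\<forall>j<?m. edge_value A (?dec y) False (ms ! j) = - w $ j"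
        proof (intro allI impI)
          fix j assume j: "j < ?m"
          then have "ms ! j \<in> multi_vertices C A" using ms'(2) nth_mem by blast
          then have "edge_value A (?dec y) True (ms ! j) +
              edge_value A (?dec y) False (ms ! j) = 0"
            using s by blast
          then show "edge_value A (?dec y) False (ms ! j) = - w $ j"
            using w[OF j] value_nth[OF j, of "?dec y"] by linarith
        qed
      qed
      then have "w \<in> left_kernel ?K" using K_iff y(1) by (auto simp: w_def)
      moreover have "a = g w" unfolding a by (rule g_eqI[symmetric]) (simp add: w)
      ultimately show "a \<in> g ` left_kernel ?K" by blast
    next
      fix a assume "a \<in> g ` left_kernel ?K"
      then obtain w y where a: "a = g w" and y: "y \<in> carrier_vec (length ls * (d + 1))"
        and "antidiagonal_vec ?n ?m w = ?K1\<^sup>T *\<^sub>v y"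
        using K_iff by blast
      note wy = this(3)[unfolded antidiag[OF y]]
      have "\<forall>v\<in>set ms. edge_value A (?dec y) True v +
         edge_value A (?dec y) False v = 0"
        unfolding all_set_conv_all_nth using wy by simp
      then have "y \<in> left_kernel ?M" using M_iff y syzygies_coupled wy ms'(2) by simp
      moreover have "a = ?f y" unfolding a by (rule g_eqI) (use wy value_nth in simp)
      ultimately show "a \<in> ?f ` left_kernel ?M" by blast
    qed
  qed
  then show ?thesis unfolding conformality_mat_dims condensed_coupling_mat_dims .
qed

end

section \<open>Equality of the three differences and the homological term\<close>

theorem proposition4p2:
  fixes C :: "rect set" and d :: nat and T1 :: "seg set"
    and ts ls :: "seg list" and tvs ms us :: "point list" and B :: "real mat"
  assumes "d \<ge> 1"
    and "t_mesh C"
    and "t_connected C"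
    and "no_vanishable C d"
    and "\<not> diagonalizable C d"
    and "is_CNDC C d T1"
    and "enumerates ts (t_l_edges C)"
    and "enumerates tvs (verts_of C (t_l_edges C))"
    and "enumerates ls T1"
    and "enumerates ms (multi_vertices C T1)"
    and "enumerates us (mono_vertices C T1)"
    and "kernel_basis_mat (K1_mat d ls ms us) B"
  shows "int (h_term d C) =
           int (card (t_l_edges C) * (d + 1)) - int (mrank (conformality_mat d ts tvs)) \<and>
         int (card (t_l_edges C) * (d + 1)) - int (mrank (conformality_mat d ts tvs)) =
           int (card T1 * (d + 1)) - int (mrank (conformality_mat d ls (ms @ us))) \<and>
         int (card T1 * (d + 1)) - int (mrank (conformality_mat d ls (ms @ us))) =
           int (card (multi_vertices C T1)) - int (mrank (condensed_coupling_mat (length ms) B))"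
proof -
  interpret mesh C by unfold_locales (rule assms(2))
  have part: "regular_partition C d T1" using assms(6) by (simp add: is_CNDC_def)
  then have T1: "T1 \<subseteq> t_l_edges C" by (simp add: regular_partition_def)
  have long: "d + 1 \<le> card (verts_on C l)" if "l \<in> T1" for l
    using assms(4) T1 that by (force simp: no_vanishable_def)
  have "multi_vertices C T1 \<subseteq> verts_of C T1"
    unfolding multi_vertices_def verts_of_def verts_on_def by blast
  then have vs: "enumerates (ms @ us) (verts_of C T1)"
    using assms(10,11) by (auto simp: enumerates_def mono_vertices_def)
  have cards: "length ts = card (t_l_edges C)" "length ls = card T1"
      "length ms = card (multi_vertices C T1)"
    using assms(7,9,10) distinct_card[of ts] distinct_card[of ls] distinct_card[of ms]
    by (simp_all add: enumerates_def)
  have "int (h_term d C) = int (length ts * (d + 1)) - int (mrank (conformality_mat d ts tvs))"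
    using h_term_plus_mrank[OF assms(7,8), of d] by linarith
  with corank_regular_partition[OF part assms(7-9) vs]
    corank_condensed_coupling[OF T1 long assms(9-12)]
  show ?thesis unfolding cards by blast
qed

end
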